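(* Let $\mathbb X=(X,\tau,\mathsf d,\mathfrak m)$ be an extended metric-topological measure space. Let $p,q\in(1,\infty)$ be conjugate exponents. Define the closed vector subspace $\mathbb B_{\mathbb X,q}$ of $L^q(\mathfrak m)\times_q L^q_{\mathrm{Lip}}(T\mathbb X)$ as the closure of its vector subspace $$\big\{(g,b)\in L^q(\mathfrak m)\times\mathrm{Der}^q_q(\mathbb X)\ :\ g=\mathrm{div}(b)\big\}.$$ Then $W^{1,p}(\mathbb X)$ is isometrically isomorphic to the dual of the quotient Banach space $\big(L^q(\mathfrak m)\times_q L^q_{\mathrm{Lip}}(T\mathbb X)\big)/\mathbb B_{\mathbb X,q}$.
   Context: An extended distance on a set $X$ is a symmetric function $\mathsf d\colon X\times X\to[0,+\infty]$ satisfying the triangle inequality and with $\mathsf d(x,y)=0$ iff $x=y$. For $f\colon X\to\mathbb R$ and $A\subseteq X$, $\mathrm{Lip}(f,A,\mathsf d)=\sup\{|f(x)-f(y)|/\mathsf d(x,y):x,y\in A,\ x\neq y\}$ (with $c/(+\infty)=0$, $\sup\varnothing=0$), $\mathrm{Lip}(f,\mathsf d)=\mathrm{Lip}(f,X,\mathsf d)$. $\mathrm{Lip}_b(X,\tau,\mathsf d)$ is the algebra of bounded $\tau$-continuous $\mathsf d$-Lipschitz functions $f\colon X\to\mathbb R$. $(X,\tau,\mathsf d)$ is an extended metric-topological space if $\tau$ is Hausdorff, $\mathsf d$ is an extended distance, $\tau$ is the initial topology of $\mathrm{Lip}_b(X,\tau,\mathsf d)$, and $\mathsf d(x,y)=\sup\{|f(x)-f(y)|:f\in\mathrm{Lip}_b(X,\tau,\mathsf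 d),\ \mathrm{Lip}(f,\mathsf d)\leq 1\}$ for all $x,y$. It becomes an extended metric-topological measure space when equipped with a finite Radon (inner regular with respect to $\tau$-compact sets) measure $\mathfrak m$ on the Borel sets of $\tau$. The asymptotic slope of $f\in\mathrm{Lip}_b(X,\tau,\mathsf d)$ is $\mathrm{lip}_{\mathsf d}(f)(x)=\inf\{\mathrm{Lip}(f,U,\mathsf d):x\in U\in\tau\}$. $\bigwedge$ denotes the $\mathfrak m$-essential infimum; a superscript $+$ denotes nonnegative elements; $L^0(\mathfrak m)$ is the algebra of real-valued $\tau$-Borel functions up to $\mathfrak m$-a.e. equality. A Lipschitz derivation on $\mathbb X$ is a linear map $b\colon\mathrm{Lip}_b(X,\tau,\mathsf d)\to L^0(\mathfrak m)$ with $b(fg)=f\,b(g)+g\,b(f)$ for all $f,g$; $hb$ denotes $f\mapsto h\,b(f)$. $b$ has divergence if $b(f)\in L^1(\mathfrak m)$ for every $f$ and there is a (unique) $\mathrm{div}(b)\in L^1(\mathfrak m)$ with $\int b(f)\,d\mathfrak m=-\int f\,\mathrm{div}(b)\,d\mathfrak m$ for every $f\in\mathrm{Lip}_b(X,\tau,\mathsf d)$. $\mathrm{Der}^q(\mathbb X)$ is the set of Lipschitz derivations $b$ for which there is $g\in L^q(\mathfrak m)^+$ with $|b(f)|\leq g\,\mathrm{lip}_{\mathsf d}(f)$ $\mathfrak m$-a.e. for every $f$; $|b|$ is the $\mathfrak m$-essential infimum of all such $g$. $\mathrm{Der}^q(\mathbb X)$ is a Banach space with norm $\|b\|_{\mathrm{Der}^q(\mathbb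 X)}=\||b|\|_{L^q(\mathfrak m)}$. $\mathrm{Der}^q_q(\mathbb X)$ is the set of $b\in\mathrm{Der}^q(\mathbb X)$ having divergence with $\mathrm{div}(b)\in L^q(\mathfrak m)$, and $L^q_{\mathrm{Lip}}(T\mathbb X)$ is the closure of $\mathrm{Der}^q_q(\mathbb X)$ in $\mathrm{Der}^q(\mathbb X)$, with the norm of $\mathrm{Der}^q(\mathbb X)$. $W^{1,p}(\mathbb X)$ is the set of $f\in L^p(\mathfrak m)$ for which there is a (necessarily unique) linear operator $L_f\colon\mathrm{Der}^q_q(\mathbb X)\to L^1(\mathfrak m)$ such that: (i) there is $g\in L^p(\mathfrak m)^+$ with $|L_f(b)|\leq g|b|$ for every $b\in\mathrm{Der}^q_q(\mathbb X)$; (ii) $L_f(hb)=h\,L_f(b)$ for every $h\in\mathrm{Lip}_b(X,\tau,\mathsf d)$ and $b\in\mathrm{Der}^q_q(\mathbb X)$; (iii) $\int L_f(b)\,d\mathfrak m=-\int f\,\mathrm{div}(b)\,d\mathfrak m$ for every $b\in\mathrm{Der}^q_q(\mathbb X)$. For $f\in W^{1,p}(\mathbb X)$, $|Df|=\bigwedge\{g\in L^p(\mathfrak m)^+:|L_f(b)|\leq g|b|\ \forall b\in\mathrm{Der}^q_q(\mathbb X)\}$, and $W^{1,p}(\mathbb X)$ is a Banach space with norm $\|f\|_{W^{1,p}(\mathbb X)}=(\|f\|_{L^p(\mathfrak m)}^p+\||Df|\|_{L^p(\mathfrak m)}^p)^{1/p}$. For Banach spaces $\mathbb B,\mathbb V$,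 $\mathbb B\times_q\mathbb V$ denotes $\mathbb B\times\mathbb V$ with the norm $\|(v,w)\|_q=(\|v\|_{\mathbb B}^q+\|w\|_{\mathbb V}^q)^{1/q}$. Isometrically isomorphic means that there is a norm-preserving linear homeomorphism. *)

theory Defs
  imports "HOL-Analysis.Analysis"
begin

section \<open>Normed spaces on a carrier set\<close>

text \<open>The Banach spaces below depend on a topology, a distance and a measure, so they are given as
  records with a carrier set. The zero vector is the multiple of any vector by the scalar 0.\<close>

record 'v nspace =
  nvec :: "'v set"
  nadd :: "'v \<Rightarrow> 'v \<Rightarrow> 'v"
  nscale :: "real \<Rightarrow> 'v \<Rightarrow> 'v"
  nnorm :: "'v \<Rightarrow> real"

text \<open>The distance is cut off outside the carrier because \<^locale>\<open>Metric_space\<close> requires nonnegativity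
  and symmetry on the whole type.\<close>

definition ndist :: "'v nspace \<Rightarrow> 'v \<Rightarrow> 'v \<Rightarrow> real" where
  "ndist V x y =
    (if x \<in> nvec V \<and> y \<in> nvec V then nnorm V (nadd V x (nscale V (- 1) y)) else 0)"

definition ntopology :: "'v nspace \<Rightarrow> 'v topology" where
  "ntopology V = Metric_space.mtopology (nvec V) (ndist V)"

definition linear_between :: "'v nspace \<Rightarrow> 'w nspace \<Rightarrow> ('v \<Rightarrow> 'w) \<Rightarrow> bool" where
  "linear_between V W \<Phi> \<longleftrightarrow>
    (\<forall>x\<in>nvec V. \<Phi> x \<in> nvec W) \<and>
    (\<forall>x\<in>nvec V. \<forall>y\<in>nvec V. \<Phi> (nadd V x y) = nadd W (\<Phi> x) (\<Phi> y)) \<and>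
    (\<forall>c. \<forall>x\<in>nvec V. \<Phi> (nscale V c x) = nscale W c (\<Phi> x))"

definition isometrically_isomorphic :: "'v nspace \<Rightarrow> 'w nspace \<Rightarrow> bool" where
  "isometrically_isomorphic V W \<longleftrightarrow>
    (\<exists>\<Phi>. linear_between V W \<Phi> \<and>
         homeomorphic_map (ntopology V) (ntopology W) \<Phi> \<and>
         (\<forall>x\<in>nvec V. nnorm W (\<Phi> x) = nnorm V x))"

definition real_nspace :: "real nspace" where
  "real_nspace = \<lparr>nvec = UNIV, nadd = (+), nscale = (*), nnorm = abs\<rparr>"

definition prod_nspace :: "real \<Rightarrow> 'v nspace \<Rightarrow> 'w nspace \<Rightarrow> ('v \<times> 'w) nspace" where
  "prod_nspace q V W =
    \<lparr>nvec = nvec V \<times> nvec W,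
     nadd = (\<lambda>(v, w) (v', w'). (nadd V v v', nadd W w w')),
     nscale = (\<lambda>c (v, w). (nscale V c v, nscale W c w)),
     nnorm = (\<lambda>(v, w). (nnorm V v powr q + nnorm W w powr q) powr (1 / q))\<rparr>"

definition quotient_nspace :: "'v nspace \<Rightarrow> 'v set \<Rightarrow> 'v set nspace" where
  "quotient_nspace V B =
    \<lparr>nvec = (\<lambda>v. nadd V v ` B) ` nvec V,
     nadd = (\<lambda>C D. {nadd V v w |v w. v \<in> C \<and> w \<in> D}),
     nscale = (\<lambda>c C. {nadd V (nscale V c v) w |v w. v \<in> C \<and> w \<in> B}),
     nnorm = (\<lambda>C. INF v\<in>C. nnorm V v)\<rparr>"

text \<open>Functionals are extensional, so that equality in the dual is equality on the carrier.\<close>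

definition dual_nspace :: "'v nspace \<Rightarrow> ('v \<Rightarrow> real) nspace" where
  "dual_nspace V =
    \<lparr>nvec = {\<phi> \<in> extensional (nvec V). linear_between V real_nspace \<phi> \<and>
               (\<exists>C. \<forall>v\<in>nvec V. \<bar>\<phi> v\<bar> \<le> C * nnorm V v)},
     nadd = (\<lambda>\<phi> \<psi>. \<lambda>v\<in>nvec V. \<phi> v + \<psi> v),
     nscale = (\<lambda>c \<phi>. \<lambda>v\<in>nvec V. c * \<phi> v),
     nnorm = (\<lambda>\<phi>. SUP v\<in>{v \<in> nvec V. nnorm V v \<le> 1}. \<bar>\<phi> v\<bar>)\<rparr>"


section \<open>Extended metric-topological measure spaces\<close>

text \<open>The underlying set is \<^term>\<open>topspace T\<close>; values of the distance off this set are irrelevant.\<close>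

definition extended_distance_on :: "'a set \<Rightarrow> ('a \<Rightarrow> 'a \<Rightarrow> ennreal) \<Rightarrow> bool" where
  "extended_distance_on X d \<longleftrightarrow>
    (\<forall>x\<in>X. \<forall>y\<in>X. d x y = d y x) \<and>
    (\<forall>x\<in>X. \<forall>y\<in>X. \<forall>z\<in>X. d x z \<le> d x y + d y z) \<and>
    (\<forall>x\<in>X. \<forall>y\<in>X. d x y = 0 \<longleftrightarrow> x = y)"

text \<open>In \<^typ>\<open>ennreal\<close> division by \<^term>\<open>top\<close> gives 0, and so does the supremum of the empty set.\<close>

definition Lip :: "('a \<Rightarrow> 'a \<Rightarrow> ennreal) \<Rightarrow> ('a \<Rightarrow> real) \<Rightarrow> 'a set \<Rightarrow> ennreal" where
  "Lip d f A = (SUP (x, y)\<in>{(x, y). x \<in> A \<and> y \<in> A \<and> x \<noteq> y}. ennreal \<bar>f x - f y\<bar> / d x y)"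

text \<open>A real function on the space is represented by its extension by 0 to the whole type. These
  extensions are closed under pointwise sums, multiples and products.\<close>

definition Lipb :: "'a topology \<Rightarrow> ('a \<Rightarrow> 'a \<Rightarrow> ennreal) \<Rightarrow> ('a \<Rightarrow> real) set" where
  "Lipb T d = {f. (\<forall>x. x \<notin> topspace T \<longrightarrow> f x = 0) \<and>
                  bounded (f ` topspace T) \<and>
                  continuous_map T euclideanreal f \<and>
                  Lip d f (topspace T) < \<infinity>}"

definition extended_metric_topological_space ::
    "'a topology \<Rightarrow> ('a \<Rightarrow> 'a \<Rightarrow> ennreal) \<Rightarrow> bool" where
  "extended_metric_topological_space T d \<longleftrightarrow>
    Hausdorff_space T \<and>
    extended_distance_on (topspace T) d \<and>
    T = topology_generated_by {{x \<in> topspace T. f x \<in> U} |f U. f \<in> Lipb T d \<and> open U} \<and>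
    (\<forall>x\<in>topspace T. \<forall>y\<in>topspace T.
      d x y = (SUP f\<in>{f \<in> Lipb T d. Lip d f (topspace T) \<le> 1}. ennreal \<bar>f x - f y\<bar>))"

definition finite_Radon_measure :: "'a topology \<Rightarrow> 'a measure \<Rightarrow> bool" where
  "finite_Radon_measure T M \<longleftrightarrow>
    space M = topspace T \<and>
    sets M = sigma_sets (topspace T) {U. openin T U} \<and>
    finite_measure M \<and>
    (\<forall>A\<in>sets M. emeasure M A = (SUP K\<in>{K. compactin T K \<and> K \<subseteq> A}. emeasure M K))"

definition emtm_space :: "'a topology \<Rightarrow> ('a \<Rightarrow> 'a \<Rightarrow> ennreal) \<Rightarrow> 'a measure \<Rightarrow> bool" where
  "emtm_space T d M \<longleftrightarrow> extended_metric_topological_space T d \<and> finite_Radon_measure T M"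

definition asymptotic_slope ::
    "'a topology \<Rightarrow> ('a \<Rightarrow> 'a \<Rightarrow> ennreal) \<Rightarrow> ('a \<Rightarrow> real) \<Rightarrow> 'a \<Rightarrow> ennreal" where
  "asymptotic_slope T d f x = (INF U\<in>{U. openin T U \<and> x \<in> U}. Lip d f U)"


section \<open>Almost everywhere equivalence classes\<close>

type_synonym 'a aeclass = "('a \<Rightarrow> real) set"

definition ae_class :: "'a measure \<Rightarrow> ('a \<Rightarrow> real) \<Rightarrow> 'a aeclass" where
  "ae_class M f = {g \<in> borel_measurable M. AE x in M. g x = f x}"

definition L0 :: "'a measure \<Rightarrow> 'a aeclass set" where
  "L0 M = ae_class M ` borel_measurable M"

text \<open>Operations on classes are defined on an arbitrary representative; the results do not depend
  on it.\<close>

definition rep :: "'a aeclass \<Rightarrow> 'a \<Rightarrow> real" where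
  "rep u = (SOME f. f \<in> u)"

definition L0_add :: "'a measure \<Rightarrow> 'a aeclass \<Rightarrow> 'a aeclass \<Rightarrow> 'a aeclass" where
  "L0_add M u v = ae_class M (\<lambda>x. rep u x + rep v x)"

definition L0_scale :: "'a measure \<Rightarrow> real \<Rightarrow> 'a aeclass \<Rightarrow> 'a aeclass" where
  "L0_scale M c u = ae_class M (\<lambda>x. c * rep u x)"

definition L0_fmult :: "'a measure \<Rightarrow> ('a \<Rightarrow> real) \<Rightarrow> 'a aeclass \<Rightarrow> 'a aeclass" where
  "L0_fmult M h u = ae_class M (\<lambda>x. h x * rep u x)"

definition L0_le :: "'a measure \<Rightarrow> 'a aeclass \<Rightarrow> 'a aeclass \<Rightarrow> bool" where
  "L0_le M u v \<longleftrightarrow> (AE x in M. rep u x \<le> rep v x)"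

definition essential_infimum :: "'a measure \<Rightarrow> 'a aeclass set \<Rightarrow> 'a aeclass" where
  "essential_infimum M G =
    (THE u. u \<in> L0 M \<and> (\<forall>g\<in>G. L0_le M u g) \<and>
            (\<forall>v\<in>L0 M. (\<forall>g\<in>G. L0_le M v g) \<longrightarrow> L0_le M v u))"

definition Lp :: "'a measure \<Rightarrow> real \<Rightarrow> 'a aeclass set" where
  "Lp M p = {u \<in> L0 M. integrable M (\<lambda>x. \<bar>rep u x\<bar> powr p)}"

definition Lp_nonneg :: "'a measure \<Rightarrow> real \<Rightarrow> 'a aeclass set" where
  "Lp_nonneg M p = {u \<in> Lp M p. AE x in M. 0 \<le> rep u x}"

definition Lp_norm :: "'a measure \<Rightarrow> real \<Rightarrow> 'a aeclass \<Rightarrow> real" where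
  "Lp_norm M p u = (\<integral>x. \<bar>rep u x\<bar> powr p \<partial>M) powr (1 / p)"

definition Lp_nspace :: "'a measure \<Rightarrow> real \<Rightarrow> 'a aeclass nspace" where
  "Lp_nspace M p =
    \<lparr>nvec = Lp M p, nadd = L0_add M, nscale = L0_scale M, nnorm = Lp_norm M p\<rparr>"


section \<open>Lipschitz derivations\<close>

text \<open>Derivations are extensional on \<^const>\<open>Lipb\<close>, so that equality is equality of maps on
  \<^const>\<open>Lipb\<close>.\<close>

type_synonym 'a lderivation = "('a \<Rightarrow> real) \<Rightarrow> 'a aeclass"

definition derivations ::
    "'a topology \<Rightarrow> ('a \<Rightarrow> 'a \<Rightarrow> ennreal) \<Rightarrow> 'a measure \<Rightarrow> 'a lderivation set" where
  "derivations T d M = {b \<in> Lipb T d \<rightarrow>\<^sub>E L0 M.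
     (\<forall>f\<in>Lipb T d. \<forall>g\<in>Lipb T d. b (\<lambda>x. f x + g x) = L0_add M (b f) (b g)) \<and>
     (\<forall>c. \<forall>f\<in>Lipb T d. b (\<lambda>x. c * f x) = L0_scale M c (b f)) \<and>
     (\<forall>f\<in>Lipb T d. \<forall>g\<in>Lipb T d.
        b (\<lambda>x. f x * g x) = L0_add M (L0_fmult M f (b g)) (L0_fmult M g (b f)))}"

definition der_add ::
    "'a topology \<Rightarrow> ('a \<Rightarrow> 'a \<Rightarrow> ennreal) \<Rightarrow> 'a measure
      \<Rightarrow> 'a lderivation \<Rightarrow> 'a lderivation \<Rightarrow> 'a lderivation" where
  "der_add T d M b c = (\<lambda>f\<in>Lipb T d. L0_add M (b f) (c f))"

definition der_scale ::
    "'a topology \<Rightarrow> ('a \<Rightarrow> 'a \<Rightarrow> ennreal) \<Rightarrow> 'a measure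
      \<Rightarrow> real \<Rightarrow> 'a lderivation \<Rightarrow> 'a lderivation" where
  "der_scale T d M c b = (\<lambda>f\<in>Lipb T d. L0_scale M c (b f))"

definition der_fmult ::
    "'a topology \<Rightarrow> ('a \<Rightarrow> 'a \<Rightarrow> ennreal) \<Rightarrow> 'a measure
      \<Rightarrow> ('a \<Rightarrow> real) \<Rightarrow> 'a lderivation \<Rightarrow> 'a lderivation" where
  "der_fmult T d M h b = (\<lambda>f\<in>Lipb T d. L0_fmult M h (b f))"

definition is_divergence ::
    "'a topology \<Rightarrow> ('a \<Rightarrow> 'a \<Rightarrow> ennreal) \<Rightarrow> 'a measure
      \<Rightarrow> 'a lderivation \<Rightarrow> 'a aeclass \<Rightarrow> bool" where
  "is_divergence T d M b u \<longleftrightarrow>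
    u \<in> Lp M 1 \<and> (\<forall>f\<in>Lipb T d. (\<integral>x. rep (b f) x \<partial>M) = - (\<integral>x. f x * rep u x \<partial>M))"

definition has_divergence ::
    "'a topology \<Rightarrow> ('a \<Rightarrow> 'a \<Rightarrow> ennreal) \<Rightarrow> 'a measure \<Rightarrow> 'a lderivation \<Rightarrow> bool" where
  "has_divergence T d M b \<longleftrightarrow>
    (\<forall>f\<in>Lipb T d. b f \<in> Lp M 1) \<and> (\<exists>u. is_divergence T d M b u)"

definition divergence ::
    "'a topology \<Rightarrow> ('a \<Rightarrow> 'a \<Rightarrow> ennreal) \<Rightarrow> 'a measure \<Rightarrow> 'a lderivation \<Rightarrow> 'a aeclass" where
  "divergence T d M b = (THE u. is_divergence T d M b u)"

definition der_bounds ::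
    "'a topology \<Rightarrow> ('a \<Rightarrow> 'a \<Rightarrow> ennreal) \<Rightarrow> 'a measure \<Rightarrow> real
      \<Rightarrow> 'a lderivation \<Rightarrow> 'a aeclass set" where
  "der_bounds T d M q b = {g \<in> Lp_nonneg M q. \<forall>f\<in>Lipb T d.
     AE x in M. ennreal \<bar>rep (b f) x\<bar> \<le> ennreal (rep g x) * asymptotic_slope T d f x}"

definition Der ::
    "'a topology \<Rightarrow> ('a \<Rightarrow> 'a \<Rightarrow> ennreal) \<Rightarrow> 'a measure \<Rightarrow> real \<Rightarrow> 'a lderivation set" where
  "Der T d M q = {b \<in> derivations T d M. der_bounds T d M q b \<noteq> {}}"

definition der_abs ::
    "'a topology \<Rightarrow> ('a \<Rightarrow> 'a \<Rightarrow> ennreal) \<Rightarrow> 'a measure \<Rightarrow> real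
      \<Rightarrow> 'a lderivation \<Rightarrow> 'a aeclass" where
  "der_abs T d M q b = essential_infimum M (der_bounds T d M q b)"

definition Der_nspace ::
    "'a topology \<Rightarrow> ('a \<Rightarrow> 'a \<Rightarrow> ennreal) \<Rightarrow> 'a measure \<Rightarrow> real \<Rightarrow> 'a lderivation nspace" where
  "Der_nspace T d M q =
    \<lparr>nvec = Der T d M q, nadd = der_add T d M, nscale = der_scale T d M,
     nnorm = (\<lambda>b. Lp_norm M q (der_abs T d M q b))\<rparr>"

text \<open>The space written with exponent and index \<open>q\<close> on paper.\<close>

definition Der_div ::
    "'a topology \<Rightarrow> ('a \<Rightarrow> 'a \<Rightarrow> ennreal) \<Rightarrow> 'a measure \<Rightarrow> real \<Rightarrow> 'a lderivation set" where
  "Der_div T d M q =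
    {b \<in> Der T d M q. has_divergence T d M b \<and> divergence T d M b \<in> Lp M q}"

text \<open>The Lipschitz tangent module.\<close>

definition LLip_nspace ::
    "'a topology \<Rightarrow> ('a \<Rightarrow> 'a \<Rightarrow> ennreal) \<Rightarrow> 'a measure \<Rightarrow> real \<Rightarrow> 'a lderivation nspace" where
  "LLip_nspace T d M q =
    (Der_nspace T d M q)\<lparr>nvec := ntopology (Der_nspace T d M q) closure_of Der_div T d M q\<rparr>"


section \<open>The Sobolev space\<close>

definition sobolev_bounds ::
    "'a topology \<Rightarrow> ('a \<Rightarrow> 'a \<Rightarrow> ennreal) \<Rightarrow> 'a measure \<Rightarrow> real \<Rightarrow> real
      \<Rightarrow> ('a lderivation \<Rightarrow> 'a aeclass) \<Rightarrow> 'a aeclass set" where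
  "sobolev_bounds T d M p q L = {g \<in> Lp_nonneg M p. \<forall>b\<in>Der_div T d M q.
     AE x in M. \<bar>rep (L b) x\<bar> \<le> rep g x * rep (der_abs T d M q b) x}"

definition is_sobolev_operator ::
    "'a topology \<Rightarrow> ('a \<Rightarrow> 'a \<Rightarrow> ennreal) \<Rightarrow> 'a measure \<Rightarrow> real \<Rightarrow> real
      \<Rightarrow> 'a aeclass \<Rightarrow> ('a lderivation \<Rightarrow> 'a aeclass) \<Rightarrow> bool" where
  "is_sobolev_operator T d M p q f L \<longleftrightarrow>
    L \<in> Der_div T d M q \<rightarrow>\<^sub>E Lp M 1 \<and>
    (\<forall>b\<in>Der_div T d M q. \<forall>c\<in>Der_div T d M q.
       L (der_add T d M b c) = L0_add M (L b) (L c)) \<and>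
    (\<forall>a. \<forall>b\<in>Der_div T d M q. L (der_scale T d M a b) = L0_scale M a (L b)) \<and>
    sobolev_bounds T d M p q L \<noteq> {} \<and>
    (\<forall>h\<in>Lipb T d. \<forall>b\<in>Der_div T d M q. L (der_fmult T d M h b) = L0_fmult M h (L b)) \<and>
    (\<forall>b\<in>Der_div T d M q.
       (\<integral>x. rep (L b) x \<partial>M) = - (\<integral>x. rep f x * rep (divergence T d M b) x \<partial>M))"

definition sobolev_operator ::
    "'a topology \<Rightarrow> ('a \<Rightarrow> 'a \<Rightarrow> ennreal) \<Rightarrow> 'a measure \<Rightarrow> real \<Rightarrow> real
      \<Rightarrow> 'a aeclass \<Rightarrow> 'a lderivation \<Rightarrow> 'a aeclass" where
  "sobolev_operator T d M p q f = (THE L. is_sobolev_operator T d M p q f L)"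

definition sobolev_gradient ::
    "'a topology \<Rightarrow> ('a \<Rightarrow> 'a \<Rightarrow> ennreal) \<Rightarrow> 'a measure \<Rightarrow> real \<Rightarrow> real
      \<Rightarrow> 'a aeclass \<Rightarrow> 'a aeclass" where
  "sobolev_gradient T d M p q f =
    essential_infimum M (sobolev_bounds T d M p q (sobolev_operator T d M p q f))"

text \<open>The exponent \<open>q\<close> of the derivations is meant to be the conjugate of \<open>p\<close>.\<close>

definition W1p_nspace ::
    "'a topology \<Rightarrow> ('a \<Rightarrow> 'a \<Rightarrow> ennreal) \<Rightarrow> 'a measure \<Rightarrow> real \<Rightarrow> real \<Rightarrow> 'a aeclass nspace" where
  "W1p_nspace T d M p q =
    \<lparr>nvec = {f \<in> Lp M p. \<exists>L. is_sobolev_operator T d M p q f L},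
     nadd = L0_add M, nscale = L0_scale M,
     nnorm = (\<lambda>f. (Lp_norm M p f powr p +
                   Lp_norm M p (sobolev_gradient T d M p q f) powr p) powr (1 / p))\<rparr>"


section \<open>The predual\<close>

definition LqLLip_nspace ::
    "'a topology \<Rightarrow> ('a \<Rightarrow> 'a \<Rightarrow> ennreal) \<Rightarrow> 'a measure \<Rightarrow> real
      \<Rightarrow> ('a aeclass \<times> 'a lderivation) nspace" where
  "LqLLip_nspace T d M q = prod_nspace q (Lp_nspace M q) (LLip_nspace T d M q)"

definition BXq ::
    "'a topology \<Rightarrow> ('a \<Rightarrow> 'a \<Rightarrow> ennreal) \<Rightarrow> 'a measure \<Rightarrow> real
      \<Rightarrow> ('a aeclass \<times> 'a lderivation) set" where
  "BXq T d M q = ntopology (LqLLip_nspace T d M q) closure_of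
     {(g, b). g \<in> Lp M q \<and> b \<in> Der_div T d M q \<and> g = divergence T d M b}"

end

theory Submission
  imports Defs
begin

text \<open>A functional on the product that vanishes on the graph of the divergence consists of a function
  \<open>f \<in> L\<^sup>p\<close> and a functional \<open>\<Lambda>\<close> on the tangent module with \<open>\<Lambda>(b) = - \<integral> f div(b)\<close>. For fixed
  \<open>b\<close> the map \<open>h \<mapsto> \<Lambda>(h b)\<close> is bounded by \<open>\<parallel>\<Lambda>\<parallel> \<parallel>h \<bar>b\<bar>\<parallel>\<close>; since Lipschitz functions are dense it
  has a density \<open>L(b) \<in> L\<^sup>1\<close>, and the essential supremum of the ratios \<open>\<bar>L(b)\<bar> / \<bar>b\<bar>\<close> is the weak
  gradient of \<open>f\<close>. Testing with bounded combinations of derivations shows that it has the right norm.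
  Conversely \<open>f\<close> determines the functional, because the classes of the pairs \<open>(g, 0)\<close> are dense in
  the quotient: \<open>(g, b)\<close> is equivalent to \<open>(g - div(b), 0)\<close>.\<close>

section \<open>Integral norms of functions\<close>

text \<open>The delicate point is that one function must bound all ratios at once, with the sharp
  norm. Estimates for single derivations control each ratio separately; a maximum of two ratios
  would be realised by gluing two derivations along a measurable set, but such a gluing need not
  have a divergence, since only Lipschitz multiples are known to stay in \<open>Der_div\<close>. The
  gluing is therefore done on the data that the estimate sees, the density \<open>L(b)\<close> and a
  bound for the length of \<open>b\<close>, and these pass to limits of Lipschitz coefficients.
  Function part and derivation part are tested in the same pair: separate tests would bound the
  norms of \<open>f\<close> and of its gradient by \<open>K\<close> each, whereas conjugate powers
  in both slots bound the sum of the p-th powers of the two norms by \<open>K powr p\<close>.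
  Density of Lipschitz functions comes from two axioms: the formula for the distance makes them
  separate points, hence disjoint compact sets, and inner regularity supplies the compact
  sets.\<close>

lemma powr_convex_nonneg:
  fixes a b p l m :: real
  assumes "1 \<le> p" "0 \<le> a" "0 \<le> b" "0 \<le> l" "0 \<le> m" "l + m = 1"
  shows "(l * a + m * b) powr p \<le> l * a powr p + m * b powr p"
proof (cases "a = 0 \<or> b = 0")
  case True
  \<comment> \<open>At a zero endpoint the claim reduces to this inequality for the weight of the
    other point; convexity of the power is used at positive points.\<close>
  have le: "c powr p \<le> c" if "0 \<le> c" "c \<le> 1" for c :: real
    using powr_mono'[of 1 p c] that assms(1) by simp
  have lm: "l powr p \<le> l" "m powr p \<le> m" using assms by (auto intro!: le)
  show ?thesis using True
  proof
    assume "a = 0"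
    then show ?thesis using assms mult_right_mono[OF lm(2), of "b powr p"] by (simp add: powr_mult)
  next
    assume "b = 0"
    then show ?thesis using assms mult_right_mono[OF lm(1), of "a powr p"] by (simp add: powr_mult)
  qed
next
  case False
  then show ?thesis using powr_convex[OF assms(1)] assms by (simp add: convex_on_def)
qed

text \<open>Convexity of the power, with \<open>a + b\<close> written as \<open>s + t\<close> times
  a convex combination of \<open>a / s\<close> and \<open>b / t\<close>. The right side is linear in
  the two powers, so it can be summed or integrated before \<open>s\<close> and \<open>t\<close> are
  matched to the norms.\<close>

lemma powr_add_le_weighted:
  fixes a b p s t :: real
  assumes "1 \<le> p" "0 \<le> a" "0 \<le> b" "0 < s" "0 < t"
  shows "(a + b) powr p \<le>
    (s + t) powr p * (s / (s + t) * (a powr p / s powr p) + t / (s + t) * (b powr p / t powr p))"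
proof -
  have eq: "a + b = (s + t) * (s / (s + t) * (a / s) + t / (s + t) * (b / t))"
  proof -
    have "s / (s + t) * (a / s) = a / (s + t)" "t / (s + t) * (b / t) = b / (s + t)"
      using assms by simp_all
    then show ?thesis using assms by (simp add: add_divide_distrib[symmetric])
  qed
  have "(s / (s + t) * (a / s) + t / (s + t) * (b / t)) powr p
      \<le> s / (s + t) * (a / s) powr p + t / (s + t) * (b / t) powr p"
    using assms by (intro powr_convex_nonneg) (auto simp: add_divide_distrib[symmetric])
  also have "\<dots> = s / (s + t) * (a powr p / s powr p) + t / (s + t) * (b powr p / t powr p)"
    using assms by (simp add: powr_divide)
  finally have "(s + t) powr p * (s / (s + t) * (a / s) + t / (s + t) * (b / t)) powr p
      \<le> (s + t) powr p * (s / (s + t) * (a powr p / s powr p) + t / (s + t) * (b powr p / t powr p))"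
    by (intro mult_left_mono) auto
  moreover have "(a + b) powr p = (s + t) powr p * (s / (s + t) * (a / s) + t / (s + t) * (b / t)) powr p"
    using assms by (subst eq, subst powr_mult) auto
  ultimately show ?thesis by simp
qed

lemma powr_inverse_le_iff:
  fixes S s p :: real
  assumes "0 < p" "0 \<le> S" "0 \<le> s"
  shows "S powr (1 / p) \<le> s \<longleftrightarrow> S \<le> s powr p"
proof
  assume "S powr (1 / p) \<le> s"
  then have "(S powr (1 / p)) powr p \<le> s powr p" using assms by (intro powr_mono2) auto
  then show "S \<le> s powr p" using assms by (simp add: powr_powr)
next
  assume "S \<le> s powr p"
  then have "S powr (1 / p) \<le> (s powr p) powr (1 / p)" using assms by (intro powr_mono2) auto
  then show "S powr (1 / p) \<le> s" using assms by (simp add: powr_powr)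
qed

text \<open>Passage from the weighted inequality to the triangle inequality, common to integrals and
  to pairs of numbers. The ideal choice is \<open>s = S powr (1 / p)\<close> and
  \<open>t = R powr (1 / p)\<close>; adding \<open>e / 2\<close> keeps both positive when
  \<open>S\<close> or \<open>R\<close> vanishes.\<close>

lemma gauge_triangle:
  fixes S R U p :: real
  assumes "1 \<le> p" "0 \<le> S" "0 \<le> R" "0 \<le> U"
    and U: "\<And>s t. 0 < s \<Longrightarrow> 0 < t \<Longrightarrow>
      U \<le> (s + t) powr p * (s / (s + t) * (S / s powr p) + t / (s + t) * (R / t powr p))"
  shows "U powr (1 / p) \<le> S powr (1 / p) + R powr (1 / p)"
proof (rule field_le_epsilon)
  fix e :: real assume "0 < e"
  define s where "s = S powr (1 / p) + e / 2"
  define t where "t = R powr (1 / p) + e / 2"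
  have st: "0 < s" "0 < t"
    using \<open>0 < e\<close> by (auto simp: s_def t_def intro!: add_nonneg_pos)
  have "S \<le> s powr p" "R \<le> t powr p"
    using assms st \<open>0 < e\<close> powr_inverse_le_iff[of p S s] powr_inverse_le_iff[of p R t]
    by (auto simp: s_def t_def)
  then have "S / s powr p \<le> 1" "R / t powr p \<le> 1" using st by (auto simp: field_simps)
  then have "s / (s + t) * (S / s powr p) + t / (s + t) * (R / t powr p)
      \<le> s / (s + t) * 1 + t / (s + t) * 1"
    using st by (intro add_mono mult_left_mono) auto
  also have "\<dots> = 1" using st by (simp add: add_divide_distrib[symmetric])
  finally have "(s + t) powr p * (s / (s + t) * (S / s powr p) + t / (s + t) * (R / t powr p))
      \<le> (s + t) powr p * 1"
    by (intro mult_left_mono) auto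
  then have "U \<le> (s + t) powr p" using U[OF st] by simp
  then have "U powr (1 / p) \<le> s + t" using powr_inverse_le_iff[of p U "s + t"] assms st by auto
  then show "U powr (1 / p) \<le> S powr (1 / p) + R powr (1 / p) + e" by (simp add: s_def t_def)
qed

text \<open>The same optimisation for Young's inequality: with \<open>s\<close> and \<open>t\<close>
  slightly above the two norms the bracket is at most \<open>1 / p + 1 / q = 1\<close>, and the
  excess \<open>e\<close> then tends to 0.\<close>

lemma gauge_Holder:
  fixes S R U p q :: real
  assumes "1 < p" "1 < q" "1 / p + 1 / q = 1" "0 \<le> S" "0 \<le> R"
    and U: "\<And>s t. 0 < s \<Longrightarrow> 0 < t \<Longrightarrow> U \<le> s * t * (S / s powr p / p + R / t powr q / q)"
  shows "U \<le> S powr (1 / p) * R powr (1 / q)"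
proof -
  define a where "a = S powr (1 / p)"
  define b where "b = R powr (1 / q)"
  have "U \<le> (a + e) * (b + e)" if "0 < e" for e
  proof -
    define s where "s = a + e"
    define t where "t = b + e"
    have st: "0 < s" "0 < t"
      using that by (auto simp: s_def t_def a_def b_def intro!: add_nonneg_pos)
    have "S \<le> s powr p" "R \<le> t powr q"
      using assms st that powr_inverse_le_iff[of p S s] powr_inverse_le_iff[of q R t]
      by (auto simp: s_def t_def a_def b_def)
    then have "S / s powr p \<le> 1" "R / t powr q \<le> 1" using st by (auto simp: field_simps)
    then have "S / s powr p / p + R / t powr q / q \<le> 1 / p + 1 / q"
      using assms by (intro add_mono divide_right_mono) auto
    then have "s * t * (S / s powr p / p + R / t powr q / q) \<le> s * t * 1"
      using st assms by (intro mult_left_mono) auto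
    then show ?thesis using U[OF st] by (simp add: s_def t_def)
  qed
  moreover have "((\<lambda>e. (a + e) * (b + e)) \<longlongrightarrow> (a + 0) * (b + 0)) (at_right 0)"
    by (intro tendsto_intros)
  ultimately have "U \<le> (a + 0) * (b + 0)"
    by (intro tendsto_lowerbound[where F = "at_right 0"])
       (auto simp: eventually_at_right_less intro!: eventually_mono[OF eventually_at_right_less])
  then show ?thesis by (simp add: a_def b_def)
qed

text \<open>Triangle inequality in the two-dimensional l^p space: it gives the norm on a product,
  and later it splits off the approximation error of a length.\<close>

lemma Minkowski_pair:
  fixes a b c d p :: real
  assumes "1 \<le> p" "0 \<le> a" "0 \<le> b" "0 \<le> c" "0 \<le> d"
  shows "((a + c) powr p + (b + d) powr p) powr (1 / p)
    \<le> (a powr p + b powr p) powr (1 / p) + (c powr p + d powr p) powr (1 / p)"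
proof (rule gauge_triangle[OF assms(1)])
  fix s t :: real assume st: "0 < s" "0 < t"
  show "(a + c) powr p + (b + d) powr p \<le> (s + t) powr p *
     (s / (s + t) * ((a powr p + b powr p) / s powr p) + t / (s + t) * ((c powr p + d powr p) / t powr p))"
    using powr_add_le_weighted[OF assms(1,2,4) st] powr_add_le_weighted[OF assms(1,3,5) st]
    by (simp add: algebra_simps add_divide_distrib)
qed auto

text \<open>Duality of the norms on pairs: it matches the p-sum in the Sobolev norm with the q-sum
  in the product norm.\<close>

lemma Holder_pair:
  fixes a b c d p q :: real
  assumes pq: "1 < p" "1 < q" "1 / p + 1 / q = 1" and "0 \<le> a" "0 \<le> b" "0 \<le> c" "0 \<le> d"
  shows "a * c + b * d \<le> (a powr p + b powr p) powr (1 / p) * (c powr q + d powr q) powr (1 / q)"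
proof (rule gauge_Holder[OF pq])
  fix s t :: real assume st: "0 < s" "0 < t"
  have Y: "x * y \<le> s * t * (x powr p / s powr p / p + y powr q / t powr q / q)"
    if "0 \<le> x" "0 \<le> y" for x y
  proof -
    have "x * y = s * t * (x / s * (y / t))" using st by simp
    also have "\<dots> \<le> s * t * ((x / s) powr p / p + (y / t) powr q / q)"
      using st that pq by (intro mult_left_mono Youngs_inequality) auto
    finally show ?thesis using st that by (simp add: powr_divide)
  qed
  show "a * c + b * d \<le> s * t * ((a powr p + b powr p) / s powr p / p + (c powr q + d powr q) / t powr q / q)"
    using Y[of a c] Y[of b d] assms by (simp add: algebra_simps add_divide_distrib)
qed auto

section \<open>Functions with integrable powers\<close>

definition Lpf :: "'a measure \<Rightarrow> real \<Rightarrow> ('a \<Rightarrow> real) set" where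
  "Lpf M p = {f \<in> borel_measurable M. integrable M (\<lambda>x. \<bar>f x\<bar> powr p)}"

text \<open>\<open>Lpf\<close> and \<open>Npf\<close> are the function-level versions of
  \<open>Lp\<close> and \<open>Lp_norm\<close>. Estimates are carried out on functions, where sums
  and products involve no choice of representative, and are transferred to classes
  afterwards.\<close>

definition Npf :: "'a measure \<Rightarrow> real \<Rightarrow> ('a \<Rightarrow> real) \<Rightarrow> real" where
  "Npf M p f = (\<integral>x. \<bar>f x\<bar> powr p \<partial>M) powr (1 / p)"

lemma Lpf_measurable: "f \<in> Lpf M p \<Longrightarrow> f \<in> borel_measurable M"
  by (simp add: Lpf_def)

lemma Lpf_integrable: "f \<in> Lpf M p \<Longrightarrow> integrable M (\<lambda>x. \<bar>f x\<bar> powr p)"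
  by (simp add: Lpf_def)

lemma Npf_nonneg: "0 \<le> Npf M p f"
  by (simp add: Npf_def)

lemma Npf_powr: "0 < p \<Longrightarrow> Npf M p f powr p = (\<integral>x. \<bar>f x\<bar> powr p \<partial>M)"
  by (simp add: Npf_def powr_powr)

lemma Npf_cong_AE:
  assumes "AE x in M. f x = g x" "f \<in> borel_measurable M" "g \<in> borel_measurable M"
  shows "Npf M p f = Npf M p g"
  unfolding Npf_def using assms by (intro arg_cong[where f = "\<lambda>t. t powr (1 / p)"] integral_cong_AE) auto

lemma Lpf_mono:
  assumes "f \<in> Lpf M p" "h \<in> borel_measurable M" "AE x in M. \<bar>h x\<bar> \<le> \<bar>f x\<bar>" "0 < p"
  shows "h \<in> Lpf M p" "Npf M p h \<le> Npf M p f"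
proof -
  have AE: "AE x in M. \<bar>h x\<bar> powr p \<le> \<bar>f x\<bar> powr p"
    using assms(3) by eventually_elim (use assms(4) in \<open>auto intro: powr_mono2\<close>)
  have int: "integrable M (\<lambda>x. \<bar>h x\<bar> powr p)"
    using assms(2) AE by (intro Bochner_Integration.integrable_bound[OF Lpf_integrable[OF assms(1)]]) auto
  then show "h \<in> Lpf M p" using assms(2) by (simp add: Lpf_def)
  show "Npf M p h \<le> Npf M p f"
    unfolding Npf_def using assms
    by (intro powr_mono2 integral_mono_AE[OF int Lpf_integrable[OF assms(1)] AE]) auto
qed

lemma Lpf_cong_AE:
  assumes "f \<in> Lpf M p" "h \<in> borel_measurable M" "AE x in M. h x = f x" "0 < p"
  shows "h \<in> Lpf M p"
  using assms(3) by (intro Lpf_mono[OF assms(1,2) _ assms(4)]) auto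

lemma Lpf_scale:
  assumes "f \<in> Lpf M p" "0 < p"
  shows "(\<lambda>x. c * f x) \<in> Lpf M p" "Npf M p (\<lambda>x. c * f x) = \<bar>c\<bar> * Npf M p f"
proof -
  have eq: "\<bar>c * f x\<bar> powr p = \<bar>c\<bar> powr p * \<bar>f x\<bar> powr p" for x
    by (simp add: abs_mult powr_mult)
  show "(\<lambda>x. c * f x) \<in> Lpf M p"
    using assms(1) by (auto simp: Lpf_def eq)
  show "Npf M p (\<lambda>x. c * f x) = \<bar>c\<bar> * Npf M p f"
    using assms(2) unfolding Npf_def eq by (simp add: powr_mult powr_powr)
qed

lemma Lpf_add:
  assumes "f \<in> Lpf M p" "g \<in> Lpf M p" "1 \<le> p"
  shows "(\<lambda>x. f x + g x) \<in> Lpf M p" "Npf M p (\<lambda>x. f x + g x) \<le> Npf M p f + Npf M p g"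
proof -
  have [measurable]: "f \<in> borel_measurable M" "g \<in> borel_measurable M"
    using assms by (auto simp: Lpf_def)
  note i = Lpf_integrable[OF assms(1)] Lpf_integrable[OF assms(2)]
  have pw: "\<bar>f x + g x\<bar> powr p \<le> (s + t) powr p *
      (s / (s + t) * (\<bar>f x\<bar> powr p / s powr p) + t / (s + t) * (\<bar>g x\<bar> powr p / t powr p))"
    if "0 < s" "0 < t" for s t x
  proof -
    have "\<bar>f x + g x\<bar> powr p \<le> (\<bar>f x\<bar> + \<bar>g x\<bar>) powr p" using assms(3) by (intro powr_mono2) auto
    then show ?thesis using powr_add_le_weighted[OF assms(3), of "\<bar>f x\<bar>" "\<bar>g x\<bar>", OF _ _ that] by simp
  qed
  have int: "integrable M (\<lambda>x. \<bar>f x + g x\<bar> powr p)"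
  proof (rule Bochner_Integration.integrable_bound)
    \<comment> \<open>The weighted inequality at \<open>s = t = 1\<close> supplies the integrable
      majorant.\<close>
    show "integrable M (\<lambda>x. (1 + 1) powr p *
      (1 / (1 + 1) * (\<bar>f x\<bar> powr p / 1 powr p) + 1 / (1 + 1) * (\<bar>g x\<bar> powr p / 1 powr p)))"
      using i by auto
    show "AE x in M. norm (\<bar>f x + g x\<bar> powr p) \<le> norm ((1 + 1) powr p *
      (1 / (1 + 1) * (\<bar>f x\<bar> powr p / 1 powr p) + 1 / (1 + 1) * (\<bar>g x\<bar> powr p / 1 powr p)))"
    proof (intro AE_I2)
      fix x
      show "norm (\<bar>f x + g x\<bar> powr p) \<le> norm ((1 + 1) powr p *
      (1 / (1 + 1) * (\<bar>f x\<bar> powr p / 1 powr p) + 1 / (1 + 1) * (\<bar>g x\<bar> powr p / 1 powr p)))"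
        using pw[of 1 1 x] by (auto simp del: powr_one_eq_one)
    qed
  qed simp
  then show "(\<lambda>x. f x + g x) \<in> Lpf M p" by (simp add: Lpf_def)
  show "Npf M p (\<lambda>x. f x + g x) \<le> Npf M p f + Npf M p g"
    unfolding Npf_def
  proof (rule gauge_triangle[OF assms(3)])
    fix s t :: real assume st: "0 < s" "0 < t"
    have "(\<integral>x. \<bar>f x + g x\<bar> powr p \<partial>M) \<le> (\<integral>x. (s + t) powr p *
      (s / (s + t) * (\<bar>f x\<bar> powr p / s powr p) + t / (s + t) * (\<bar>g x\<bar> powr p / t powr p)) \<partial>M)"
      using i pw[OF st] by (intro integral_mono int) auto
    also have "\<dots> = (s + t) powr p * (s / (s + t) * ((\<integral>x. \<bar>f x\<bar> powr p \<partial>M) / s powr p)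
        + t / (s + t) * ((\<integral>x. \<bar>g x\<bar> powr p \<partial>M) / t powr p))"
      using i by simp
    finally show "(\<integral>x. \<bar>f x + g x\<bar> powr p \<partial>M) \<le> \<dots>" .
  qed auto
qed

lemma Lpf_diff:
  assumes "f \<in> Lpf M p" "g \<in> Lpf M p" "1 \<le> p"
  shows "(\<lambda>x. f x - g x) \<in> Lpf M p"
  using Lpf_add(1)[OF assms(1) Lpf_scale(1)[OF assms(2), of "-1"] assms(3)] assms(3) by simp

lemma Lpf_abs: "f \<in> Lpf M p \<Longrightarrow> (\<lambda>x. \<bar>f x\<bar>) \<in> Lpf M p"
  by (auto simp: Lpf_def)

lemma Lpf_1: "f \<in> Lpf M 1 \<longleftrightarrow> integrable M f"
  using integrable_abs_cancel by (auto simp: Lpf_def)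

lemma Npf_1: "Npf M 1 f = (\<integral>x. \<bar>f x\<bar> \<partial>M)"
  by (simp add: Npf_def)

lemma (in finite_measure) Lpf_bounded:
  assumes "f \<in> borel_measurable M" "\<And>x. x \<in> space M \<Longrightarrow> \<bar>f x\<bar> \<le> C" "0 < p"
  shows "f \<in> Lpf M p"
proof -
  have "(\<lambda>x. C) \<in> Lpf M p" by (simp add: Lpf_def)
  moreover have "AE x in M. \<bar>f x\<bar> \<le> \<bar>C\<bar>"
    using assms(2) by (intro AE_I2) (meson abs_ge_self order_trans)
  ultimately show ?thesis using assms by (intro Lpf_mono(1)[of "\<lambda>x. C" M p f])
qed

text \<open>Finiteness of the measure enters through the constant 1 in
  \<open>\<bar>y\<bar> \<le> 1 + \<bar>y\<bar> powr p\<close>.\<close>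

lemma (in finite_measure) Lpf_imp_integrable:
  assumes "f \<in> Lpf M p" "1 \<le> p"
  shows "integrable M f"
proof (rule Bochner_Integration.integrable_bound)
  show "integrable M (\<lambda>x. 1 + \<bar>f x\<bar> powr p)" using Lpf_integrable[OF assms(1)] by auto
  show "f \<in> borel_measurable M" using assms by (simp add: Lpf_def)
  have "\<bar>y\<bar> \<le> 1 + \<bar>y\<bar> powr p" for y :: real
    using powr_mono[of 1 p "\<bar>y\<bar>"] assms(2) by (cases "1 \<le> \<bar>y\<bar>") (auto simp: add_increasing2)
  then show "AE x in M. norm (f x) \<le> norm (1 + \<bar>f x\<bar> powr p)" by (auto simp: abs_of_nonneg)
qed

text \<open>Young's inequality for \<open>f / s\<close> and \<open>g / t\<close>: the choice
  \<open>s = t = 1\<close> gives integrability, and matching \<open>s\<close> and \<open>t\<close>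
  to the norms gives the estimate.\<close>

lemma Holder:
  assumes pq: "1 < p" "1 < q" "1 / p + 1 / q = 1" and "f \<in> Lpf M p" "g \<in> Lpf M q"
  shows "integrable M (\<lambda>x. f x * g x)" "(\<integral>x. \<bar>f x * g x\<bar> \<partial>M) \<le> Npf M p f * Npf M q g"
proof -
  have [measurable]: "f \<in> borel_measurable M" "g \<in> borel_measurable M"
    using assms by (auto simp: Lpf_def)
  note i = Lpf_integrable[OF assms(4)] Lpf_integrable[OF assms(5)]
  have pw: "\<bar>f x * g x\<bar> \<le> s * t * (\<bar>f x\<bar> powr p / s powr p / p + \<bar>g x\<bar> powr q / t powr q / q)"
    if "0 < s" "0 < t" for s t x
  proof -
    have "\<bar>f x * g x\<bar> = s * t * (\<bar>f x\<bar> / s * (\<bar>g x\<bar> / t))" using that by (simp add: abs_mult)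
    also have "\<dots> \<le> s * t * ((\<bar>f x\<bar> / s) powr p / p + (\<bar>g x\<bar> / t) powr q / q)"
      using that pq by (intro mult_left_mono Youngs_inequality) auto
    finally show ?thesis using that by (simp add: powr_divide)
  qed
  show int: "integrable M (\<lambda>x. f x * g x)"
  proof (rule Bochner_Integration.integrable_bound)
    show "integrable M (\<lambda>x. \<bar>f x\<bar> powr p / p + \<bar>g x\<bar> powr q / q)" using i by auto
    show "AE x in M. norm (f x * g x) \<le> norm (\<bar>f x\<bar> powr p / p + \<bar>g x\<bar> powr q / q)"
      using pw[of 1 1] pq by (auto intro!: AE_I2 simp: abs_of_nonneg)
  qed simp
  show "(\<integral>x. \<bar>f x * g x\<bar> \<partial>M) \<le> Npf M p f * Npf M q g"
    unfolding Npf_def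
  proof (rule gauge_Holder[OF pq])
    fix s t :: real assume st: "0 < s" "0 < t"
    have "(\<integral>x. \<bar>f x * g x\<bar> \<partial>M) \<le>
        (\<integral>x. s * t * (\<bar>f x\<bar> powr p / s powr p / p + \<bar>g x\<bar> powr q / t powr q / q) \<partial>M)"
      using i int pw[OF st] by (intro integral_mono) auto
    also have "\<dots> = s * t * ((\<integral>x. \<bar>f x\<bar> powr p \<partial>M) / s powr p / p + (\<integral>x. \<bar>g x\<bar> powr q \<partial>M) / t powr q / q)"
      using i by simp
    finally show "(\<integral>x. \<bar>f x * g x\<bar> \<partial>M) \<le> \<dots>" .
  qed auto
qed

text \<open>Dominated convergence for the p-th powers with majorant
  \<open>\<bar>w\<bar> powr p\<close>; the common source of the L^p approximations below.\<close>

lemma Npf_tendsto_0: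
  assumes "w \<in> Lpf M p" "0 < p" "\<And>n. f n \<in> borel_measurable M"
    and lim: "AE x in M. (\<lambda>n. f n x) \<longlonglongrightarrow> 0" and bd: "\<And>n. AE x in M. \<bar>f n x\<bar> \<le> \<bar>w x\<bar>"
  shows "(\<lambda>n. Npf M p (f n)) \<longlonglongrightarrow> 0"
proof -
  have "(\<lambda>n. \<integral>x. \<bar>f n x\<bar> powr p \<partial>M) \<longlonglongrightarrow> (\<integral>x. 0 \<partial>M)"
  proof (rule integral_dominated_convergence)
    show "integrable M (\<lambda>x. \<bar>w x\<bar> powr p)" by (rule Lpf_integrable) fact
    show "AE x in M. (\<lambda>n. \<bar>f n x\<bar> powr p) \<longlonglongrightarrow> 0" using lim
    proof eventually_elim
      case (elim x)
      then have "(\<lambda>n. \<bar>f n x\<bar> powr p) \<longlonglongrightarrow> \<bar>0\<bar> powr p"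
        using assms(2) by (intro tendsto_powr' tendsto_intros) auto
      then show ?case by simp
    qed
    show "AE x in M. norm (\<bar>f n x\<bar> powr p) \<le> \<bar>w x\<bar> powr p" for n
      using bd[of n] by eventually_elim (use assms(2) in \<open>auto intro: powr_mono2\<close>)
  qed (use assms in auto)
  then have "(\<lambda>n. (\<integral>x. \<bar>f n x\<bar> powr p \<partial>M) powr (1 / p)) \<longlonglongrightarrow> 0 powr (1 / p)"
    using assms(2) by (intro tendsto_powr') auto
  then show ?thesis using assms(2) by (simp add: Npf_def)
qed

lemma Npf_eq_0:
  assumes "f \<in> Lpf M p" "Npf M p f = 0" "0 < p"
  shows "AE x in M. f x = 0"
proof -
  have "(\<integral>x. \<bar>f x\<bar> powr p \<partial>M) = 0" using assms by (simp add: Npf_def)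
  then have "AE x in M. \<bar>f x\<bar> powr p = 0"
    using Lpf_integrable[OF assms(1)] by (subst (asm) integral_nonneg_eq_0_iff_AE) auto
  then show ?thesis by eventually_elim (simp add: powr_eq_0_iff)
qed

section \<open>Set functions and functionals with densities\<close>

lemma Lpf_indicator_mult:
  assumes "w \<in> Lpf M q" "A \<in> sets M" "0 < q"
  shows "(\<lambda>x. indicator A x * w x) \<in> Lpf M q"
  using assms by (intro Lpf_mono(1)[OF assms(1)]) (auto simp: Lpf_def abs_mult split: split_indicator)

lemma Npf_indicator_mono:
  assumes "w \<in> Lpf M q" "A \<in> sets M" "B \<in> sets M" "A \<subseteq> B" "0 < q"
  shows "Npf M q (\<lambda>x. indicator A x * w x) \<le> Npf M q (\<lambda>x. indicator B x * w x)"
  using assms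
  by (intro Lpf_mono(2)[OF Lpf_indicator_mult[OF assms(1,3)]])
     (auto simp: Lpf_def abs_mult split: split_indicator)

text \<open>The bound by the norm of \<open>w\<close> on \<open>A\<close> does two jobs: dominated
  convergence along a decreasing sequence with empty intersection gives countable additivity, and
  null sets get the value 0. Radon-Nikodym then applies.\<close>

lemma additive_nonneg_has_density:
  fixes \<mu> :: "'a set \<Rightarrow> real"
  assumes "finite_measure M" "w \<in> Lpf M q" "1 \<le> q"
    and nonneg: "\<And>A. A \<in> sets M \<Longrightarrow> 0 \<le> \<mu> A"
    and add: "\<And>A B. A \<in> sets M \<Longrightarrow> B \<in> sets M \<Longrightarrow> A \<inter> B = {} \<Longrightarrow> \<mu> (A \<union> B) = \<mu> A + \<mu> B"
    and bd: "\<And>A. A \<in> sets M \<Longrightarrow> \<mu> A \<le> C * Npf M q (\<lambda>x. indicator A x * w x)"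
  shows "\<exists>l. integrable M l \<and> (\<forall>A\<in>sets M. \<mu> A = (\<integral>x. indicator A x * l x \<partial>M))"
proof -
  interpret finite_measure M by fact
  define f where "f A = ennreal (\<mu> A)" for A
  have w[measurable]: "w \<in> borel_measurable M" using assms(2) by (simp add: Lpf_def)
  have "\<mu> {} = 0" using add[of "{}" "{}"] by simp
  then have pos: "positive (sets M) f" by (simp add: positive_def f_def)
  have addf: "additive (sets M) f"
    using nonneg by (auto simp: additive_def f_def add ennreal_plus)
  have ca: "countably_additive (sets M) f"
  proof (rule sets.empty_continuous_imp_countably_additive[OF pos addf])
    show "\<forall>A\<in>sets M. f A \<noteq> \<infinity>" by (simp add: f_def)
    fix A :: "nat \<Rightarrow> 'a set" assume A: "range A \<subseteq> sets M" "decseq A" "(\<Inter>i. A i) = {}"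
    have Am[measurable]: "A n \<in> sets M" for n using A by auto
    have lim0: "(\<lambda>n. Npf M q (\<lambda>x. indicator (A n) x * w x)) \<longlonglongrightarrow> 0"
    proof (rule Npf_tendsto_0[OF assms(2)])
      have "(\<lambda>n. indicator (A n) x * w x) \<longlonglongrightarrow> indicator (\<Inter>i. A i) x * w x" for x
        by (intro tendsto_mult LIMSEQ_indicator_decseq[OF A(2)] tendsto_const)
      then show "AE x in M. (\<lambda>n. indicator (A n) x * w x) \<longlonglongrightarrow> 0" by (simp add: A(3))
      show "AE x in M. \<bar>indicator (A n) x * w x\<bar> \<le> \<bar>w x\<bar>" for n
        by (auto split: split_indicator)
    qed (use assms in auto)
    have "(\<lambda>n. \<mu> (A n)) \<longlonglongrightarrow> 0"
    proof (rule tendsto_sandwich[OF _ _ tendsto_const])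
      show "(\<lambda>n. C * Npf M q (\<lambda>x. indicator (A n) x * w x)) \<longlonglongrightarrow> 0"
        using tendsto_mult[OF tendsto_const lim0, of C] by simp
      show "\<forall>\<^sub>F n in sequentially. 0 \<le> \<mu> (A n)"
        "\<forall>\<^sub>F n in sequentially. \<mu> (A n) \<le> C * Npf M q (\<lambda>x. indicator (A n) x * w x)"
        using nonneg bd by simp_all
    qed
    then show "(\<lambda>i. f (A i)) \<longlonglongrightarrow> 0" using tendsto_ennrealI by (fastforce simp: f_def)
  qed
  define N where "N = measure_of (space M) (sets M) f"
  have sN: "sets N = sets M" "space N = space M" by (simp_all add: N_def)
  have eN: "emeasure N A = f A" if "A \<in> sets M" for A
    unfolding N_def using sets.sigma_algebra_axioms pos ca that by (rule emeasure_measure_of_sigma)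
  have "finite_measure N"
    by (intro finite_measureI) (simp add: eN sN f_def)
  moreover have "absolutely_continuous M N"
    unfolding absolutely_continuous_def
  proof
    fix A assume A: "A \<in> null_sets M"
    then have "AE x in M. indicator A x * w x = 0"
      using AE_not_in[OF A] by (auto elim!: eventually_mono)
    then have "Npf M q (\<lambda>x. indicator A x * w x) = Npf M q (\<lambda>x. 0)"
      using A by (intro Npf_cong_AE) auto
    then have "\<mu> A = 0" using bd[of A] nonneg[of A] A assms(3) by (auto simp: Npf_def)
    then show "A \<in> null_sets N" using A eN[of A] by (auto simp: null_sets_def sN f_def)
  qed
  ultimately obtain h where h[measurable]: "h \<in> borel_measurable M" and hN: "density M h = N"
    using Radon_Nikodym_finite_measure[of N] sN by blast
  have hA: "(\<integral>\<^sup>+x. h x * indicator A x \<partial>M) = ennreal (\<mu> A)" if "A \<in> sets M" for A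
    using emeasure_density[OF h that] eN[OF that] by (simp add: hN f_def)
  have "(\<integral>\<^sup>+x. h x \<partial>M) = (\<integral>\<^sup>+x. h x * indicator (space M) x \<partial>M)"
    by (intro nn_integral_cong) auto
  then have "(\<integral>\<^sup>+x. h x \<partial>M) \<noteq> \<infinity>" by (simp only: hA[OF sets.top]) simp
  then have fin: "AE x in M. h x \<noteq> \<infinity>" by (intro nn_integral_noteq_infinite) auto
  \<comment> \<open>The total mass is the real number \<open>\<mu> (space M)\<close>, so the
    extended density is finite almost everywhere and may be made real.\<close>
  define l where "l = (\<lambda>x. enn2real (h x))"
  have hb: "has_bochner_integral M (\<lambda>x. indicator A x * l x) (\<mu> A)" if A: "A \<in> sets M" for A
  proof (rule has_bochner_integral_nn_integral)
    have "(\<integral>\<^sup>+x. ennreal (indicator A x * l x) \<partial>M) = (\<integral>\<^sup>+x. h x * indicator A x \<partial>M)"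
      by (intro nn_integral_cong_AE, use fin in eventually_elim)
         (auto simp: l_def less_top split: split_indicator)
    then show "(\<integral>\<^sup>+x. ennreal (indicator A x * l x) \<partial>M) = ennreal (\<mu> A)" by (simp add: hA A)
  qed (use A nonneg in \<open>auto simp: l_def\<close>)
  have "integrable M l"
    using hb[OF sets.top] by (auto simp: has_bochner_integral_iff cong: Bochner_Integration.integrable_cong)
  then show ?thesis using hb by (auto simp: has_bochner_integral_iff)
qed

text \<open>Jordan decomposition: the upper variation \<open>P\<close> and the difference
  \<open>P - \<nu>\<close> are nonnegative, additive and controlled by the same weight, so each has
  a density.\<close>

lemma additive_has_density:
  fixes \<nu> :: "'a set \<Rightarrow> real"
  assumes "finite_measure M" "w \<in> Lpf M q" "1 \<le> q"
    and add: "\<And>A B. A \<in> sets M \<Longrightarrow> B \<in> sets M \<Longrightarrow> A \<inter> B = {} \<Longrightarrow> \<nu> (A \<union> B) = \<nu> A + \<nu> B"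
    and bd: "\<And>A. A \<in> sets M \<Longrightarrow> \<bar>\<nu> A\<bar> \<le> C * Npf M q (\<lambda>x. indicator A x * w x)"
  shows "\<exists>l. integrable M l \<and> (\<forall>A\<in>sets M. \<nu> A = (\<integral>x. indicator A x * l x \<partial>M))"
proof -
  define P where "P A = (SUP B\<in>{B \<in> sets M. B \<subseteq> A}. \<nu> B)" for A
  \<comment> \<open>The given constant may be negative; enlarging the norm on the right needs a
    nonnegative one.\<close>
  define K where "K = \<bar>C\<bar>"
  have bd': "\<bar>\<nu> A\<bar> \<le> K * Npf M q (\<lambda>x. indicator A x * w x)" if "A \<in> sets M" for A
  proof -
    have "C * Npf M q (\<lambda>x. indicator A x * w x) \<le> K * Npf M q (\<lambda>x. indicator A x * w x)"
      by (intro mult_right_mono) (auto simp: K_def Npf_nonneg)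
    then show ?thesis using bd[OF that] by linarith
  qed
  have up: "\<nu> B \<le> K * Npf M q (\<lambda>x. indicator A x * w x)" if "A \<in> sets M" "B \<in> sets M" "B \<subseteq> A" for A B
  proof -
    have "\<nu> B \<le> K * Npf M q (\<lambda>x. indicator B x * w x)" using bd'[OF that(2)] by linarith
    also have "\<dots> \<le> K * Npf M q (\<lambda>x. indicator A x * w x)"
      using that assms by (intro mult_left_mono Npf_indicator_mono) (auto simp: K_def)
    finally show ?thesis .
  qed
  have bdd: "bdd_above (\<nu> ` {B \<in> sets M. B \<subseteq> A})" if "A \<in> sets M" for A
    using up[OF that] by (auto intro!: bdd_aboveI)
  have "\<nu> {} = 0" using add[of "{}" "{}"] by simp
  have le_P: "\<nu> B \<le> P A" if "A \<in> sets M" "B \<in> sets M" "B \<subseteq> A" for A B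
    unfolding P_def using that by (intro cSUP_upper bdd) auto
  have P_le: "P A \<le> c" if "A \<in> sets M" "\<And>B. B \<in> sets M \<Longrightarrow> B \<subseteq> A \<Longrightarrow> \<nu> B \<le> c" for A c
    unfolding P_def using that by (intro cSUP_least) auto
  have P_nonneg: "0 \<le> P A" if "A \<in> sets M" for A
    using le_P[OF that, of "{}"] \<open>\<nu> {} = 0\<close> by simp
  have P_add: "P (A \<union> B) = P A + P B" if AB: "A \<in> sets M" "B \<in> sets M" "A \<inter> B = {}" for A B
  proof (rule antisym)
    show "P (A \<union> B) \<le> P A + P B"
    proof (rule P_le)
      fix D assume D: "D \<in> sets M" "D \<subseteq> A \<union> B"
      have "\<nu> ((D \<inter> A) \<union> (D \<inter> B)) = \<nu> (D \<inter> A) + \<nu> (D \<inter> B)" using AB D by (intro add) auto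
      moreover have "(D \<inter> A) \<union> (D \<inter> B) = D" using D by auto
      moreover have "\<nu> (D \<inter> A) \<le> P A" "\<nu> (D \<inter> B) \<le> P B" using AB D by (auto intro!: le_P)
      ultimately show "\<nu> D \<le> P A + P B" by simp
    qed (use AB in auto)
    \<comment> \<open>The supremum is taken in one variable at a time: over the subsets of
      \<open>B\<close> with \<open>D\<close> fixed, and then over \<open>D\<close>.\<close>
    have "\<nu> D + P B \<le> P (A \<union> B)" if D: "D \<in> sets M" "D \<subseteq> A" for D
    proof -
      have "P B \<le> P (A \<union> B) - \<nu> D"
      proof (rule P_le)
        fix E assume E: "E \<in> sets M" "E \<subseteq> B"
        have "\<nu> (D \<union> E) = \<nu> D + \<nu> E" using AB D E by (intro add) auto
        moreover have "\<nu> (D \<union> E) \<le> P (A \<union> B)" using AB D E by (intro le_P) auto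
        ultimately show "\<nu> E \<le> P (A \<union> B) - \<nu> D" by simp
      qed fact
      then show ?thesis by simp
    qed
    then have "P A \<le> P (A \<union> B) - P B" using AB by (intro P_le) (auto simp: le_diff_eq)
    then show "P A + P B \<le> P (A \<union> B)" by simp
  qed
  have "\<exists>l. integrable M l \<and> (\<forall>A\<in>sets M. P A = (\<integral>x. indicator A x * l x \<partial>M))"
    using P_nonneg P_add up by (intro additive_nonneg_has_density[OF assms(1-3), where C = K] P_le) auto
  then obtain l1 where l1: "integrable M l1" "\<forall>A\<in>sets M. P A = (\<integral>x. indicator A x * l1 x \<partial>M)" by auto
  have "\<exists>l. integrable M l \<and> (\<forall>A\<in>sets M. P A - \<nu> A = (\<integral>x. indicator A x * l x \<partial>M))"
  proof (rule additive_nonneg_has_density[OF assms(1-3), where C = "2 * K"])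
    \<comment> \<open>\<open>P A\<close> and \<open>- \<nu> A\<close> each contribute one factor
      \<open>K\<close>.\<close>
    show "P A - \<nu> A \<le> 2 * K * Npf M q (\<lambda>x. indicator A x * w x)" if "A \<in> sets M" for A
      using P_le[OF that up[OF that]] bd'[OF that] by linarith
  qed (use le_P P_add add in auto)
  then obtain l2 where l2: "integrable M l2" "\<forall>A\<in>sets M. P A - \<nu> A = (\<integral>x. indicator A x * l2 x \<partial>M)" by auto
  have "\<nu> A = (\<integral>x. indicator A x * (l1 x - l2 x) \<partial>M)" if A: "A \<in> sets M" for A
  proof -
    have "integrable M (\<lambda>x. indicator A x * l1 x)" "integrable M (\<lambda>x. indicator A x * l2 x)"
      using integrable_mult_indicator[OF A l1(1)] integrable_mult_indicator[OF A l2(1)] by auto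
    then show ?thesis using bspec[OF l1(2) A] bspec[OF l2(2) A] by (simp add: right_diff_distrib)
  qed
  moreover have "integrable M (\<lambda>x. l1 x - l2 x)" using l1 l2 by auto
  ultimately show ?thesis by blast
qed

definition bounded_measurable :: "'a measure \<Rightarrow> ('a \<Rightarrow> real) set" where
  "bounded_measurable M = {h \<in> borel_measurable M. \<exists>K. \<forall>x\<in>space M. \<bar>h x\<bar> \<le> K}"

lemma bounded_measurableI:
  "h \<in> borel_measurable M \<Longrightarrow> (\<And>x. x \<in> space M \<Longrightarrow> \<bar>h x\<bar> \<le> K) \<Longrightarrow> h \<in> bounded_measurable M"
  by (auto simp: bounded_measurable_def)

lemma bounded_measurableE:
  assumes "h \<in> bounded_measurable M"
  obtains K where "0 \<le> K" "\<And>x. x \<in> space M \<Longrightarrow> \<bar>h x\<bar> \<le> K" "h \<in> borel_measurable M"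
proof -
  obtain K where K: "h \<in> borel_measurable M" "\<forall>x\<in>space M. \<bar>h x\<bar> \<le> K"
    using assms by (auto simp: bounded_measurable_def)
  show thesis using K by (intro that[of "max 0 K"]) (auto simp: le_max_iff_disj)
qed

lemma bounded_measurable_add:
  assumes "g \<in> bounded_measurable M" "h \<in> bounded_measurable M"
  shows "(\<lambda>x. g x + h x) \<in> bounded_measurable M"
proof -
  obtain K L where KL: "\<forall>x\<in>space M. \<bar>g x\<bar> \<le> K" "\<forall>x\<in>space M. \<bar>h x\<bar> \<le> L"
    and *: "g \<in> borel_measurable M" "h \<in> borel_measurable M"
    using assms by (auto simp: bounded_measurable_def)
  have "\<bar>g x + h x\<bar> \<le> K + L" if "x \<in> space M" for x using bspec[OF KL(1) that] bspec[OF KL(2) that] by linarith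
  then show ?thesis using * by (intro bounded_measurableI) auto
qed

lemma bounded_measurable_mult:
  assumes "g \<in> bounded_measurable M" "h \<in> bounded_measurable M"
  shows "(\<lambda>x. g x * h x) \<in> bounded_measurable M"
proof -
  obtain K L where KL: "\<forall>x\<in>space M. \<bar>g x\<bar> \<le> K" "\<forall>x\<in>space M. \<bar>h x\<bar> \<le> L"
    and *: "g \<in> borel_measurable M" "h \<in> borel_measurable M"
    using assms by (auto simp: bounded_measurable_def)
  have "\<bar>g x * h x\<bar> \<le> K * L" if "x \<in> space M" for x
  proof -
    have "\<bar>g x\<bar> \<le> K" "\<bar>h x\<bar> \<le> L" using KL that by auto
    then show ?thesis by (auto simp: abs_mult intro!: mult_mono)
  qed
  then show ?thesis using * by (intro bounded_measurableI) auto
qed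

lemma bounded_measurable_const: "(\<lambda>x. c) \<in> bounded_measurable M"
  by (intro bounded_measurableI[where K = "\<bar>c\<bar>"]) auto

lemma bounded_measurable_scale: "h \<in> bounded_measurable M \<Longrightarrow> (\<lambda>x. c * h x) \<in> bounded_measurable M"
  by (intro bounded_measurable_mult bounded_measurable_const)

lemma bounded_measurable_indicator: "A \<in> sets M \<Longrightarrow> indicator A \<in> bounded_measurable M"
  by (intro bounded_measurableI[where K = 1]) auto

lemma bounded_mult_integrable:
  assumes "h \<in> bounded_measurable M" "integrable M f"
  shows "integrable M (\<lambda>x. h x * f x)"
proof (rule bounded_measurableE[OF assms(1)])
  fix K assume K: "0 \<le> K" "\<And>x. x \<in> space M \<Longrightarrow> \<bar>h x\<bar> \<le> K" "h \<in> borel_measurable M"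
  show ?thesis
  proof (rule Bochner_Integration.integrable_bound)
    show "integrable M (\<lambda>x. K * f x)" using assms by auto
    show "AE x in M. norm (h x * f x) \<le> norm (K * f x)"
      using K by (auto simp: abs_mult intro!: mult_right_mono AE_I2)
  qed (use K assms in auto)
qed

lemma bounded_mult_Lpf:
  assumes "h \<in> bounded_measurable M" "f \<in> Lpf M q" "0 < q"
  shows "(\<lambda>x. h x * f x) \<in> Lpf M q"
proof (rule bounded_measurableE[OF assms(1)])
  fix K assume K: "0 \<le> K" "\<And>x. x \<in> space M \<Longrightarrow> \<bar>h x\<bar> \<le> K" "h \<in> borel_measurable M"
  show ?thesis
  proof (rule Lpf_mono(1)[OF Lpf_scale(1)[OF assms(2,3), of K]])
    show "AE x in M. \<bar>h x * f x\<bar> \<le> \<bar>K * f x\<bar>"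
      using K by (auto simp: abs_mult intro!: mult_right_mono AE_I2)
  qed (use K assms in \<open>auto simp: Lpf_def\<close>)
qed

text \<open>The weight \<open>w\<close> lets this lemma serve both for the dual of \<open>L\<^sup>q\<close> (with \<open>w = 1\<close>) and for
  functionals on the multiples of a fixed derivation (with \<open>w = \<bar>b\<bar>\<close>).\<close>

lemma Riesz_bounded_measurable:
  fixes F :: "('a \<Rightarrow> real) \<Rightarrow> real"
  assumes "finite_measure M" "w \<in> Lpf M q" "1 \<le> q"
    and add: "\<And>g h. g \<in> bounded_measurable M \<Longrightarrow> h \<in> bounded_measurable M \<Longrightarrow>
      F (\<lambda>x. g x + h x) = F g + F h"
    and scale: "\<And>c h. h \<in> bounded_measurable M \<Longrightarrow> F (\<lambda>x. c * h x) = c * F h"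
    and bd: "\<And>h. h \<in> bounded_measurable M \<Longrightarrow> \<bar>F h\<bar> \<le> C * Npf M q (\<lambda>x. h x * w x)"
  shows "\<exists>l. integrable M l \<and> (\<forall>h\<in>bounded_measurable M. F h = (\<integral>x. h x * l x \<partial>M))"
proof -
  interpret finite_measure M by fact
  have w[measurable]: "w \<in> borel_measurable M" using assms(2) by (simp add: Lpf_def)
  have "\<exists>l. integrable M l \<and> (\<forall>A\<in>sets M. F (indicator A) = (\<integral>x. indicator A x * l x \<partial>M))"
  proof (rule additive_has_density[OF assms(1-3)])
    show "\<bar>F (indicator A)\<bar> \<le> C * Npf M q (\<lambda>x. indicator A x * w x)" if "A \<in> sets M" for A
      using that by (intro bd bounded_measurable_indicator)
    show "F (indicator (A \<union> B)) = F (indicator A) + F (indicator B)"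
      if "A \<in> sets M" "B \<in> sets M" "A \<inter> B = {}" for A B
    proof -
      have "(indicator (A \<union> B) :: 'a \<Rightarrow> real) = (\<lambda>x. indicator A x + indicator B x)"
        using that(3) by (auto simp: fun_eq_iff split: split_indicator)
      then show ?thesis using that by (simp add: add bounded_measurable_indicator)
    qed
  qed
  then obtain l where l: "integrable M l" and Fl: "\<And>A. A \<in> sets M \<Longrightarrow> F (indicator A) = (\<integral>x. indicator A x * l x \<partial>M)"
    by auto
  have "F h = (\<integral>x. h x * l x \<partial>M)" if h: "h \<in> bounded_measurable M" for h
  proof (rule bounded_measurableE[OF h])
    fix K assume K: "0 \<le> K" "\<And>x. x \<in> space M \<Longrightarrow> \<bar>h x\<bar> \<le> K" and hm[measurable]: "h \<in> borel_measurable M"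
    obtain s where s: "\<And>i. simple_function M (s i)" "\<And>x. x \<in> space M \<Longrightarrow> (\<lambda>i. s i x) \<longlonglongrightarrow> h x"
      "\<And>i x. x \<in> space M \<Longrightarrow> dist (s i x) 0 \<le> 2 * dist (h x) 0"
      using borel_measurable_implies_sequence_metric[OF hm, of 0] by blast
    \<comment> \<open>Off \<open>space M\<close> the simple functions are arbitrary;
      \<open>t i\<close> is the explicit combination of indicators, equal to \<open>s i\<close> on
      the space, on which \<open>F\<close> can be evaluated term by term.\<close>
    define t where "t i x = (\<Sum>y\<in>s i ` space M. y * indicator (s i -` {y} \<inter> space M) x)" for i x
    have fin: "finite (s i ` space M)" for i using s(1) by (simp add: simple_function_def)
    have sm: "s i -` {y} \<inter> space M \<in> sets M" for i y
    proof (cases "y \<in> s i ` space M")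
    case False
    then have "s i -` {y} \<inter> space M = {}" by auto
    then show ?thesis by simp
  qed (use s(1)[of i] in \<open>auto simp: simple_function_def\<close>)
    have ts: "t i x = s i x" if "x \<in> space M" for i x
    proof -
      have "t i x = (\<Sum>y\<in>s i ` space M. if y = s i x then y else 0)"
        unfolding t_def using that by (intro sum.cong) (auto split: split_indicator)
      then show ?thesis using that fin by simp
    qed
    \<comment> \<open>Induction over the finite set of values extends additivity of \<open>F\<close>
      from two summands to the whole combination.\<close>
    have part: "(\<lambda>x. \<Sum>y\<in>Y. y * indicator (s i -` {y} \<inter> space M) x) \<in> bounded_measurable M \<and>
       F (\<lambda>x. \<Sum>y\<in>Y. y * indicator (s i -` {y} \<inter> space M) x) =
       (\<integral>x. (\<Sum>y\<in>Y. y * indicator (s i -` {y} \<inter> space M) x) * l x \<partial>M)" if "finite Y" for Y i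
      using that
    proof induction
      case empty
      have "F (\<lambda>x. 0 * (0::real)) = 0" by (subst scale) (auto intro: bounded_measurable_const)
      then show ?case using bounded_measurable_const[of 0 M] by simp
    next
      case (insert y Y)
      let ?S = "\<lambda>x. \<Sum>y\<in>Y. y * indicator (s i -` {y} \<inter> space M) x :: real"
      let ?I = "indicator (s i -` {y} \<inter> space M) :: 'a \<Rightarrow> real"
      have S: "?S \<in> bounded_measurable M" "F ?S = (\<integral>x. ?S x * l x \<partial>M)" using insert by auto
      have I: "?I \<in> bounded_measurable M" "F ?I = (\<integral>x. ?I x * l x \<partial>M)"
        using sm by (auto intro!: bounded_measurable_indicator Fl)
      have eq: "(\<Sum>y\<in>insert y Y. y * indicator (s i -` {y} \<inter> space M) x) = y * ?I x + ?S x" for x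
        by (simp only: sum.insert[OF insert.hyps])
      note SI = bounded_mult_integrable[OF S(1) l] bounded_mult_integrable[OF I(1) l]
      have "(\<integral>x. (y * ?I x + ?S x) * l x \<partial>M) = (\<integral>x. y * (?I x * l x) + ?S x * l x \<partial>M)"
        by (simp add: algebra_simps)
      also have "\<dots> = y * (\<integral>x. ?I x * l x \<partial>M) + (\<integral>x. ?S x * l x \<partial>M)"
        using SI by (subst Bochner_Integration.integral_add) auto
      finally have "(\<integral>x. (y * ?I x + ?S x) * l x \<partial>M) = F (\<lambda>x. y * ?I x + ?S x)"
        using S I by (simp add: add scale bounded_measurable_scale)
      moreover have "(\<lambda>x. y * ?I x + ?S x) \<in> bounded_measurable M"
        using S I by (intro bounded_measurable_add bounded_measurable_scale)
      ultimately show ?case unfolding eq by (simp only: simp_thms)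
    qed
    have t: "t i \<in> bounded_measurable M" "F (t i) = (\<integral>x. t i x * l x \<partial>M)" for i
      using part[OF fin[of i], of i] by (auto simp: t_def[abs_def])
    have tbd: "\<bar>t i x\<bar> \<le> 2 * K" if "x \<in> space M" for i x
      using s(3)[OF that, of i] K(2)[OF that] by (simp add: ts[OF that])
    have lim1: "(\<lambda>i. \<integral>x. t i x * l x \<partial>M) \<longlonglongrightarrow> (\<integral>x. h x * l x \<partial>M)"
    proof (rule integral_dominated_convergence)
      show "integrable M (\<lambda>x. 2 * K * \<bar>l x\<bar>)" using l by auto
      show "AE x in M. (\<lambda>i. t i x * l x) \<longlonglongrightarrow> h x * l x"
        by (intro AE_I2 tendsto_mult tendsto_const) (simp add: ts s)
      show "AE x in M. norm (t i x * l x) \<le> 2 * K * \<bar>l x\<bar>" for i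
        using tbd by (auto simp: abs_mult intro!: AE_I2 mult_right_mono)
    qed (use bounded_mult_integrable[OF t(1) l] bounded_mult_integrable[OF h l] in auto)
    define r where "r i x = h x + - 1 * t i x" for i x
    have r: "r i \<in> bounded_measurable M" for i
      unfolding r_def[abs_def] by (intro bounded_measurable_add h bounded_measurable_scale t)
    have "(\<lambda>i. Npf M q (\<lambda>x. r i x * w x)) \<longlonglongrightarrow> 0"
    proof (rule Npf_tendsto_0)
      show "(\<lambda>x. (3 * K) * w x) \<in> Lpf M q" using assms by (intro Lpf_scale) auto
      show "(\<lambda>x. r i x * w x) \<in> borel_measurable M" for i
        using r[of i] by (auto simp: bounded_measurable_def)
      have "(\<lambda>i. r i x * w x) \<longlonglongrightarrow> (h x + - 1 * h x) * w x" if "x \<in> space M" for x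
        unfolding r_def by (intro tendsto_intros) (simp add: ts s that)
      then show "AE x in M. (\<lambda>i. r i x * w x) \<longlonglongrightarrow> 0" by auto
      \<comment> \<open>\<open>K\<close> bounds \<open>h\<close>, and \<open>2 * K\<close> bounds
        the simple functions, whose distance to 0 is at most twice that of \<open>h\<close>.\<close>
      have "\<bar>r i x\<bar> \<le> \<bar>3 * K\<bar>" if "x \<in> space M" for i x
        using tbd[OF that, of i] K(2)[OF that] unfolding r_def by linarith
      then show "AE x in M. \<bar>r i x * w x\<bar> \<le> \<bar>3 * K * w x\<bar>" for i
        unfolding abs_mult[of _ "w _"] by (intro AE_I2 mult_right_mono) simp_all
    qed (use assms in auto)
    then have "(\<lambda>i. C * Npf M q (\<lambda>x. r i x * w x)) \<longlonglongrightarrow> C * 0" by (intro tendsto_intros)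
    then have lim2: "(\<lambda>i. C * Npf M q (\<lambda>x. r i x * w x)) \<longlonglongrightarrow> 0" by simp
    have "(\<lambda>i. F (r i)) \<longlonglongrightarrow> 0"
    proof (rule Lim_null_comparison[OF _ lim2])
      show "\<forall>\<^sub>F i in sequentially. norm (F (r i)) \<le> C * Npf M q (\<lambda>x. r i x * w x)"
        unfolding real_norm_def by (intro always_eventually allI bd r)
    qed
    moreover have "F (r i) = F h - F (t i)" for i
    proof -
      have "F (r i) = F h + F (\<lambda>x. - 1 * t i x)"
        unfolding r_def by (intro add h bounded_measurable_scale t)
      then show ?thesis using scale[OF t(1), of "- 1"] by simp
    qed
    ultimately have "(\<lambda>i. F h - (F h - F (t i))) \<longlonglongrightarrow> F h - 0" by (intro tendsto_diff tendsto_const) simp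
    then have "(\<lambda>i. \<integral>x. t i x * l x \<partial>M) \<longlonglongrightarrow> F h" by (simp add: t(2))
    then show ?thesis using lim1 LIMSEQ_unique by blast
  qed
  then show ?thesis using l by auto
qed

text \<open>Exhaustion argument. A maximising sequence, made increasing by running maxima, has a
  limit whose integral is the supremum \<open>s\<close> of all integrals. Joining one more member
  \<open>G'\<close> to the sequence can enlarge the limit but not its integral, so \<open>G'\<close>
  was already below it almost everywhere.\<close>

lemma ex_ess_sup:
  fixes S :: real
  assumes "\<G> \<noteq> {}" "\<And>G. G \<in> \<G> \<Longrightarrow> integrable M G" "\<And>G x. G \<in> \<G> \<Longrightarrow> 0 \<le> G x"
    and mx: "\<And>G H. G \<in> \<G> \<Longrightarrow> H \<in> \<G> \<Longrightarrow> (\<lambda>x. max (G x) (H x)) \<in> \<G>"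
    and S: "\<And>G. G \<in> \<G> \<Longrightarrow> (\<integral>x. G x \<partial>M) \<le> S"
  shows "\<exists>g. integrable M g \<and> (\<forall>x. 0 \<le> g x) \<and> (\<integral>x. g x \<partial>M) \<le> S \<and> (\<forall>G\<in>\<G>. AE x in M. G x \<le> g x)"
proof -
  define s where "s = (SUP G\<in>\<G>. \<integral>x. G x \<partial>M)"
  have bdd: "bdd_above ((\<lambda>G. \<integral>x. G x \<partial>M) ` \<G>)" using S by (auto intro!: bdd_aboveI)
  have les: "(\<integral>x. G x \<partial>M) \<le> s" if "G \<in> \<G>" for G
    unfolding s_def using that by (intro cSUP_upper bdd)
  have sS: "s \<le> S" unfolding s_def using assms by (intro cSUP_least) auto
  have "\<exists>G\<in>\<G>. s - 1 / real (Suc n) < (\<integral>x. G x \<partial>M)" for n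
    using less_cSUP_iff[OF assms(1) bdd, of "s - 1 / real (Suc n)"] unfolding s_def by simp
  then obtain G where G: "\<And>n. G n \<in> \<G>" "\<And>n. s - 1 / real (Suc n) < (\<integral>x. G n x \<partial>M)" by metis
  define H where "H = rec_nat (G 0) (\<lambda>n h x. max (h x) (G (Suc n) x))"
  have H0: "H 0 = G 0" and HS: "H (Suc n) = (\<lambda>x. max (H n x) (G (Suc n) x))" for n
    by (simp_all add: H_def)
  have HG: "H n \<in> \<G>" for n by (induction n) (auto simp: H0 HS G mx)
  have GH: "G n x \<le> H n x" for n x by (cases n) (auto simp: H0 HS)
  have Hinc: "H n x \<le> H (Suc n) x" for n x by (auto simp: HS)
  have s0: "0 \<le> s" using les[OF G(1)[of 0]] assms(3)[OF G(1)[of 0]] by (meson Bochner_Integration.integral_nonneg order_trans)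
  \<comment> \<open>The limit is recorded with its minimality among pointwise bounds, because two
    such limits, with and without an extra member, have to be compared later.\<close>
  have lim: "\<exists>g. integrable M g \<and> (\<forall>x. 0 \<le> g x) \<and> (\<integral>x. g x \<partial>M) \<le> s \<and> (AE x in M. \<forall>n. F n x \<le> g x)
      \<and> (AE x in M. \<forall>c. (\<forall>n. F n x \<le> c) \<longrightarrow> g x \<le> c)"
    if F: "\<And>n. F n \<in> \<G>" "\<And>n x. F n x \<le> F (Suc n) x" for F
  proof -
    have [measurable]: "F n \<in> borel_measurable M" for n using assms(2)[OF F(1)] by auto
    have int: "(\<integral>\<^sup>+x. ennreal (F n x) \<partial>M) = ennreal (\<integral>x. F n x \<partial>M)" for n
      using assms F by (intro nn_integral_eq_integral) auto
    have "(\<integral>\<^sup>+x. (SUP n. ennreal (F n x)) \<partial>M) = (SUP n. \<integral>\<^sup>+x. ennreal (F n x) \<partial>M)"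
      using F(2) by (intro nn_integral_monotone_convergence_SUP)
         (auto simp: incseq_Suc_iff le_fun_def intro: ennreal_leI)
    also have "\<dots> \<le> ennreal s" unfolding int using les[OF F(1)] by (intro SUP_least ennreal_leI)
    finally have le: "(\<integral>\<^sup>+x. (SUP n. ennreal (F n x)) \<partial>M) \<le> ennreal s" .
    then have "(\<integral>\<^sup>+x. (SUP n. ennreal (F n x)) \<partial>M) \<noteq> \<infinity>" by (auto simp: top_unique)
    then have fin: "AE x in M. (SUP n. ennreal (F n x)) \<noteq> \<infinity>" by (intro nn_integral_noteq_infinite) auto
    define g where "g x = enn2real (SUP n. ennreal (F n x))" for x
    have gm[measurable]: "g \<in> borel_measurable M" unfolding g_def[abs_def] by measurable
    have eg: "AE x in M. ennreal (g x) = (SUP n. ennreal (F n x))"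
      using fin by eventually_elim (metis ennreal_enn2real g_def infinity_ennreal_def less_top)
    have nn: "(\<integral>\<^sup>+x. ennreal (g x) \<partial>M) \<le> ennreal s" using le eg by (subst nn_integral_cong_AE) auto
    have gint: "integrable M g"
      using nn by (intro integrableI_nonneg) (auto simp: g_def order_le_less_trans)
    have "ennreal (\<integral>x. g x \<partial>M) \<le> ennreal s"
      using nn gint by (subst nn_integral_eq_integral[symmetric]) (auto simp: g_def)
    then have "(\<integral>x. g x \<partial>M) \<le> s" using s0 by simp
    moreover have "AE x in M. \<forall>n. F n x \<le> g x"
      using eg
    proof eventually_elim
      case (elim x)
      then have "ennreal (F n x) \<le> ennreal (g x)" for n by (metis SUP_upper UNIV_I)
      moreover have "0 \<le> g x" by (simp add: g_def)
      ultimately show ?case by (simp add: ennreal_le_iff)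
    qed
    moreover have "AE x in M. \<forall>c. (\<forall>n. F n x \<le> c) \<longrightarrow> g x \<le> c"
      using eg
    proof eventually_elim
      case (elim x)
      show ?case
      proof (intro allI impI)
        fix c assume c: "\<forall>n. F n x \<le> c"
        then have "0 \<le> c" using assms(3)[OF F(1)[of 0], of x] order_trans by blast
        have "ennreal (g x) \<le> ennreal c" unfolding elim using c by (intro SUP_least ennreal_leI) auto
        then show "g x \<le> c" using \<open>0 \<le> c\<close> by simp
      qed
    qed
    ultimately show ?thesis using gint by (intro exI[of _ g]) (auto simp: g_def)
  qed
  obtain g where g: "integrable M g" "\<forall>x. 0 \<le> g x" "(\<integral>x. g x \<partial>M) \<le> s" "AE x in M. \<forall>n. H n x \<le> g x"
      "AE x in M. \<forall>c. (\<forall>n. H n x \<le> c) \<longrightarrow> g x \<le> c"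
    using lim[where F = H, OF HG Hinc] by blast
  have sg: "s \<le> (\<integral>x. g x \<partial>M)"
  proof (rule field_le_epsilon)
    fix e :: real assume "0 < e"
    then obtain n where n: "1 / real (Suc n) < e" using nat_approx_posE by metis
    have "(\<integral>x. G n x \<partial>M) \<le> (\<integral>x. g x \<partial>M)"
      using g(4) 
      by (intro integral_mono_AE[OF assms(2)[OF G(1)] g(1)]) (auto elim!: eventually_mono intro: order_trans[OF GH])
    then show "s \<le> (\<integral>x. g x \<partial>M) + e" using G(2)[of n] n by linarith
  qed
  have "AE x in M. G' x \<le> g x" if G': "G' \<in> \<G>" for G'
  proof -
    have "\<exists>g. integrable M g \<and> (\<forall>x. 0 \<le> g x) \<and> (\<integral>x. g x \<partial>M) \<le> s
        \<and> (AE x in M. \<forall>n. max (H n x) (G' x) \<le> g x)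
        \<and> (AE x in M. \<forall>c. (\<forall>n. max (H n x) (G' x) \<le> c) \<longrightarrow> g x \<le> c)"
      using HG G' Hinc by (intro lim mx) (auto intro: max.coboundedI1)
    then obtain k where k: "integrable M k" "(\<integral>x. k x \<partial>M) \<le> s" "AE x in M. \<forall>n. max (H n x) (G' x) \<le> k x"
      by auto
    have gk: "AE x in M. g x \<le> k x" using g(5) k(3) by eventually_elim auto
    then have "(\<integral>x. g x \<partial>M) = (\<integral>x. k x \<partial>M)" using sg k integral_mono_AE[OF g(1) k(1) gk] by linarith
    then have "AE x in M. g x = k x" using integral_ineq_eq_0_then_AE[OF gk g(1) k(1)] by simp
    then show ?thesis using k(3) by eventually_elim auto
  qed
  then show ?thesis using g sS by (intro exI[of _ g]) auto
qed

text \<open>Stability under countable infima lets the minimal integral be attained inside the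
  family. The infimum of the minimiser and any further member has the same integral, hence agrees
  with the minimiser almost everywhere.\<close>

lemma ex_ess_inf:
  fixes \<G> :: "('a \<Rightarrow> real) set"
  assumes "\<G> \<noteq> {}" "\<And>G. G \<in> \<G> \<Longrightarrow> integrable M G" "\<And>G. G \<in> \<G> \<Longrightarrow> AE x in M. 0 \<le> G x"
    and inf: "\<And>G :: nat \<Rightarrow> _. (\<And>n. G n \<in> \<G>) \<Longrightarrow> (\<lambda>x. INF n. G n x) \<in> \<G>"
  shows "\<exists>u\<in>\<G>. \<forall>G\<in>\<G>. AE x in M. u x \<le> G x"
proof -
  define m where "m = (INF G\<in>\<G>. \<integral>x. G x \<partial>M)"
  have bdd: "bdd_below ((\<lambda>G. \<integral>x. G x \<partial>M) ` \<G>)"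
    using assms(3) by (intro bdd_belowI2[where m = 0] integral_nonneg_AE)
  have mle: "m \<le> (\<integral>x. G x \<partial>M)" if "G \<in> \<G>" for G
    unfolding m_def using that by (intro cINF_lower bdd)
  have "\<exists>G\<in>\<G>. (\<integral>x. G x \<partial>M) < m + 1 / real (Suc n)" for n
    using cINF_less_iff[OF assms(1) bdd, of "m + 1 / real (Suc n)"] unfolding m_def by simp
  then obtain G where G: "\<And>n. G n \<in> \<G>" "\<And>n. (\<integral>x. G n x \<partial>M) < m + 1 / real (Suc n)" by metis
  define u where "u x = (INF n. G n x)" for x
  have u: "u \<in> \<G>" unfolding u_def[abs_def] by (intro inf G)
  have low: "AE x in M. (\<forall>n. (INF n. F n x) \<le> F n x)" if "\<And>n. F n \<in> \<G>" for F :: "nat \<Rightarrow> _"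
  proof -
    have "AE x in M. \<forall>n. 0 \<le> F n x" using assms(3) that by (simp add: AE_all_countable)
    then show ?thesis
      by eventually_elim (auto intro!: cINF_lower bdd_belowI2[where m = 0])
  qed
  have um: "(\<integral>x. u x \<partial>M) \<le> m"
  proof (rule field_le_epsilon)
    fix e :: real assume "0 < e"
    then obtain n where n: "1 / real (Suc n) < e" using nat_approx_posE by metis
    have "(\<integral>x. u x \<partial>M) \<le> (\<integral>x. G n x \<partial>M)"
      using low[of G, OF G(1)] by (intro integral_mono_AE assms G u) (auto simp: u_def)
    then show "(\<integral>x. u x \<partial>M) \<le> m + e" using G(2)[of n] n by linarith
  qed
  have "AE x in M. u x \<le> K x" if K: "K \<in> \<G>" for K
  proof -
    \<comment> \<open>A sequence whose infimum is the minimum of \<open>u\<close> and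
      \<open>K\<close>, so that the closure assumption applies.\<close>
    define F where "F n = (if n = 0 then u else K)" for n :: nat
    have F: "F n \<in> \<G>" for n using u K by (simp add: F_def)
    define v where "v x = (INF n. F n x)" for x
    have v: "v \<in> \<G>" unfolding v_def[abs_def] by (intro inf F)
    have "AE x in M. v x \<le> u x \<and> v x \<le> K x"
      using low[of F, OF F] by eventually_elim (use F_def v_def in \<open>metis zero_neq_one\<close>)
    then have vu: "AE x in M. v x \<le> u x" and vK: "AE x in M. v x \<le> K x" by auto
    have "(\<integral>x. v x \<partial>M) = (\<integral>x. u x \<partial>M)"
      using integral_mono_AE[OF assms(2)[OF v] assms(2)[OF u] vu] mle[OF v] um by linarith
    then have "AE x in M. v x = u x"
      using integral_ineq_eq_0_then_AE[OF vu assms(2)[OF v] assms(2)[OF u]] by simp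
    then show ?thesis using vK by eventually_elim auto
  qed
  then show ?thesis using u by auto
qed

section \<open>Seminormed spaces on a carrier set\<close>

text \<open>The constant may vanish or be negative, so the test value is
  \<open>e / (\<bar>C\<bar> + 1)\<close>.\<close>

lemma abs_le_if_small:
  fixes a C :: real
  assumes "\<And>e. 0 < e \<Longrightarrow> \<bar>a\<bar> \<le> C * e"
  shows "a = 0"
proof -
  have "\<bar>a\<bar> \<le> 0 + e" if "0 < e" for e
  proof -
    have "0 < \<bar>C\<bar> + 1" by simp
    then have "0 < e / (\<bar>C\<bar> + 1)" using that by simp
    then have "\<bar>a\<bar> \<le> C * (e / (\<bar>C\<bar> + 1))" by (rule assms)
    also have "\<dots> \<le> (\<bar>C\<bar> + 1) * (e / (\<bar>C\<bar> + 1))" using that by (intro mult_right_mono) auto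
    also have "\<dots> = e" using \<open>0 < \<bar>C\<bar> + 1\<close> by simp
    finally show ?thesis by simp
  qed
  then have "\<bar>a\<bar> \<le> 0" by (rule field_le_epsilon)
  then show ?thesis by simp
qed

text \<open>Definiteness is kept separate: quotients by a subspace, and bounded functions measured
  by the norm of \<open>h w\<close>, are handled as seminormed spaces. As no zero vector is named,
  \<open>scale_zero\<close> says that all vectors share one zero multiple. Homogeneity is asked as
  an inequality; applying it to \<open>1 / c\<close> recovers equality.\<close>

locale seminormed_nspace =
  fixes V :: "'v nspace"
  assumes nonempty: "nvec V \<noteq> {}"
    and add_closed: "\<And>x y. x \<in> nvec V \<Longrightarrow> y \<in> nvec V \<Longrightarrow> nadd V x y \<in> nvec V"
    and scale_closed: "\<And>c x. x \<in> nvec V \<Longrightarrow> nscale V c x \<in> nvec V"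
    and add_assoc: "\<And>x y z. x \<in> nvec V \<Longrightarrow> y \<in> nvec V \<Longrightarrow> z \<in> nvec V \<Longrightarrow>
      nadd V (nadd V x y) z = nadd V x (nadd V y z)"
    and add_commute: "\<And>x y. x \<in> nvec V \<Longrightarrow> y \<in> nvec V \<Longrightarrow> nadd V x y = nadd V y x"
    and scale_right: "\<And>c x y. x \<in> nvec V \<Longrightarrow> y \<in> nvec V \<Longrightarrow>
      nscale V c (nadd V x y) = nadd V (nscale V c x) (nscale V c y)"
    and scale_left: "\<And>a b x. x \<in> nvec V \<Longrightarrow>
      nscale V (a + b) x = nadd V (nscale V a x) (nscale V b x)"
    and scale_scale: "\<And>a b x. x \<in> nvec V \<Longrightarrow> nscale V a (nscale V b x) = nscale V (a * b) x"
    and scale_one: "\<And>x. x \<in> nvec V \<Longrightarrow> nscale V 1 x = x"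
    and scale_zero: "\<And>x y. x \<in> nvec V \<Longrightarrow> y \<in> nvec V \<Longrightarrow> nscale V 0 x = nscale V 0 y"
    and norm_nonneg: "\<And>x. x \<in> nvec V \<Longrightarrow> 0 \<le> nnorm V x"
    and norm_triangle: "\<And>x y. x \<in> nvec V \<Longrightarrow> y \<in> nvec V \<Longrightarrow>
      nnorm V (nadd V x y) \<le> nnorm V x + nnorm V y"
    and norm_scale_le: "\<And>c x. x \<in> nvec V \<Longrightarrow> nnorm V (nscale V c x) \<le> \<bar>c\<bar> * nnorm V x"
begin

definition diff :: "'v \<Rightarrow> 'v \<Rightarrow> 'v" where "diff x y = nadd V x (nscale V (- 1) y)"

lemma diff_closed: "x \<in> nvec V \<Longrightarrow> y \<in> nvec V \<Longrightarrow> diff x y \<in> nvec V"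
  by (simp add: diff_def add_closed scale_closed)

lemma add_left_commute: "x \<in> nvec V \<Longrightarrow> y \<in> nvec V \<Longrightarrow> z \<in> nvec V \<Longrightarrow>
    nadd V x (nadd V y z) = nadd V y (nadd V x z)"
  by (metis add_assoc add_commute)

lemmas add_ac = add_assoc add_commute add_left_commute

lemma add_zero: "x \<in> nvec V \<Longrightarrow> y \<in> nvec V \<Longrightarrow> nadd V x (nscale V 0 y) = x"
  by (metis add.right_neutral scale_left scale_one scale_zero)

lemma zero_add: "x \<in> nvec V \<Longrightarrow> y \<in> nvec V \<Longrightarrow> nadd V (nscale V 0 y) x = x"
  by (metis add_zero add_commute scale_closed)

lemma add_minus: "x \<in> nvec V \<Longrightarrow> nadd V x (nscale V (- 1) x) = nscale V 0 x"
  by (metis add.right_inverse scale_left scale_one)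

lemma norm_scale: "x \<in> nvec V \<Longrightarrow> nnorm V (nscale V c x) = \<bar>c\<bar> * nnorm V x"
proof (rule antisym[OF norm_scale_le])
  assume x: "x \<in> nvec V"
  show "\<bar>c\<bar> * nnorm V x \<le> nnorm V (nscale V c x)"
  proof (cases "c = 0")
    case True
    then show ?thesis using norm_nonneg[OF scale_closed[OF x]] by simp
  next
    case False
    then have "x = nscale V (1 / c) (nscale V c x)" using x by (simp add: scale_scale scale_one)
    then have "nnorm V x \<le> \<bar>1 / c\<bar> * nnorm V (nscale V c x)"
      using norm_scale_le[OF scale_closed[OF x, of c], of "1 / c"] by simp
    then show ?thesis using False by (simp add: field_simps)
  qed
qed

lemma norm_zero: "x \<in> nvec V \<Longrightarrow> nnorm V (nscale V 0 x) = 0"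
  by (simp add: norm_scale)

lemma diff_minus: "x \<in> nvec V \<Longrightarrow> y \<in> nvec V \<Longrightarrow> diff y x = nscale V (- 1) (diff x y)"
  by (simp add: diff_def scale_right scale_scale scale_closed scale_one add_commute)

lemma norm_diff_commute: "x \<in> nvec V \<Longrightarrow> y \<in> nvec V \<Longrightarrow> nnorm V (diff y x) = nnorm V (diff x y)"
  by (simp add: diff_minus[of x y] norm_scale diff_closed)

lemma diff_add_diff: 
  assumes "x \<in> nvec V" "y \<in> nvec V" "z \<in> nvec V"
  shows "nadd V (diff x y) (diff y z) = diff x z"
proof -
  have "nadd V (diff x y) (diff y z) = nadd V (nadd V x (nscale V (- 1) z)) (nadd V y (nscale V (- 1) y))"
    using assms by (simp add: diff_def add_ac add_closed scale_closed)
  then show ?thesis using assms by (simp add: add_minus add_zero diff_def add_closed scale_closed)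
qed

lemma diff_add: "x \<in> nvec V \<Longrightarrow> y \<in> nvec V \<Longrightarrow> nadd V (diff x y) y = x"
proof -
  assume xy: "x \<in> nvec V" "y \<in> nvec V"
  have "nadd V (diff x y) y = nadd V x (nadd V y (nscale V (- 1) y))"
    using xy by (simp add: diff_def add_ac add_closed scale_closed)
  then show ?thesis using xy by (simp add: add_minus add_zero)
qed

lemma diff_add_add:
  assumes "x \<in> nvec V" "y \<in> nvec V" "x' \<in> nvec V" "y' \<in> nvec V"
  shows "diff (nadd V x y) (nadd V x' y') = nadd V (diff x x') (diff y y')"
  using assms by (simp add: diff_def scale_right add_ac add_closed scale_closed)

lemma diff_scale:
  assumes "x \<in> nvec V" "y \<in> nvec V"
  shows "diff (nscale V c x) (nscale V c y) = nscale V c (diff x y)"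
  using assms by (simp add: diff_def scale_right scale_scale scale_closed)

lemma norm_diff_triangle:
  assumes "x \<in> nvec V" "y \<in> nvec V" "z \<in> nvec V"
  shows "nnorm V (diff x z) \<le> nnorm V (diff x y) + nnorm V (diff y z)"
  using norm_triangle[of "diff x y" "diff y z"] assms by (simp add: diff_closed diff_add_diff)

lemma norm_diff_self: "x \<in> nvec V \<Longrightarrow> nnorm V (diff x x) = 0"
  by (simp add: diff_def add_minus norm_zero)

definition nsubspace :: "'v set \<Rightarrow> bool" where
  "nsubspace D \<longleftrightarrow> D \<subseteq> nvec V \<and> D \<noteq> {} \<and> (\<forall>x\<in>D. \<forall>y\<in>D. nadd V x y \<in> D) \<and> (\<forall>c. \<forall>x\<in>D. nscale V c x \<in> D)"

lemma nsubspace_in: "nsubspace D \<Longrightarrow> x \<in> D \<Longrightarrow> x \<in> nvec V"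
  by (auto simp: nsubspace_def)

lemma nsubspace_diff: "nsubspace D \<Longrightarrow> x \<in> D \<Longrightarrow> y \<in> D \<Longrightarrow> diff x y \<in> D"
  by (auto simp: nsubspace_def diff_def)

lemma nsubspace_seminormed: "nsubspace D \<Longrightarrow> seminormed_nspace (V\<lparr>nvec := D\<rparr>)"
  by unfold_locales
     (auto simp: nsubspace_def subset_iff add_assoc scale_right scale_left scale_scale
       scale_one norm_nonneg norm_triangle norm_scale_le intro: scale_zero add_commute)

definition dense :: "'v set \<Rightarrow> bool" where
  "dense D \<longleftrightarrow> (\<forall>x\<in>nvec V. \<forall>e>0. \<exists>y\<in>D. nnorm V (diff x y) < e)"

text \<open>McShane's formula gives the unique continuous extension without any completeness.\<close>

lemma extend_functional:
  assumes D: "nsubspace D" and dense: "dense D" and "0 \<le> C"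
    and add: "\<And>x y. x \<in> D \<Longrightarrow> y \<in> D \<Longrightarrow> l (nadd V x y) = l x + l y"
    and scale: "\<And>c x. x \<in> D \<Longrightarrow> l (nscale V c x) = c * l x"
    and bd: "\<And>x. x \<in> D \<Longrightarrow> \<bar>l x\<bar> \<le> C * nnorm V x"
  shows "\<exists>L. (\<forall>x\<in>nvec V. \<forall>y\<in>nvec V. L (nadd V x y) = L x + L y) \<and>
    (\<forall>c. \<forall>x\<in>nvec V. L (nscale V c x) = c * L x) \<and>
    (\<forall>x\<in>nvec V. \<bar>L x\<bar> \<le> C * nnorm V x) \<and> (\<forall>x\<in>D. L x = (l x :: real))"
proof -
  define L where "L x = (SUP y\<in>D. l y - C * nnorm V (diff x y))" for x
  note inV = nsubspace_in[OF D]
  have l_diff: "\<bar>l y - l z\<bar> \<le> C * nnorm V (diff y z)" if "y \<in> D" "z \<in> D" for y z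
  proof -
    have "l (diff y z) = l y - l z"
      using that D scale[of z "- 1"] by (simp add: diff_def add nsubspace_def)
    then show ?thesis using bd[OF nsubspace_diff[OF D that]] by simp
  qed
  have up: "l y - C * nnorm V (diff x y) \<le> l z + C * nnorm V (diff x z)"
    if "x \<in> nvec V" "y \<in> D" "z \<in> D" for x y z
  proof -
    have "C * nnorm V (diff y z) \<le> C * (nnorm V (diff x y) + nnorm V (diff x z))"
      using norm_diff_triangle[of y x z] norm_diff_commute[of x y] that inV assms(3)
      by (intro mult_left_mono) auto
    then show ?thesis using l_diff[OF that(2,3)] by (simp add: distrib_left)
  qed
  obtain d0 where d0: "d0 \<in> D" using D by (auto simp: nsubspace_def)
  have Ll: "\<bar>L x - l y\<bar> \<le> C * nnorm V (diff x y)" if x: "x \<in> nvec V" "y \<in> D" for x y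
  proof -
    have "bdd_above ((\<lambda>y. l y - C * nnorm V (diff x y)) ` D)"
      using up[OF x(1) _ d0] by (auto intro!: bdd_aboveI)
    then have "l y - C * nnorm V (diff x y) \<le> L x"
      unfolding L_def using x by (intro cSUP_upper)
    moreover have "L x \<le> l y + C * nnorm V (diff x y)"
      unfolding L_def using d0 up[OF x(1) _ x(2)] by (intro cSUP_least) auto
    ultimately show ?thesis by linarith
  qed
  have near: "\<exists>y\<in>D. nnorm V (diff x y) < e" if "x \<in> nvec V" "0 < e" for x e
    using dense that by (auto simp: dense_def)
  have "L (nadd V x y) = L x + L y" if xy: "x \<in> nvec V" "y \<in> nvec V" for x y
  proof -
    \<comment> \<open>The approximation of the sum costs \<open>2 * C * e\<close>, and those of
      \<open>x\<close> and \<open>y\<close> cost \<open>C * e\<close> each.\<close>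
    have "\<bar>L (nadd V x y) - (L x + L y)\<bar> \<le> (4 * C) * e" if e: "0 < e" for e
    proof -
      obtain x' y' where x': "x' \<in> D" "nnorm V (diff x x') < e" and y': "y' \<in> D" "nnorm V (diff y y') < e"
        using near xy e by meson
      have "nadd V x' y' \<in> D" using D x' y' by (auto simp: nsubspace_def)
      then have "\<bar>L (nadd V x y) - l (nadd V x' y')\<bar> \<le> C * nnorm V (diff (nadd V x y) (nadd V x' y'))"
        using xy by (intro Ll add_closed)
      moreover have "nnorm V (diff (nadd V x y) (nadd V x' y')) \<le> nnorm V (diff x x') + nnorm V (diff y y')"
        using xy x' y' inV by (simp add: diff_add_add norm_triangle diff_closed)
      ultimately have 1: "\<bar>L (nadd V x y) - l (nadd V x' y')\<bar> \<le> C * (2 * e)"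
        using x' y' mult_left_mono[OF _ assms(3), of _ "2 * e"] by (smt (verit))
      have 2: "\<bar>L x - l x'\<bar> \<le> C * e" "\<bar>L y - l y'\<bar> \<le> C * e"
        using Ll[OF xy(1) x'(1)] Ll[OF xy(2) y'(1)] x' y' mult_left_mono[OF _ assms(3), of _ e] by (smt (verit))+
      show ?thesis using 1 2 add[OF x'(1) y'(1)] by (simp add: algebra_simps)
    qed
    then have "L (nadd V x y) - (L x + L y) = 0" by (rule abs_le_if_small)
    then show ?thesis by simp
  qed
  moreover have "L (nscale V c x) = c * L x" if x: "x \<in> nvec V" for x c
  proof -
    have "\<bar>L (nscale V c x) - c * L x\<bar> \<le> (2 * \<bar>c\<bar> * C) * e" if e: "0 < e" for e
    proof -
      obtain x' where x': "x' \<in> D" "nnorm V (diff x x') < e"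
        using near x e by meson
      have "nscale V c x' \<in> D" using D x' by (auto simp: nsubspace_def)
      then have "\<bar>L (nscale V c x) - l (nscale V c x')\<bar> \<le> C * nnorm V (diff (nscale V c x) (nscale V c x'))"
        using x by (intro Ll scale_closed)
      also have "\<dots> = \<bar>c\<bar> * C * nnorm V (diff x x')"
        using x x' inV by (simp add: diff_scale norm_scale diff_closed)
      also have "\<dots> \<le> \<bar>c\<bar> * C * e" using x' assms(3) by (intro mult_left_mono) auto
      finally have 1: "\<bar>L (nscale V c x) - c * l x'\<bar> \<le> \<bar>c\<bar> * C * e" by (simp add: scale x')
      have "\<bar>c * L x - c * l x'\<bar> = \<bar>c\<bar> * \<bar>L x - l x'\<bar>" by (simp add: right_diff_distrib[symmetric] abs_mult)
      also have "\<dots> \<le> \<bar>c\<bar> * (C * nnorm V (diff x x'))" using Ll[OF x x'(1)] by (intro mult_left_mono) auto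
      also have "\<dots> \<le> \<bar>c\<bar> * (C * e)" using x' assms(3) by (intro mult_left_mono) auto
      finally show ?thesis using 1 by (simp add: algebra_simps)
    qed
    then have "L (nscale V c x) - c * L x = 0" by (rule abs_le_if_small)
    then show ?thesis by simp
  qed
  moreover have "L x = l x" if "x \<in> D" for x
    using Ll[OF inV[OF that] that] that by (simp add: norm_diff_self inV)
  moreover have "\<bar>L x\<bar> \<le> C * nnorm V x" if x: "x \<in> nvec V" for x
  proof -
    have z: "nscale V 0 d0 \<in> D" using D d0 by (auto simp: nsubspace_def)
    have "diff x (nscale V 0 d0) = x"
      using x inV[OF d0] by (simp add: diff_def scale_scale add_zero)
    then show ?thesis using Ll[OF x z] scale[OF d0, of 0] by simp
  qed
  ultimately show ?thesis by (intro exI[of _ L]) auto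
qed

end

section \<open>Normed spaces, closures and products\<close>

locale normed_nspace = seminormed_nspace +
  assumes norm_eq_0: "\<And>x. x \<in> nvec V \<Longrightarrow> nnorm V x = 0 \<Longrightarrow> x = nscale V 0 x"
begin

lemma diff_eq_0: "x \<in> nvec V \<Longrightarrow> y \<in> nvec V \<Longrightarrow> nnorm V (diff x y) = 0 \<Longrightarrow> x = y"
  by (metis diff_add diff_closed norm_eq_0 zero_add)

lemma ndist_eq: "x \<in> nvec V \<Longrightarrow> y \<in> nvec V \<Longrightarrow> ndist V x y = nnorm V (diff x y)"
  by (simp add: ndist_def diff_def)

sublocale Metric_space "nvec V" "ndist V"
proof
  show "0 \<le> ndist V x y" for x y
    by (auto simp: ndist_def norm_nonneg add_closed scale_closed)
  show "ndist V x y = ndist V y x" for x y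
    using norm_diff_commute[of x y] by (auto simp: ndist_def diff_def)
  show "ndist V x y = 0 \<longleftrightarrow> x = y" if "x \<in> nvec V" "y \<in> nvec V" for x y
    using that diff_eq_0[of x y] norm_diff_self[of x] by (auto simp: ndist_eq)
  show "ndist V x z \<le> ndist V x y + ndist V y z" if "x \<in> nvec V" "y \<in> nvec V" "z \<in> nvec V" for x y z
    using that norm_diff_triangle[of x y z] by (simp add: ndist_eq)
qed

lemma in_closure_iff:
  assumes "D \<subseteq> nvec V"
  shows "x \<in> ntopology V closure_of D \<longleftrightarrow> x \<in> nvec V \<and> (\<forall>e>0. \<exists>y\<in>D. nnorm V (diff x y) < e)"
  unfolding ntopology_def metric_closure_of using assms
  by (auto simp: in_mball ndist_eq subset_iff) (metis ndist_eq subsetD)+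

lemma nsubspace_closure:
  assumes D: "nsubspace D"
  shows "nsubspace (ntopology V closure_of D)"
proof -
  have DV: "D \<subseteq> nvec V" using D by (simp add: nsubspace_def)
  note cl = in_closure_iff[OF DV]
  have "x \<in> ntopology V closure_of D" if "x \<in> D" for x
    using that DV norm_diff_self[of x] unfolding cl by (metis subsetD)
  then have "ntopology V closure_of D \<noteq> {}" using D by (auto simp: nsubspace_def)
  moreover have "nadd V x y \<in> ntopology V closure_of D"
    if xy: "x \<in> ntopology V closure_of D" "y \<in> ntopology V closure_of D" for x y
  proof -
    have V: "x \<in> nvec V" "y \<in> nvec V" using xy by (auto simp: cl)
    have "\<exists>z\<in>D. nnorm V (diff (nadd V x y) z) < e" if "0 < e" for e
    proof -
      have e: "0 < e / 2" using that by simp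
      obtain x' where x': "x' \<in> D" "nnorm V (diff x x') < e / 2" using xy(1) e unfolding cl by blast
      obtain y' where y': "y' \<in> D" "nnorm V (diff y y') < e / 2" using xy(2) e unfolding cl by blast
      have "nnorm V (diff (nadd V x y) (nadd V x' y')) \<le> nnorm V (diff x x') + nnorm V (diff y y')"
        using V x' y' nsubspace_in[OF D] by (simp add: diff_add_add norm_triangle diff_closed)
      then have "nnorm V (diff (nadd V x y) (nadd V x' y')) < e" using x' y' by linarith
      moreover have "nadd V x' y' \<in> D" using D x' y' by (simp add: nsubspace_def)
      ultimately show ?thesis by blast
    qed
    then show ?thesis using V by (simp add: cl add_closed)
  qed
  moreover have "nscale V c x \<in> ntopology V closure_of D"
    if x: "x \<in> ntopology V closure_of D" for c x
  proof -
    have V: "x \<in> nvec V" using x by (auto simp: cl)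
    have "\<exists>z\<in>D. nnorm V (diff (nscale V c x) z) < e" if "0 < e" for e
    proof -
      have "0 < e / (\<bar>c\<bar> + 1)" using that by simp
      then obtain x' where x': "x' \<in> D" "nnorm V (diff x x') < e / (\<bar>c\<bar> + 1)"
        using x unfolding cl by meson
      have "nnorm V (diff (nscale V c x) (nscale V c x')) = \<bar>c\<bar> * nnorm V (diff x x')"
        using V x' nsubspace_in[OF D] by (simp add: diff_scale norm_scale diff_closed)
      also have "\<dots> \<le> (\<bar>c\<bar> + 1) * nnorm V (diff x x')"
        using V x' nsubspace_in[OF D] by (intro mult_right_mono norm_nonneg diff_closed) auto
      also have "\<dots> < e" using x'(2) by (simp add: pos_less_divide_eq mult.commute)
      finally show ?thesis using D x' by (auto simp: nsubspace_def)
    qed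
    then show ?thesis using V by (simp add: cl scale_closed)
  qed
  moreover have "ntopology V closure_of D \<subseteq> nvec V" by (auto simp: cl)
  ultimately show ?thesis by (auto simp: nsubspace_def)
qed

lemma nsubspace_normed: "nsubspace D \<Longrightarrow> normed_nspace (V\<lparr>nvec := D\<rparr>)"
  by (intro normed_nspace.intro normed_nspace_axioms.intro nsubspace_seminormed)
     (auto simp: nsubspace_def intro: norm_eq_0)

end

lemma normed_prod_nspace:
  assumes "normed_nspace V" "normed_nspace W" "1 \<le> q"
  shows "normed_nspace (prod_nspace q V W)"
proof -
  interpret V: normed_nspace V by fact
  interpret W: normed_nspace W by fact
  note [simp] = prod_nspace_def V.add_closed W.add_closed V.scale_closed W.scale_closed
  show ?thesis
  proof
    show "nvec (prod_nspace q V W) \<noteq> {}" using V.nonempty W.nonempty by simp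
    show "nadd (prod_nspace q V W) x y = nadd (prod_nspace q V W) y x"
      if "x \<in> nvec (prod_nspace q V W)" "y \<in> nvec (prod_nspace q V W)" for x y
      using that by (auto simp: V.add_commute W.add_commute)
    show "nscale (prod_nspace q V W) 0 x = nscale (prod_nspace q V W) 0 y"
      if "x \<in> nvec (prod_nspace q V W)" "y \<in> nvec (prod_nspace q V W)" for x y
      using that by (auto intro: V.scale_zero W.scale_zero)
    show "nnorm (prod_nspace q V W) (nadd (prod_nspace q V W) x y)
        \<le> nnorm (prod_nspace q V W) x + nnorm (prod_nspace q V W) y"
      if xy: "x \<in> nvec (prod_nspace q V W)" "y \<in> nvec (prod_nspace q V W)" for x y
    proof -
      obtain a b c d where eq: "x = (a, b)" "y = (c, d)" by (metis surj_pair)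
      have in_V: "a \<in> nvec V" "b \<in> nvec W" "c \<in> nvec V" "d \<in> nvec W" using xy by (auto simp: eq)
      have "(nnorm V (nadd V a c) powr q + nnorm W (nadd W b d) powr q) powr (1 / q)
        \<le> ((nnorm V a + nnorm V c) powr q + (nnorm W b + nnorm W d) powr q) powr (1 / q)"
        using in_V assms(3)
        by (intro powr_mono2 add_mono V.norm_triangle W.norm_triangle V.norm_nonneg W.norm_nonneg) auto
      also have "\<dots> \<le> (nnorm V a powr q + nnorm W b powr q) powr (1 / q)
         + (nnorm V c powr q + nnorm W d powr q) powr (1 / q)"
        using in_V assms(3) by (intro Minkowski_pair V.norm_nonneg W.norm_nonneg)
      finally show ?thesis by (simp add: eq)
    qed
    show "nnorm (prod_nspace q V W) (nscale (prod_nspace q V W) c x) \<le> \<bar>c\<bar> * nnorm (prod_nspace q V W) x"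
      if x: "x \<in> nvec (prod_nspace q V W)" for c x
    proof -
      obtain a b where eq: "x = (a, b)" by (metis surj_pair)
      have in_V: "a \<in> nvec V" "b \<in> nvec W" using x by (auto simp: eq)
      have "nnorm V (nscale V c a) powr q + nnorm W (nscale W c b) powr q =
          \<bar>c\<bar> powr q * (nnorm V a powr q + nnorm W b powr q)"
        using in_V by (simp add: V.norm_scale W.norm_scale powr_mult V.norm_nonneg W.norm_nonneg distrib_left)
      then show ?thesis using assms(3) by (simp add: eq powr_mult powr_powr)
    qed
    show "x = nscale (prod_nspace q V W) 0 x"
      if x: "x \<in> nvec (prod_nspace q V W)" "nnorm (prod_nspace q V W) x = 0" for x
    proof -
      obtain a b where eq: "x = (a, b)" by (metis surj_pair)
      have in_V: "a \<in> nvec V" "b \<in> nvec W" using x by (auto simp: eq)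
      have "nnorm V a powr q + nnorm W b powr q = 0" using x assms(3) by (simp add: eq)
      then have "nnorm V a powr q = 0" "nnorm W b powr q = 0"
        by (simp_all add: add_nonneg_eq_0_iff)
      then have "nnorm V a = 0" "nnorm W b = 0" by auto
      then show ?thesis using V.norm_eq_0[OF in_V(1)] W.norm_eq_0[OF in_V(2)] by (simp add: eq)
    qed
  qed (auto simp: V.add_assoc W.add_assoc V.scale_right W.scale_right V.scale_left W.scale_left
        V.scale_scale W.scale_scale V.scale_one W.scale_one)
qed

text \<open>The metric axioms on \<open>V\<close> are pulled back from \<open>W\<close> along the
  bijection, which preserves distances because it is linear and norm-preserving. In this way the
  Sobolev norm induces a metric without a direct proof of its triangle inequality.\<close>

lemma isometrically_isomorphicI:
  assumes W: "normed_nspace W" and lin: "linear_between V W \<Phi>"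
    and V: "\<And>x y. x \<in> nvec V \<Longrightarrow> y \<in> nvec V \<Longrightarrow> nadd V x y \<in> nvec V"
      "\<And>c x. x \<in> nvec V \<Longrightarrow> nscale V c x \<in> nvec V"
    and bij: "bij_betw \<Phi> (nvec V) (nvec W)"
    and norm: "\<And>x. x \<in> nvec V \<Longrightarrow> nnorm W (\<Phi> x) = nnorm V x"
  shows "isometrically_isomorphic V W"
proof -
  interpret W: normed_nspace W by fact
  have in_W: "\<Phi> x \<in> nvec W" if "x \<in> nvec V" for x using bij that by (auto simp: bij_betw_def)
  have dist: "ndist V x y = ndist W (\<Phi> x) (\<Phi> y)" if "x \<in> nvec V" "y \<in> nvec V" for x y
  proof -
    have "\<Phi> (nadd V x (nscale V (- 1) y)) = nadd W (\<Phi> x) (nscale W (- 1) (\<Phi> y))"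
      using lin that V by (simp add: linear_between_def)
    then show ?thesis using that V in_W norm[of "nadd V x (nscale V (- 1) y)"] by (simp add: ndist_def)
  qed
  have out: "ndist V x y = 0" if "\<not> (x \<in> nvec V \<and> y \<in> nvec V)" for x y
    using that by (auto simp: ndist_def)
  have inj: "\<Phi> x = \<Phi> y \<longleftrightarrow> x = y" if "x \<in> nvec V" "y \<in> nvec V" for x y
    using bij that by (auto simp: bij_betw_def inj_on_def)
  interpret V: Metric_space "nvec V" "ndist V"
  proof
    show "0 \<le> ndist V x y" for x y using dist[of x y] out[of x y] by fastforce
    show "ndist V x y = ndist V y x" for x y
      using dist[of x y] dist[of y x] out[of x y] out[of y x] W.commute by metis
    show "ndist V x y = 0 \<longleftrightarrow> x = y" if "x \<in> nvec V" "y \<in> nvec V" for x y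
      using that by (simp add: dist in_W inj)
    show "ndist V x z \<le> ndist V x y + ndist V y z" if "x \<in> nvec V" "y \<in> nvec V" "z \<in> nvec V" for x y z
      using that by (simp add: dist in_W W.triangle)
  qed
  define \<Psi> where "\<Psi> = inv_into (nvec V) \<Phi>"
  have Psi: "\<Psi> y \<in> nvec V" "\<Phi> (\<Psi> y) = y" if "y \<in> nvec W" for y
    using bij that by (auto simp: \<Psi>_def bij_betw_def inv_into_into f_inv_into_f)
  have Psi_Phi: "\<Psi> (\<Phi> x) = x" if "x \<in> nvec V" for x
    using bij that by (auto simp: \<Psi>_def bij_betw_def)
  have "continuous_map V.mtopology W.mtopology \<Phi>"
    unfolding V.metric_continuous_map[OF W.Metric_space_axioms] using dist in_W by (metis image_subsetI)
  moreover have "continuous_map W.mtopology V.mtopology \<Psi>"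
    unfolding W.metric_continuous_map[OF V.Metric_space_axioms] using dist Psi by (metis image_subsetI)
  ultimately have "homeomorphic_maps V.mtopology W.mtopology \<Phi> \<Psi>"
    by (simp add: homeomorphic_maps_def Psi Psi_Phi)
  then have "homeomorphic_map (ntopology V) (ntopology W) \<Phi>"
    unfolding ntopology_def using homeomorphic_maps_map by blast
  then show ?thesis using lin norm by (auto simp: isometrically_isomorphic_def)
qed

section \<open>Quotients and duals\<close>

context seminormed_nspace
begin

definition coset :: "'v set \<Rightarrow> 'v \<Rightarrow> 'v set" where "coset B v = nadd V v ` B"

context
  fixes B assumes B: "nsubspace B"
begin

lemma B_in: "b \<in> B \<Longrightarrow> b \<in> nvec V"
  and B_add: "b \<in> B \<Longrightarrow> c \<in> B \<Longrightarrow> nadd V b c \<in> B"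
  and B_scale: "b \<in> B \<Longrightarrow> nscale V a b \<in> B"
  using B by (auto simp: nsubspace_def)

lemma ex_B: "\<exists>b. b \<in> B"
  using B by (auto simp: nsubspace_def)

lemma coset_subset: "v \<in> nvec V \<Longrightarrow> coset B v \<subseteq> nvec V"
  by (auto simp: coset_def add_closed B_in)

lemma coset_self: "v \<in> nvec V \<Longrightarrow> v \<in> coset B v"
  using ex_B B_in B_scale by (auto simp: coset_def image_iff) (metis add_zero)

lemma coset_eqI:
  assumes "v \<in> nvec V" "b \<in> B"
  shows "coset B (nadd V v b) = coset B v"
proof (intro set_eqI iffI)
  fix x assume "x \<in> coset B (nadd V v b)"
  then obtain c where "c \<in> B" "x = nadd V (nadd V v b) c" by (auto simp: coset_def)
  then show "x \<in> coset B v" using assms B_in B_add by (auto simp: coset_def add_assoc)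
next
  fix x assume "x \<in> coset B v"
  then obtain c where c: "c \<in> B" "x = nadd V v c" by (auto simp: coset_def)
  have "diff c b \<in> B" using c assms B by (simp add: nsubspace_diff)
  moreover have "x = nadd V (nadd V v b) (diff c b)"
    using assms c B_in diff_add[of c b] by (simp add: add_assoc add_commute[of b] diff_closed)
  ultimately show "x \<in> coset B (nadd V v b)" by (auto simp: coset_def)
qed

lemma coset_eq: "v \<in> nvec V \<Longrightarrow> w \<in> coset B v \<Longrightarrow> coset B w = coset B v"
  by (auto simp: coset_def[of B v] coset_eqI)

lemma quotient_nvec: "nvec (quotient_nspace V B) = coset B ` nvec V"
  by (simp add: quotient_nspace_def coset_def[abs_def])

lemma quotient_add:
  assumes "v \<in> nvec V" "w \<in> nvec V"
  shows "nadd (quotient_nspace V B) (coset B v) (coset B w) = coset B (nadd V v w)"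
proof -
  have eq: "nadd V (nadd V v b) (nadd V w c) = nadd V (nadd V v w) (nadd V b c)" if "b \<in> B" "c \<in> B" for b c
    using assms that B_in by (simp add: add_ac add_closed)
  obtain b0 where b0: "b0 \<in> B" using ex_B by auto
  have "{nadd V x y |x y. x \<in> coset B v \<and> y \<in> coset B w} = coset B (nadd V v w)"
  proof (intro set_eqI iffI)
    fix x assume "x \<in> {nadd V x y |x y. x \<in> coset B v \<and> y \<in> coset B w}"
    then obtain b c where "b \<in> B" "c \<in> B" "x = nadd V (nadd V v b) (nadd V w c)"
      by (auto simp: coset_def)
    then show "x \<in> coset B (nadd V v w)" using eq B_add by (auto simp: coset_def)
  next
    fix x assume "x \<in> coset B (nadd V v w)"
    then obtain b where b: "b \<in> B" "x = nadd V (nadd V v w) b" by (auto simp: coset_def)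
    have "nadd V b (nscale V 0 b0) = b" using b b0 B_in by (simp add: add_zero)
    then have "x = nadd V (nadd V v b) (nadd V w (nscale V 0 b0))"
      using eq[OF b(1) B_scale[OF b0, of 0]] b(2) by simp
    moreover have "nadd V v b \<in> coset B v" "nadd V w (nscale V 0 b0) \<in> coset B w"
      using b b0 B_scale by (auto simp: coset_def)
    ultimately show "x \<in> {nadd V x y |x y. x \<in> coset B v \<and> y \<in> coset B w}" by blast
  qed
  then show ?thesis by (simp add: quotient_nspace_def)
qed

lemma quotient_scale:
  assumes "v \<in> nvec V"
  shows "nscale (quotient_nspace V B) c (coset B v) = coset B (nscale V c v)"
proof -
  have eq: "nadd V (nscale V c (nadd V v b)) d = nadd V (nscale V c v) (nadd V (nscale V c b) d)"
    if "b \<in> B" "d \<in> B" for b d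
    using assms that B_in by (simp add: scale_right add_assoc scale_closed)
  obtain b0 where b0: "b0 \<in> B" using ex_B by auto
  have "{nadd V (nscale V c x) y |x y. x \<in> coset B v \<and> y \<in> B} = coset B (nscale V c v)"
  proof (intro set_eqI iffI)
    fix x assume "x \<in> {nadd V (nscale V c x) y |x y. x \<in> coset B v \<and> y \<in> B}"
    then obtain b d where "b \<in> B" "d \<in> B" "x = nadd V (nscale V c (nadd V v b)) d"
      by (auto simp: coset_def)
    then show "x \<in> coset B (nscale V c v)" using eq B_add B_scale by (auto simp: coset_def)
  next
    fix x assume "x \<in> coset B (nscale V c v)"
    then obtain b where b: "b \<in> B" "x = nadd V (nscale V c v) b" by (auto simp: coset_def)
    then show "x \<in> {nadd V (nscale V c x) y |x y. x \<in> coset B v \<and> y \<in> B}"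
      using coset_self[OF assms] by blast
  qed
  then show ?thesis by (simp add: quotient_nspace_def)
qed

lemma quotient_norm: "nnorm (quotient_nspace V B) C = (INF v\<in>C. nnorm V v)"
  by (simp add: quotient_nspace_def)

lemma quotient_norm_le:
  assumes "v \<in> nvec V" "w \<in> coset B v"
  shows "nnorm (quotient_nspace V B) (coset B v) \<le> nnorm V w"
  unfolding quotient_norm using assms coset_subset[OF assms(1)]
  by (intro cINF_lower bdd_belowI2[where m = 0] norm_nonneg) auto

lemma quotient_norm_ge:
  assumes "v \<in> nvec V" "\<And>w. w \<in> coset B v \<Longrightarrow> c \<le> nnorm V w"
  shows "c \<le> nnorm (quotient_nspace V B) (coset B v)"
  unfolding quotient_norm using assms coset_self[OF assms(1)] by (intro cINF_greatest) auto

text \<open>Almost optimal representatives stand in for an attained infimum when the seminorm axioms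
  of the quotient are verified.\<close>

lemma quotient_norm_approx:
  assumes "v \<in> nvec V" "0 < e"
  shows "\<exists>w\<in>coset B v. nnorm V w < nnorm (quotient_nspace V B) (coset B v) + e"
proof (rule ccontr)
  assume "\<not> ?thesis"
  then have "nnorm (quotient_nspace V B) (coset B v) + e \<le> nnorm (quotient_nspace V B) (coset B v)"
    using assms by (intro quotient_norm_ge) auto
  then show False using assms by simp
qed

lemma seminormed_quotient: "seminormed_nspace (quotient_nspace V B)"
proof (unfold_locales, goal_cases)
  case 1
  then show ?case using nonempty by (simp add: quotient_nvec)
next
  case (2 x y)
  then show ?case by (auto simp: quotient_nvec quotient_add add_closed)
next
  case (3 c x)
  then show ?case by (auto simp: quotient_nvec quotient_scale scale_closed)
next
  case (4 x y z)
  then show ?case by (auto simp: quotient_nvec quotient_add add_closed add_assoc)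
next
  case (5 x y)
  then obtain v w where "v \<in> nvec V" "w \<in> nvec V" "x = coset B v" "y = coset B w"
    by (auto simp: quotient_nvec)
  then show ?case by (simp add: quotient_add add_commute)
next
  case (6 c x y)
  then show ?case by (auto simp: quotient_nvec quotient_add quotient_scale add_closed scale_closed scale_right)
next
  case (7 a b x)
  then show ?case by (auto simp: quotient_nvec quotient_add quotient_scale scale_closed scale_left)
next
  case (8 a b x)
  then show ?case by (auto simp: quotient_nvec quotient_scale scale_closed scale_scale)
next
  case (9 x)
  then show ?case by (auto simp: quotient_nvec quotient_scale scale_one)
next
  case (10 x y)
  then show ?case by (auto simp: quotient_nvec quotient_scale) (metis scale_zero)+
next
  case (11 x)
  then show ?case
    using coset_subset by (auto simp: quotient_nvec intro!: quotient_norm_ge norm_nonneg)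
next
  case (12 x y)
  then obtain v w where vw: "v \<in> nvec V" "w \<in> nvec V" and eq: "x = coset B v" "y = coset B w"
    by (auto simp: quotient_nvec)
  let ?N = "nnorm (quotient_nspace V B)"
  show ?case
  proof (rule field_le_epsilon)
    fix e :: real assume "0 < e"
    then have e: "0 < e / 2" by simp
    obtain v' where v': "v' \<in> coset B v" "nnorm V v' < ?N (coset B v) + e / 2"
      using quotient_norm_approx[OF vw(1) e] by auto
    obtain w' where w': "w' \<in> coset B w" "nnorm V w' < ?N (coset B w) + e / 2"
      using quotient_norm_approx[OF vw(2) e] by auto
    have V: "v' \<in> nvec V" "w' \<in> nvec V" using v' w' coset_subset vw by auto
    have "?N (coset B (nadd V v' w')) \<le> nnorm V (nadd V v' w')"
      using V by (intro quotient_norm_le add_closed coset_self)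
    also have "\<dots> \<le> nnorm V v' + nnorm V w'" using V by (rule norm_triangle)
    finally have "?N (coset B (nadd V v' w')) \<le> ?N x + ?N y + e"
      using v' w' eq by simp
    moreover have "nadd (quotient_nspace V B) x y = coset B (nadd V v' w')"
      using quotient_add[OF V] coset_eq[OF vw(1) v'(1)] coset_eq[OF vw(2) w'(1)] eq by simp
    ultimately show "?N (nadd (quotient_nspace V B) x y) \<le> ?N x + ?N y + e" by simp
  qed
next
  case (13 c x)
  then obtain v where v: "v \<in> nvec V" and eq: "x = coset B v" by (auto simp: quotient_nvec)
  let ?N = "nnorm (quotient_nspace V B)"
  show ?case
  proof (rule field_le_epsilon)
    fix e :: real assume e: "0 < e"
    \<comment> \<open>After scaling by \<open>c\<close> the error stays below \<open>e\<close>, also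
      for \<open>c = 0\<close>.\<close>
    then have "0 < e / (\<bar>c\<bar> + 1)" by simp
    then obtain v' where v': "v' \<in> coset B v" "nnorm V v' < ?N (coset B v) + e / (\<bar>c\<bar> + 1)"
      using quotient_norm_approx[OF v] by blast
    have V: "v' \<in> nvec V" using v' coset_subset v by auto
    have "?N (coset B (nscale V c v')) \<le> nnorm V (nscale V c v')"
      using V by (intro quotient_norm_le scale_closed coset_self)
    also have "\<dots> = \<bar>c\<bar> * nnorm V v'" using V by (rule norm_scale)
    also have "\<dots> \<le> \<bar>c\<bar> * (?N (coset B v) + e / (\<bar>c\<bar> + 1))" using v' by (intro mult_left_mono) auto
    also have "\<dots> = \<bar>c\<bar> * ?N (coset B v) + \<bar>c\<bar> / (\<bar>c\<bar> + 1) * e" by (simp add: distrib_left)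
    also have "\<bar>c\<bar> / (\<bar>c\<bar> + 1) * e \<le> 1 * e" using e by (intro mult_right_mono) auto
    finally have "?N (coset B (nscale V c v')) \<le> \<bar>c\<bar> * ?N x + e" by (simp add: eq)
    moreover have "nscale (quotient_nspace V B) c x = coset B (nscale V c v')"
      using quotient_scale[OF V] coset_eq[OF v v'(1)] eq by simp
    ultimately show "?N (nscale (quotient_nspace V B) c x) \<le> \<bar>c\<bar> * ?N x + e" by simp
  qed
qed

end

section \<open>Bounded functionals and dual spaces\<close>

definition bounded_functional :: "('v \<Rightarrow> real) \<Rightarrow> real \<Rightarrow> bool" where
  "bounded_functional \<psi> K \<longleftrightarrow>
    (\<forall>x\<in>nvec V. \<forall>y\<in>nvec V. \<psi> (nadd V x y) = \<psi> x + \<psi> y) \<and>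
    (\<forall>c. \<forall>x\<in>nvec V. \<psi> (nscale V c x) = c * \<psi> x) \<and>
    (\<forall>x\<in>nvec V. \<bar>\<psi> x\<bar> \<le> K * nnorm V x)"

lemma bounded_functional_diff:
  assumes "bounded_functional \<psi> K" "x \<in> nvec V" "y \<in> nvec V"
  shows "\<psi> (diff x y) = \<psi> x - \<psi> y"
  using assms by (simp add: bounded_functional_def diff_def scale_closed)

lemma dual_nvec_iff:
  "\<phi> \<in> nvec (dual_nspace V) \<longleftrightarrow> \<phi> \<in> extensional (nvec V) \<and> (\<exists>K. bounded_functional \<phi> K)"
  by (auto simp: dual_nspace_def bounded_functional_def linear_between_def real_nspace_def)

lemma dual_norm: "nnorm (dual_nspace V) \<phi> = (SUP v\<in>{v \<in> nvec V. nnorm V v \<le> 1}. \<bar>\<phi> v\<bar>)"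
  by (simp add: dual_nspace_def)

lemma dual_norm_le:
  assumes "0 \<le> K" "\<And>v. v \<in> nvec V \<Longrightarrow> \<bar>\<phi> v\<bar> \<le> K * nnorm V v"
  shows "nnorm (dual_nspace V) \<phi> \<le> K"
  unfolding dual_norm
proof (rule cSUP_least)
  obtain x where "x \<in> nvec V" using nonempty by auto
  then have "nscale V 0 x \<in> {v \<in> nvec V. nnorm V v \<le> 1}" by (simp add: scale_closed norm_zero)
  then show "{v \<in> nvec V. nnorm V v \<le> 1} \<noteq> {}" by blast
  fix v assume v: "v \<in> {v \<in> nvec V. nnorm V v \<le> 1}"
  then have "K * nnorm V v \<le> K * 1" using assms(1) by (intro mult_left_mono) auto
  then show "\<bar>\<phi> v\<bar> \<le> K" using assms(2)[of v] v by simp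
qed

lemma dual_bdd_above:
  assumes "bounded_functional \<phi> K"
  shows "bdd_above ((\<lambda>v. \<bar>\<phi> v\<bar>) ` {v \<in> nvec V. nnorm V v \<le> 1})"
proof (rule bdd_aboveI2)
  fix x assume x: "x \<in> {v \<in> nvec V. nnorm V v \<le> 1}"
  then have "\<bar>\<phi> x\<bar> \<le> K * nnorm V x" using assms by (auto simp: bounded_functional_def)
  also have "\<dots> \<le> \<bar>K\<bar> * 1" using x norm_nonneg by (intro mult_mono) auto
  finally show "\<bar>\<phi> x\<bar> \<le> \<bar>K\<bar>" by simp
qed

text \<open>Normalise \<open>v\<close> and compare with the supremum. A vector of norm 0 cannot be
  normalised and need not be the zero vector, but boundedness with any constant gives the value 0
  there.\<close>

lemma dual_bound:
  assumes "bounded_functional \<phi> K" "v \<in> nvec V"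
  shows "\<bar>\<phi> v\<bar> \<le> nnorm (dual_nspace V) \<phi> * nnorm V v"
proof (cases "nnorm V v = 0")
  case True
  then show ?thesis using assms by (auto simp: bounded_functional_def)
next
  case False
  then have pos: "0 < nnorm V v" using norm_nonneg[OF assms(2)] by simp
  let ?w = "nscale V (1 / nnorm V v) v"
  have w: "?w \<in> nvec V" "nnorm V ?w \<le> 1" using pos assms by (auto simp: scale_closed norm_scale)
  have "\<bar>\<phi> ?w\<bar> \<le> nnorm (dual_nspace V) \<phi>"
    unfolding dual_norm using w by (intro cSUP_upper dual_bdd_above[OF assms(1)]) auto
  moreover have "\<phi> ?w = 1 / nnorm V v * \<phi> v" using assms by (auto simp: bounded_functional_def)
  ultimately show ?thesis using pos by (simp add: abs_mult field_simps)
qed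

lemma dual_norm_nonneg:
  assumes "bounded_functional \<phi> K"
  shows "0 \<le> nnorm (dual_nspace V) \<phi>"
proof -
  obtain x where x: "x \<in> nvec V" using nonempty by auto
  have "\<bar>\<phi> (nscale V 0 x)\<bar> \<le> nnorm (dual_nspace V) \<phi>"
    unfolding dual_norm using x by (intro cSUP_upper dual_bdd_above[OF assms]) (auto simp: scale_closed norm_zero)
  then show ?thesis by linarith
qed

lemma bounded_functional_add:
  assumes "bounded_functional \<phi> K" "bounded_functional \<psi> L"
  shows "bounded_functional (\<lambda>v\<in>nvec V. \<phi> v + \<psi> v) (K + L)"
  unfolding bounded_functional_def
proof (intro conjI ballI allI)
  show "\<bar>(\<lambda>v\<in>nvec V. \<phi> v + \<psi> v) x\<bar> \<le> (K + L) * nnorm V x" if x: "x \<in> nvec V" for x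
  proof -
    have "\<bar>\<phi> x\<bar> \<le> K * nnorm V x" "\<bar>\<psi> x\<bar> \<le> L * nnorm V x"
      using assms x by (auto simp: bounded_functional_def)
    then show ?thesis using x by (simp add: distrib_right)
  qed
qed (use assms in \<open>auto simp: bounded_functional_def add_closed scale_closed distrib_left\<close>)

lemma bounded_functional_scale:
  assumes "bounded_functional \<phi> K"
  shows "bounded_functional (\<lambda>v\<in>nvec V. c * \<phi> v) (\<bar>c\<bar> * K)"
  unfolding bounded_functional_def
proof (intro conjI ballI allI)
  show "\<bar>(\<lambda>v\<in>nvec V. c * \<phi> v) x\<bar> \<le> \<bar>c\<bar> * K * nnorm V x" if x: "x \<in> nvec V" for x
  proof -
    have "\<bar>\<phi> x\<bar> \<le> K * nnorm V x" using assms x by (auto simp: bounded_functional_def)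
    then have "\<bar>c\<bar> * \<bar>\<phi> x\<bar> \<le> \<bar>c\<bar> * (K * nnorm V x)" by (intro mult_left_mono) auto
    then show ?thesis using x by (simp add: abs_mult mult.assoc)
  qed
qed (use assms in \<open>auto simp: bounded_functional_def add_closed scale_closed distrib_left\<close>)

text \<open>Definiteness holds even though \<open>V\<close> is only seminormed: a functional of norm
  0 vanishes on the carrier, and extensionality fixes it elsewhere.\<close>

lemma normed_dual: "normed_nspace (dual_nspace V)"
proof -
  have add: "nadd (dual_nspace V) = (\<lambda>\<phi> \<psi>. \<lambda>v\<in>nvec V. \<phi> v + \<psi> v)"
    and scale: "nscale (dual_nspace V) = (\<lambda>c \<phi>. \<lambda>v\<in>nvec V. c * \<phi> v)"
    by (simp_all add: dual_nspace_def)
  have ext: "\<phi> v = undefined" if "\<phi> \<in> nvec (dual_nspace V)" "v \<notin> nvec V" for \<phi> v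
    using that by (simp add: dual_nvec_iff extensional_def)
  have eqI: "\<phi> = \<psi>" if "\<And>v. v \<in> nvec V \<Longrightarrow> \<phi> v = \<psi> v" "\<phi> \<in> extensional (nvec V)" "\<psi> \<in> extensional (nvec V)"
    for \<phi> \<psi> :: "'v \<Rightarrow> real" using that by (auto intro!: extensionalityI)
  show ?thesis
  proof (unfold_locales, goal_cases)
    case 1
    have "bounded_functional (\<lambda>v\<in>nvec V. 0) 0"
      by (auto simp: bounded_functional_def add_closed scale_closed)
    then have "(\<lambda>v\<in>nvec V. 0) \<in> nvec (dual_nspace V)" by (auto simp: dual_nvec_iff)
    then show ?case by blast
  next
    case (2 x y)
    then show ?case using bounded_functional_add unfolding dual_nvec_iff add by blast
  next
    case (3 c x)
    then show ?case using bounded_functional_scale unfolding dual_nvec_iff scale by blast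
  next
    case (4 x y z)
    then show ?case by (auto simp: add)
  next
    case (5 x y)
    then show ?case by (auto simp: add)
  next
    case (6 c x y)
    then show ?case by (auto simp: add scale algebra_simps)
  next
    case (7 a b x)
    then show ?case by (auto simp: add scale algebra_simps)
  next
    case (8 a b x)
    then show ?case by (auto simp: scale)
  next
    case (9 x)
    then show ?case by (auto simp: scale ext intro!: eqI simp: dual_nvec_iff)
  next
    case (10 x y)
    then show ?case by (auto simp: scale)
  next
    case (11 x)
    then show ?case using dual_norm_nonneg by (auto simp: dual_nvec_iff)
  next
    case (12 x y)
    then obtain K L where KL: "bounded_functional x K" "bounded_functional y L" by (auto simp: dual_nvec_iff)
    show ?case
    proof (rule dual_norm_le)
      show "\<bar>nadd (dual_nspace V) x y v\<bar> \<le> (nnorm (dual_nspace V) x + nnorm (dual_nspace V) y) * nnorm V v"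
        if "v \<in> nvec V" for v
        using dual_bound[OF KL(1) that] dual_bound[OF KL(2) that] that by (simp add: add distrib_right)
    qed (intro add_nonneg_nonneg dual_norm_nonneg[OF KL(1)] dual_norm_nonneg[OF KL(2)])
  next
    case (13 c x)
    then obtain K where K: "bounded_functional x K" by (auto simp: dual_nvec_iff)
    show ?case
    proof (rule dual_norm_le)
      show "\<bar>nscale (dual_nspace V) c x v\<bar> \<le> \<bar>c\<bar> * nnorm (dual_nspace V) x * nnorm V v"
        if "v \<in> nvec V" for v
        using mult_left_mono[OF dual_bound[OF K that], of "\<bar>c\<bar>"] that by (simp add: scale abs_mult mult.assoc)
    qed (intro mult_nonneg_nonneg abs_ge_zero dual_norm_nonneg[OF K])
  next
    case (14 x)
    then obtain K where K: "bounded_functional x K" by (auto simp: dual_nvec_iff)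
    have "x v = 0" if "v \<in> nvec V" for v using dual_bound[OF K that] 14 by simp
    then show ?case using 14 by (intro eqI) (auto simp: scale dual_nvec_iff)
  qed
qed

text \<open>Half of the identification of the dual of a quotient with the annihilator of
  \<open>B\<close>: composition with the projection does not increase the norm.\<close>

lemma dual_quotientD:
  assumes B: "nsubspace B" and phi: "\<phi> \<in> nvec (dual_nspace (quotient_nspace V B))"
  shows "bounded_functional (\<lambda>v. \<phi> (coset B v)) (nnorm (dual_nspace (quotient_nspace V B)) \<phi>)"
    and "b \<in> B \<Longrightarrow> \<phi> (coset B b) = 0"
proof -
  interpret Q: seminormed_nspace "quotient_nspace V B" by (rule seminormed_quotient[OF B])
  obtain K where K: "Q.bounded_functional \<phi> K" using phi by (auto simp: Q.dual_nvec_iff)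
  have in_Q: "coset B v \<in> nvec (quotient_nspace V B)" if "v \<in> nvec V" for v
    using that by (simp add: quotient_nvec[OF B])
  show *: "bounded_functional (\<lambda>v. \<phi> (coset B v)) (nnorm (dual_nspace (quotient_nspace V B)) \<phi>)"
    unfolding bounded_functional_def
  proof (intro conjI ballI allI)
    show "\<phi> (coset B (nadd V x y)) = \<phi> (coset B x) + \<phi> (coset B y)"
      if "x \<in> nvec V" "y \<in> nvec V" for x y
      using K in_Q that by (simp add: Q.bounded_functional_def quotient_add[OF B, symmetric])
    show "\<phi> (coset B (nscale V c x)) = c * \<phi> (coset B x)" if "x \<in> nvec V" for c x
      using K in_Q that by (simp add: Q.bounded_functional_def quotient_scale[OF B, symmetric])
    show "\<bar>\<phi> (coset B x)\<bar> \<le> nnorm (dual_nspace (quotient_nspace V B)) \<phi> * nnorm V x" if x: "x \<in> nvec V" for x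
    proof -
      have "nnorm (dual_nspace (quotient_nspace V B)) \<phi> * nnorm (quotient_nspace V B) (coset B x)
          \<le> nnorm (dual_nspace (quotient_nspace V B)) \<phi> * nnorm V x"
        using x by (intro mult_left_mono quotient_norm_le[OF B] coset_self[OF B] Q.dual_norm_nonneg[OF K])
      then show ?thesis using Q.dual_bound[OF K in_Q[OF x]] by linarith
    qed
  qed
  show "\<phi> (coset B b) = 0" if b: "b \<in> B"
  proof -
    have V: "b \<in> nvec V" "nscale V 0 b \<in> nvec V" using nsubspace_in[OF B b] scale_closed by auto
    have "coset B (nadd V (nscale V 0 b) b) = coset B (nscale V 0 b)" using V b by (intro coset_eqI[OF B])
    then have "coset B b = coset B (nscale V 0 b)" using V by (simp add: zero_add)
    moreover have "\<phi> (coset B (nscale V 0 b)) = 0 * \<phi> (coset B b)"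
      using *[unfolded bounded_functional_def] V(1) by blast
    ultimately show ?thesis by simp
  qed
qed

text \<open>The other half: a functional vanishing on \<open>B\<close> is constant on cosets, and
  its bound survives the infimum over representatives.\<close>

lemma dual_quotientI:
  assumes B: "nsubspace B" and psi: "bounded_functional \<psi> K" "0 \<le> K"
    and zero: "\<And>b. b \<in> B \<Longrightarrow> \<psi> b = 0"
  shows "\<exists>\<phi>\<in>nvec (dual_nspace (quotient_nspace V B)).
    nnorm (dual_nspace (quotient_nspace V B)) \<phi> \<le> K \<and> (\<forall>v\<in>nvec V. \<phi> (coset B v) = \<psi> v)"
proof -
  interpret Q: seminormed_nspace "quotient_nspace V B" by (rule seminormed_quotient[OF B])
  define \<phi> where "\<phi> = (\<lambda>C\<in>nvec (quotient_nspace V B). \<psi> (SOME v. v \<in> C))"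
  have psi_coset: "\<psi> w = \<psi> v" if "v \<in> nvec V" "w \<in> coset B v" for v w
    using that psi zero nsubspace_in[OF B] by (auto simp: bounded_functional_def coset_def)
  have phi: "\<phi> (coset B v) = \<psi> v" if v: "v \<in> nvec V" for v
    using psi_coset[OF v someI[of "\<lambda>w. w \<in> coset B v", OF coset_self[OF B v]]] v
    by (simp add: \<phi>_def quotient_nvec[OF B])
  have bd: "\<bar>\<phi> C\<bar> \<le> K * nnorm (quotient_nspace V B) C" if "C \<in> nvec (quotient_nspace V B)" for C
  proof -
    have "C \<in> coset B ` nvec V" using that by (simp add: quotient_nvec[OF B])
    then obtain v where "C = coset B v" "v \<in> nvec V" by (rule imageE)
    then have v: "v \<in> nvec V" "C = coset B v" by auto
    have *: "\<bar>\<psi> v\<bar> \<le> K * nnorm V w" if w: "w \<in> coset B v" for w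
    proof -
      have "w \<in> nvec V" using w coset_subset[OF B v(1)] by auto
      then have "\<bar>\<psi> w\<bar> \<le> K * nnorm V w" using psi by (simp add: bounded_functional_def)
      then show ?thesis using psi_coset[OF v(1) w] by simp
    qed
    have "\<bar>\<psi> v\<bar> \<le> K * nnorm (quotient_nspace V B) (coset B v)"
    \<comment> \<open>The bound is moved through the infimum after division by \<open>K\<close>, so
      \<open>K = 0\<close> is treated apart.\<close>
    proof (cases "K = 0")
      case True
      then show ?thesis using *[OF coset_self[OF B v(1)]] by simp
    next
      case False
      then have "0 < K" using psi by simp
      then have "\<bar>\<psi> v\<bar> / K \<le> nnorm (quotient_nspace V B) (coset B v)"
        using * by (intro quotient_norm_ge[OF B v(1)]) (auto simp: pos_divide_le_eq mult.commute)
      then show ?thesis using \<open>0 < K\<close> by (simp add: pos_divide_le_eq mult.commute)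
    qed
    then show ?thesis using v phi by simp
  qed
  have "Q.bounded_functional \<phi> K"
    unfolding Q.bounded_functional_def
    using bd psi by (auto simp: quotient_nvec[OF B] quotient_add[OF B] quotient_scale[OF B] phi
        add_closed scale_closed bounded_functional_def)
  moreover have "\<phi> \<in> extensional (nvec (quotient_nspace V B))" by (simp add: \<phi>_def)
  ultimately have "\<phi> \<in> nvec (dual_nspace (quotient_nspace V B))" by (auto simp: Q.dual_nvec_iff)
  moreover have "nnorm (dual_nspace (quotient_nspace V B)) \<phi> \<le> K"
    by (rule Q.dual_norm_le[OF psi(2) bd])
  ultimately show ?thesis using phi by auto
qed

lemma dual_quotient_eqI:
  assumes B: "nsubspace B" and "\<phi> \<in> nvec (dual_nspace (quotient_nspace V B))"
    "\<psi> \<in> nvec (dual_nspace (quotient_nspace V B))"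
    and "\<And>v. v \<in> nvec V \<Longrightarrow> \<phi> (coset B v) = \<psi> (coset B v)"
  shows "\<phi> = \<psi>"
proof -
  interpret Q: seminormed_nspace "quotient_nspace V B" by (rule seminormed_quotient[OF B])
  show ?thesis using assms
    by (intro extensionalityI[of _ "nvec (quotient_nspace V B)"])
       (auto simp: Q.dual_nvec_iff quotient_nvec[OF B])
qed

end

section \<open>Classes of functions\<close>

lemma ae_class_eq_iff:
  assumes "f \<in> borel_measurable M" "g \<in> borel_measurable M"
  shows "ae_class M f = ae_class M g \<longleftrightarrow> (AE x in M. f x = g x)"
proof
  assume "ae_class M f = ae_class M g"
  moreover have "f \<in> ae_class M f" using assms by (simp add: ae_class_def)
  ultimately show "AE x in M. f x = g x" by (simp add: ae_class_def)
next
  assume fg: "AE x in M. f x = g x"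
  have "(AE x in M. h x = f x) \<longleftrightarrow> (AE x in M. h x = g x)" for h
  proof
    show "AE x in M. h x = g x" if "AE x in M. h x = f x" using that fg by eventually_elim simp
    show "AE x in M. h x = f x" if "AE x in M. h x = g x" using that fg by eventually_elim simp
  qed
  then show "ae_class M f = ae_class M g" by (simp add: ae_class_def)
qed

lemma ae_class_in_L0: "f \<in> borel_measurable M \<Longrightarrow> ae_class M f \<in> L0 M"
  by (simp add: L0_def)

lemma rep_in:
  assumes "u \<in> L0 M"
  shows "rep u \<in> u"
proof -
  obtain f where "f \<in> u" using assms by (auto simp: L0_def ae_class_def)
  then show ?thesis unfolding rep_def by (rule someI[of "\<lambda>f. f \<in> u"])
qed

lemma rep_measurable: "u \<in> L0 M \<Longrightarrow> rep u \<in> borel_measurable M"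
  using rep_in[of u M] by (auto simp: L0_def ae_class_def)

lemma rep_ae_class:
  assumes "f \<in> borel_measurable M"
  shows "AE x in M. rep (ae_class M f) x = f x"
  using rep_in[OF ae_class_in_L0[OF assms]] by (simp add: ae_class_def)

lemma ae_class_rep: "u \<in> L0 M \<Longrightarrow> ae_class M (rep u) = u"
  using rep_in[of u M] ae_class_eq_iff rep_measurable by (fastforce simp: L0_def ae_class_def)

lemma L0_eqI:
  assumes "u \<in> L0 M" "v \<in> L0 M" "AE x in M. rep u x = rep v x"
  shows "u = v"
  using assms ae_class_eq_iff[OF rep_measurable[OF assms(1)] rep_measurable[OF assms(2)]]
  by (simp add: ae_class_rep)

lemma L0_add_in: "u \<in> L0 M \<Longrightarrow> v \<in> L0 M \<Longrightarrow> L0_add M u v \<in> L0 M"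
  unfolding L0_add_def by (intro ae_class_in_L0 borel_measurable_add rep_measurable)

lemma L0_scale_in: "u \<in> L0 M \<Longrightarrow> L0_scale M c u \<in> L0 M"
  unfolding L0_scale_def by (intro ae_class_in_L0 borel_measurable_times borel_measurable_const rep_measurable)

lemma L0_fmult_in: "u \<in> L0 M \<Longrightarrow> h \<in> borel_measurable M \<Longrightarrow> L0_fmult M h u \<in> L0 M"
  unfolding L0_fmult_def by (intro ae_class_in_L0 borel_measurable_times rep_measurable)

lemma rep_add: "u \<in> L0 M \<Longrightarrow> v \<in> L0 M \<Longrightarrow> AE x in M. rep (L0_add M u v) x = rep u x + rep v x"
  unfolding L0_add_def by (intro rep_ae_class borel_measurable_add rep_measurable)

lemma rep_scale: "u \<in> L0 M \<Longrightarrow> AE x in M. rep (L0_scale M c u) x = c * rep u x"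
  unfolding L0_scale_def by (intro rep_ae_class borel_measurable_times borel_measurable_const rep_measurable)

lemma rep_fmult: "u \<in> L0 M \<Longrightarrow> h \<in> borel_measurable M \<Longrightarrow> AE x in M. rep (L0_fmult M h u) x = h x * rep u x"
  unfolding L0_fmult_def by (intro rep_ae_class borel_measurable_times rep_measurable)

lemma L0_add_assoc:
  assumes L: "x \<in> L0 M" "y \<in> L0 M" "z \<in> L0 M"
  shows "L0_add M (L0_add M x y) z = L0_add M x (L0_add M y z)"
  using rep_add[OF L0_add_in[OF L(1,2)] L(3)] rep_add[OF L(1,2)] rep_add[OF L(1) L0_add_in[OF L(2,3)]] rep_add[OF L(2,3)]
  by (intro L0_eqI[where M = M] L0_add_in L) auto

lemma L0_add_commute: "L0_add M x y = L0_add M y x"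
  by (simp add: L0_add_def add.commute)

lemma L0_scale_right:
  assumes L: "x \<in> L0 M" "y \<in> L0 M"
  shows "L0_scale M c (L0_add M x y) = L0_add M (L0_scale M c x) (L0_scale M c y)"
  using rep_scale[OF L0_add_in[OF L], of c] rep_add[OF L] rep_add[OF L0_scale_in[OF L(1)] L0_scale_in[OF L(2)], of c c]
    rep_scale[OF L(1), of c] rep_scale[OF L(2), of c]
  by (intro L0_eqI[where M = M] L0_add_in L0_scale_in L) (auto simp: distrib_left)

lemma L0_scale_left:
  assumes L: "x \<in> L0 M"
  shows "L0_scale M (a + b) x = L0_add M (L0_scale M a x) (L0_scale M b x)"
  using rep_scale[OF L, of "a + b"] rep_scale[OF L, of a] rep_scale[OF L, of b]
    rep_add[OF L0_scale_in[OF L] L0_scale_in[OF L], of a b]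
  by (intro L0_eqI[where M = M] L0_add_in L0_scale_in L) (auto simp: distrib_right)

lemma L0_scale_scale:
  assumes L: "x \<in> L0 M"
  shows "L0_scale M a (L0_scale M b x) = L0_scale M (a * b) x"
  using rep_scale[OF L, of "a * b"] rep_scale[OF L, of b] rep_scale[OF L0_scale_in[OF L], of a b]
  by (intro L0_eqI[where M = M] L0_scale_in L) auto

lemma L0_scale_one: "x \<in> L0 M \<Longrightarrow> L0_scale M 1 x = x"
  by (simp add: L0_scale_def ae_class_rep)

section \<open>The normed space of classes with integrable powers\<close>

lemma Lp_iff: "u \<in> Lp M p \<longleftrightarrow> u \<in> L0 M \<and> rep u \<in> Lpf M p"
  by (auto simp: Lp_def Lpf_def rep_measurable)

lemma Lp_L0: "u \<in> Lp M p \<Longrightarrow> u \<in> L0 M"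
  by (simp add: Lp_def)

lemma Lp_norm_eq: "Lp_norm M p u = Npf M p (rep u)"
  by (simp add: Lp_norm_def Npf_def)

lemma ae_class_in_Lp:
  assumes "f \<in> Lpf M p" "0 < p"
  shows "ae_class M f \<in> Lp M p" "Lp_norm M p (ae_class M f) = Npf M p f"
proof -
  have f: "f \<in> borel_measurable M" using assms by (simp add: Lpf_def)
  note L0 = ae_class_in_L0[OF f]
  show "ae_class M f \<in> Lp M p"
    using assms f L0 by (auto simp: Lp_iff intro!: Lpf_cong_AE[OF assms(1)] rep_measurable rep_ae_class)
  show "Lp_norm M p (ae_class M f) = Npf M p f"
    unfolding Lp_norm_eq using rep_ae_class[OF f] rep_measurable[OF L0] f by (rule Npf_cong_AE)
qed

lemma Lp_add: "u \<in> Lp M p \<Longrightarrow> v \<in> Lp M p \<Longrightarrow> 1 \<le> p \<Longrightarrow> L0_add M u v \<in> Lp M p"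
  unfolding L0_add_def by (intro ae_class_in_Lp Lpf_add) (auto simp: Lp_iff)

lemma Lp_scale: "u \<in> Lp M p \<Longrightarrow> 0 < p \<Longrightarrow> L0_scale M c u \<in> Lp M p"
  unfolding L0_scale_def by (intro ae_class_in_Lp Lpf_scale) (auto simp: Lp_iff)

lemma normed_Lp:
  assumes p: "1 \<le> p"
  shows "normed_nspace (Lp_nspace M p)"
proof -
  note [simp] = Lp_nspace_def
  show ?thesis
  proof (unfold_locales, goal_cases)
    case 1
    have "(\<lambda>x. 0) \<in> Lpf M p" by (simp add: Lpf_def)
    then have "ae_class M (\<lambda>x. 0) \<in> Lp M p" using p by (intro ae_class_in_Lp) auto
    then show ?case by auto
  next
    case (2 x y)
    then show ?case using p by (simp add: Lp_add)
  next
    case (3 c x)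
    then show ?case using p by (simp add: Lp_scale)
  next
    case (4 x y z)
    then show ?case by (simp add: L0_add_assoc Lp_L0)
  next
    case (5 x y)
    then show ?case by (simp add: L0_add_commute)
  next
    case (6 c x y)
    then show ?case by (simp add: L0_scale_right Lp_L0)
  next
    case (7 a b x)
    then show ?case by (simp add: L0_scale_left Lp_L0)
  next
    case (8 a b x)
    then show ?case by (simp add: L0_scale_scale Lp_L0)
  next
    case (9 x)
    then show ?case by (simp add: L0_scale_one Lp_L0)
  next
    case (10 x y)
    then show ?case by (simp add: L0_scale_def)
  next
    case (11 x)
    then show ?case by (simp add: Lp_norm_eq Npf_nonneg)
  next
    case (12 x y)
    then have "rep x \<in> Lpf M p" "rep y \<in> Lpf M p" by (simp_all add: Lp_iff)
    then show ?case using p by (simp add: L0_add_def ae_class_in_Lp Lpf_add Lp_norm_eq[of M p x] Lp_norm_eq[of M p y])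
  next
    case (13 c x)
    then have "rep x \<in> Lpf M p" by (simp_all add: Lp_iff)
    then show ?case using p by (simp add: L0_scale_def ae_class_in_Lp Lpf_scale Lp_norm_eq[of M p x])
  next
    case (14 x)
    then have L: "x \<in> L0 M" by (simp add: Lp_L0)
    have "AE y in M. rep x y = 0" using 14 p by (intro Npf_eq_0) (auto simp: Lp_iff Lp_norm_eq)
    then have "x = L0_scale M 0 x"
      using rep_scale[OF L, of 0] by (intro L0_eqI[where M = M] L L0_scale_in) auto
    then show ?case by simp
  qed
qed

text \<open>A least member is a greatest lower bound, and mutual comparison makes such a class
  unique; the definite description is thus resolved by exhibiting a minimum.\<close>

lemma essential_infimum_eq:
  assumes "u \<in> G" "G \<subseteq> L0 M" "\<And>g. g \<in> G \<Longrightarrow> AE x in M. rep u x \<le> rep g x"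
  shows "essential_infimum M G = u"
  unfolding essential_infimum_def
proof (rule the_equality)
  show "u \<in> L0 M \<and> (\<forall>g\<in>G. L0_le M u g) \<and> (\<forall>v\<in>L0 M. (\<forall>g\<in>G. L0_le M v g) \<longrightarrow> L0_le M v u)"
    using assms by (auto simp: L0_le_def)
  fix v assume v: "v \<in> L0 M \<and> (\<forall>g\<in>G. L0_le M v g) \<and> (\<forall>w\<in>L0 M. (\<forall>g\<in>G. L0_le M w g) \<longrightarrow> L0_le M w v)"
  then have "L0_le M v u" "L0_le M u v" using assms by (auto simp: L0_le_def)
  then have "AE x in M. rep v x = rep u x" by (auto simp: L0_le_def)
  then show "v = u" using v assms by (intro L0_eqI[of v M u]) auto
qed

section \<open>Density of the Lipschitz functions\<close>

text \<open>Compactness packaged as an induction: what holds near each point and passes to unions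
  and subsets holds on the whole set. The separation lemmas apply it to the existence of a suitable
  Lipschitz function.\<close>

lemma compactin_finite_union_induct:
  assumes K: "compactin T K" and empty: "P {}"
    and union: "\<And>U V. P U \<Longrightarrow> P V \<Longrightarrow> P (U \<union> V)" and mono: "\<And>U V. P V \<Longrightarrow> U \<subseteq> V \<Longrightarrow> P U"
    and local: "\<And>x. x \<in> K \<Longrightarrow> \<exists>U. openin T U \<and> x \<in> U \<and> P U"
  shows "P K"
proof -
  have "\<exists>\<F>. finite \<F> \<and> \<F> \<subseteq> {U. openin T U \<and> P U} \<and> K \<subseteq> \<Union>\<F>"
    using K local by (intro compactinD) auto
  then obtain \<F> where F: "finite \<F>" "\<F> \<subseteq> {U. openin T U \<and> P U}" "K \<subseteq> \<Union>\<F>" by blast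
  have "P (\<Union>\<F>)" using F(1,2) by induction (auto intro: empty union)
  then show ?thesis using F(3) by (rule mono)
qed

locale emtm =
  fixes T :: "'a topology" and d :: "'a \<Rightarrow> 'a \<Rightarrow> ennreal" and M :: "'a measure"
  assumes emtm: "emtm_space T d M"
begin

lemma space_M: "space M = topspace T"
  and sets_M: "sets M = sigma_sets (topspace T) {U. openin T U}"
  and Hausdorff: "Hausdorff_space T"
  using emtm
  by (auto simp: emtm_space_def finite_Radon_measure_def extended_metric_topological_space_def)

sublocale finite_measure M
  using emtm by (simp add: emtm_space_def finite_Radon_measure_def)

lemma inner_regular: "A \<in> sets M \<Longrightarrow> emeasure M A = (SUP K\<in>{K. compactin T K \<and> K \<subseteq> A}. emeasure M K)"
  using emtm by (simp add: emtm_space_def finite_Radon_measure_def)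

lemma openin_sets: "openin T U \<Longrightarrow> U \<in> sets M"
  by (simp add: sets_M sigma_sets.Basic)

lemma compactin_sets:
  assumes "compactin T K"
  shows "K \<in> sets M"
proof -
  have "closedin T K" using compactin_imp_closedin[OF Hausdorff assms] .
  then have "K = space M - (topspace T - K)" "openin T (topspace T - K)"
    by (auto simp: closedin_def space_M)
  then show ?thesis using openin_sets sets.compl_sets by metis
qed

lemma d_eq_0: "x \<in> topspace T \<Longrightarrow> y \<in> topspace T \<Longrightarrow> d x y = 0 \<longleftrightarrow> x = y"
  using emtm unfolding emtm_space_def extended_metric_topological_space_def extended_distance_on_def by blast

text \<open>The product form treats coincident points and points at infinite distance uniformly,
  which the supremum of quotients does not.\<close>

lemma Lip_finite_iff: "Lip d f (topspace T) < \<infinity> \<longleftrightarrow>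
  (\<exists>L>0. \<forall>x\<in>topspace T. \<forall>y\<in>topspace T. ennreal \<bar>f x - f y\<bar> \<le> ennreal L * d x y)"
proof
  assume fin: "Lip d f (topspace T) < \<infinity>"
  \<comment> \<open>The added 1 makes \<open>L\<close> positive, so that
    \<open>ennreal L * top = top\<close> covers infinite distances even for constant
    functions.\<close>
  define L where "L = enn2real (Lip d f (topspace T)) + 1"
  have L: "0 < L" "Lip d f (topspace T) \<le> ennreal L"
    using fin by (auto simp: L_def intro: add_nonneg_pos)
  have "ennreal \<bar>f x - f y\<bar> \<le> ennreal L * d x y" if xy: "x \<in> topspace T" "y \<in> topspace T" for x y
  proof (cases "x = y \<or> d x y = top")
    case True
    then show ?thesis using L by (auto simp: ennreal_mult_top)
  next
    case False
    then have nz: "d x y \<noteq> 0" "d x y \<noteq> top" using d_eq_0[OF xy] by auto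
    have "ennreal \<bar>f x - f y\<bar> / d x y \<le> Lip d f (topspace T)"
      unfolding Lip_def using xy False by (intro SUP_upper2[where i = "(x, y)"]) auto
    then have "ennreal \<bar>f x - f y\<bar> / d x y \<le> ennreal L" using L by simp
    then have "ennreal \<bar>f x - f y\<bar> / d x y * d x y \<le> ennreal L * d x y" by (intro mult_right_mono) auto
    then show ?thesis using nz by (simp add: ennreal_divide_times less_top)
  qed
  then show "\<exists>L>0. \<forall>x\<in>topspace T. \<forall>y\<in>topspace T. ennreal \<bar>f x - f y\<bar> \<le> ennreal L * d x y"
    using L by blast
next
  assume "\<exists>L>0. \<forall>x\<in>topspace T. \<forall>y\<in>topspace T. ennreal \<bar>f x - f y\<bar> \<le> ennreal L * d x y"
  then obtain L where L: "\<And>x y. x \<in> topspace T \<Longrightarrow> y \<in> topspace T \<Longrightarrow> ennreal \<bar>f x - f y\<bar> \<le> ennreal L * d x y"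
    by blast
  have "Lip d f (topspace T) \<le> ennreal L"
    unfolding Lip_def
  proof (rule SUP_least, clarify)
    fix x y assume "x \<in> topspace T" "y \<in> topspace T" "x \<noteq> y"
    then show "ennreal \<bar>f x - f y\<bar> / d x y \<le> ennreal L"
      using L[of x y] d_eq_0[of x y]
      by (intro divide_le_posI_ennreal) (auto simp: zero_less_iff_neq_zero mult.commute)
  qed
  then show "Lip d f (topspace T) < \<infinity>" by (simp add: order_le_less_trans)
qed

lemma Lipb_iff: "f \<in> Lipb T d \<longleftrightarrow> (\<forall>x. x \<notin> topspace T \<longrightarrow> f x = 0) \<and> (\<exists>A. \<forall>x. \<bar>f x\<bar> \<le> A) \<and>
  continuous_map T euclideanreal f \<and>
  (\<exists>L>0. \<forall>x\<in>topspace T. \<forall>y\<in>topspace T. ennreal \<bar>f x - f y\<bar> \<le> ennreal L * d x y)"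
proof -
  have "bounded (f ` topspace T) \<longleftrightarrow> (\<exists>A. \<forall>x. \<bar>f x\<bar> \<le> A)" if "\<forall>x. x \<notin> topspace T \<longrightarrow> f x = 0"
  proof
    assume "bounded (f ` topspace T)"
    then obtain A where A: "\<And>x. x \<in> topspace T \<Longrightarrow> \<bar>f x\<bar> \<le> A" by (auto simp: bounded_iff)
    have "\<bar>f x\<bar> \<le> \<bar>A\<bar>" for x using A[of x] that by (cases "x \<in> topspace T") auto
    then show "\<exists>A. \<forall>x. \<bar>f x\<bar> \<le> A" by blast
  qed (auto simp: bounded_iff)
  then show ?thesis unfolding Lipb_def mem_Collect_eq Lip_finite_iff by blast
qed

lemma Lipb_outside: "f \<in> Lipb T d \<Longrightarrow> x \<notin> topspace T \<Longrightarrow> f x = 0"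
  by (simp add: Lipb_def)

lemma Lipb_bound: "f \<in> Lipb T d \<Longrightarrow> \<exists>A\<ge>0. \<forall>x. \<bar>f x\<bar> \<le> A"
  unfolding Lipb_iff by (metis abs_ge_zero order_trans)

lemma Lipb_openin:
  assumes "f \<in> Lipb T d" "open S"
  shows "openin T {x \<in> topspace T. f x \<in> S}"
  using assms openin_continuous_map_preimage[of T euclideanreal f S] by (simp add: Lipb_def)

lemma Lipb_measurable: "f \<in> Lipb T d \<Longrightarrow> f \<in> borel_measurable M"
proof (rule borel_measurableI)
  fix S :: "real set" assume "f \<in> Lipb T d" "open S"
  then have "openin T {x \<in> topspace T. f x \<in> S}"
    by (rule Lipb_openin)
  moreover have "f -` S \<inter> space M = {x \<in> topspace T. f x \<in> S}" by (auto simp: space_M)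
  ultimately show "f -` S \<inter> space M \<in> sets M" by (simp add: openin_sets)
qed

lemma Lipb_bounded_measurable: "f \<in> Lipb T d \<Longrightarrow> f \<in> bounded_measurable M"
  using Lipb_bound[of f] Lipb_measurable[of f] by (auto simp: bounded_measurable_def)

text \<open>One argument for sums, products and lattice operations. On the bounded range of
  \<open>f\<close> and \<open>g\<close> a Lipschitz bound for \<open>\<phi>\<close> yields
  boundedness, by comparison with the origin, as well as the Lipschitz estimate;
  \<open>\<phi> 0 0 = 0\<close> preserves the extension by 0 outside the space.\<close>

lemma Lipb_binary:
  assumes f: "f \<in> Lipb T d" and g: "g \<in> Lipb T d"
    and zero: "\<phi> 0 0 = 0" and cont: "continuous_on UNIV (\<lambda>z. \<phi> (fst z) (snd z))"
    and lip: "\<And>A. \<exists>L>0. \<forall>a b a' b'. \<bar>a\<bar> \<le> A \<longrightarrow> \<bar>b\<bar> \<le> A \<longrightarrow> \<bar>a'\<bar> \<le> A \<longrightarrow> \<bar>b'\<bar> \<le> A \<longrightarrow>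
      \<bar>\<phi> a b - \<phi> a' b'\<bar> \<le> L * (\<bar>a - a'\<bar> + \<bar>b - b'\<bar>)"
  shows "(\<lambda>x. \<phi> (f x) (g x)) \<in> Lipb T d"
proof -
  obtain A B where AB: "\<And>x. \<bar>f x\<bar> \<le> A" "\<And>x. \<bar>g x\<bar> \<le> B" "0 \<le> A" "0 \<le> B"
    using Lipb_bound[OF f] Lipb_bound[OF g] by blast
  define C where "C = A + B"
  have C: "\<bar>f x\<bar> \<le> C" "\<bar>g x\<bar> \<le> C" for x
    using AB(1,2)[of x] AB(3,4) unfolding C_def by linarith+
  have C0: "0 \<le> C" using AB by (simp add: C_def)
  obtain L where L: "0 < L" and lipL: "\<And>a b a' b'. \<bar>a\<bar> \<le> C \<Longrightarrow> \<bar>b\<bar> \<le> C \<Longrightarrow> \<bar>a'\<bar> \<le> C \<Longrightarrow> \<bar>b'\<bar> \<le> C \<Longrightarrow>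
      \<bar>\<phi> a b - \<phi> a' b'\<bar> \<le> L * (\<bar>a - a'\<bar> + \<bar>b - b'\<bar>)" using lip[of C] by blast
  have "\<bar>\<phi> (f x) (g x)\<bar> \<le> L * (C + C)" for x
  proof -
    have "\<bar>\<phi> (f x) (g x) - \<phi> 0 0\<bar> \<le> L * (\<bar>f x - 0\<bar> + \<bar>g x - 0\<bar>)" using C C0 by (intro lipL) auto
    also have "\<dots> \<le> L * (C + C)" using C[of x] L by (intro mult_left_mono add_mono) auto
    finally show ?thesis by (simp add: zero)
  qed
  moreover have "\<phi> (f x) (g x) = 0" if "x \<notin> topspace T" for x
    using that f g by (simp add: Lipb_outside zero)
  moreover have "continuous_map T euclideanreal (\<lambda>x. \<phi> (f x) (g x))"
  proof -
    have "continuous_map T euclidean (\<lambda>x. (f x, g x))"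
      unfolding prod_topology_euclidean[symmetric]
      using f g by (intro continuous_map_pairedI) (auto simp: Lipb_def)
    moreover have "continuous_map euclidean euclideanreal (\<lambda>z. \<phi> (fst z) (snd z))" using cont by simp
    ultimately have "continuous_map T euclideanreal ((\<lambda>z. \<phi> (fst z) (snd z)) \<circ> (\<lambda>x. (f x, g x)))"
      by (rule continuous_map_compose)
    then show ?thesis by (simp add: o_def)
  qed
  moreover have "\<exists>L>0. \<forall>x\<in>topspace T. \<forall>y\<in>topspace T.
      ennreal \<bar>\<phi> (f x) (g x) - \<phi> (f y) (g y)\<bar> \<le> ennreal L * d x y"
  proof -
    obtain F where F: "0 < F" "\<And>x y. x \<in> topspace T \<Longrightarrow> y \<in> topspace T \<Longrightarrow> ennreal \<bar>f x - f y\<bar> \<le> ennreal F * d x y"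
      using f unfolding Lipb_iff by blast
    obtain G where G: "0 < G" "\<And>x y. x \<in> topspace T \<Longrightarrow> y \<in> topspace T \<Longrightarrow> ennreal \<bar>g x - g y\<bar> \<le> ennreal G * d x y"
      using g unfolding Lipb_iff by blast
    have "ennreal \<bar>\<phi> (f x) (g x) - \<phi> (f y) (g y)\<bar> \<le> ennreal (L * (F + G)) * d x y"
      if xy: "x \<in> topspace T" "y \<in> topspace T" for x y
    proof -
      have "ennreal \<bar>\<phi> (f x) (g x) - \<phi> (f y) (g y)\<bar> \<le> ennreal (L * (\<bar>f x - f y\<bar> + \<bar>g x - g y\<bar>))"
        using C by (intro ennreal_leI lipL) auto
      also have "\<dots> = ennreal L * (ennreal \<bar>f x - f y\<bar> + ennreal \<bar>g x - g y\<bar>)"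
        using L by (simp add: ennreal_mult ennreal_plus)
      also have "\<dots> \<le> ennreal L * (ennreal F * d x y + ennreal G * d x y)"
        using xy F G by (intro mult_left_mono add_mono) auto
      also have "\<dots> = ennreal (L * (F + G)) * d x y"
        using L F G by (simp add: ennreal_mult ennreal_plus distrib_right distrib_left mult.assoc)
      finally show ?thesis .
    qed
    then show ?thesis using L F G by (intro exI[of _ "L * (F + G)"]) auto
  qed
  ultimately show ?thesis unfolding Lipb_iff by blast
qed

lemma Lipb_add: "f \<in> Lipb T d \<Longrightarrow> g \<in> Lipb T d \<Longrightarrow> (\<lambda>x. f x + g x) \<in> Lipb T d"
  by (rule Lipb_binary) (auto intro!: continuous_intros exI[of _ 1])

lemma Lipb_scale: "f \<in> Lipb T d \<Longrightarrow> (\<lambda>x. c * f x) \<in> Lipb T d"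
proof (rule Lipb_binary[of f f "\<lambda>a b. c * a"])
  show "\<exists>L>0. \<forall>a b a' b'. \<bar>a\<bar> \<le> A \<longrightarrow> \<bar>b\<bar> \<le> A \<longrightarrow> \<bar>a'\<bar> \<le> A \<longrightarrow> \<bar>b'\<bar> \<le> A \<longrightarrow>
      \<bar>c * a - c * a'\<bar> \<le> L * (\<bar>a - a'\<bar> + \<bar>b - b'\<bar>)" for A :: real
  proof (intro exI[of _ "\<bar>c\<bar> + 1"] conjI allI impI)
    fix a b a' b' :: real
    have "\<bar>c * a - c * a'\<bar> = \<bar>c\<bar> * \<bar>a - a'\<bar>" by (simp add: right_diff_distrib[symmetric] abs_mult)
    also have "\<dots> \<le> (\<bar>c\<bar> + 1) * (\<bar>a - a'\<bar> + \<bar>b - b'\<bar>)" by (intro mult_mono) auto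
    finally show "\<bar>c * a - c * a'\<bar> \<le> (\<bar>c\<bar> + 1) * (\<bar>a - a'\<bar> + \<bar>b - b'\<bar>)" .
  qed simp
qed (auto intro!: continuous_intros)

lemma Lipb_mult: "f \<in> Lipb T d \<Longrightarrow> g \<in> Lipb T d \<Longrightarrow> (\<lambda>x. f x * g x) \<in> Lipb T d"
proof (rule Lipb_binary[of f g "\<lambda>a b. a * b"])
  show "\<exists>L>0. \<forall>a b a' b'. \<bar>a\<bar> \<le> A \<longrightarrow> \<bar>b\<bar> \<le> A \<longrightarrow> \<bar>a'\<bar> \<le> A \<longrightarrow> \<bar>b'\<bar> \<le> A \<longrightarrow>
      \<bar>a * b - a' * b'\<bar> \<le> L * (\<bar>a - a'\<bar> + \<bar>b - b'\<bar>)" for A :: real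
  proof (intro exI[of _ "\<bar>A\<bar> + 1"] conjI allI impI)
    fix a b a' b' :: real assume *: "\<bar>a\<bar> \<le> A" "\<bar>b\<bar> \<le> A" "\<bar>a'\<bar> \<le> A" "\<bar>b'\<bar> \<le> A"
    have "\<bar>a * b - a' * b'\<bar> = \<bar>(a - a') * b + a' * (b - b')\<bar>" by (simp add: algebra_simps)
    also have "\<dots> \<le> \<bar>a - a'\<bar> * \<bar>b\<bar> + \<bar>a'\<bar> * \<bar>b - b'\<bar>" by (metis abs_mult abs_triangle_ineq)
    also have "\<dots> \<le> \<bar>a - a'\<bar> * (\<bar>A\<bar> + 1) + (\<bar>A\<bar> + 1) * \<bar>b - b'\<bar>"
      using * by (intro add_mono mult_mono) auto
    finally show "\<bar>a * b - a' * b'\<bar> \<le> (\<bar>A\<bar> + 1) * (\<bar>a - a'\<bar> + \<bar>b - b'\<bar>)" by (simp add: algebra_simps)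
  qed simp
qed (auto intro!: continuous_intros)

lemma Lipb_max: "f \<in> Lipb T d \<Longrightarrow> g \<in> Lipb T d \<Longrightarrow> (\<lambda>x. max (f x) (g x)) \<in> Lipb T d"
  by (rule Lipb_binary) (auto intro!: continuous_intros exI[of _ 1])

lemma Lipb_min: "f \<in> Lipb T d \<Longrightarrow> g \<in> Lipb T d \<Longrightarrow> (\<lambda>x. min (f x) (g x)) \<in> Lipb T d"
  by (rule Lipb_binary) (auto intro!: continuous_intros exI[of _ 1])

text \<open>The constant 1 in the encoding that extends by 0. It is the unit of the algebra, and
  affine changes of Lipschitz functions use it in place of real constants.\<close>

definition unit_fun :: "'a \<Rightarrow> real" where "unit_fun x = indicator (topspace T) x"

lemma Lipb_unit: "unit_fun \<in> Lipb T d"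
proof -
  have "continuous_map T euclideanreal unit_fun"
    by (rule continuous_map_eq[where f = "\<lambda>x. 1"]) (auto simp: unit_fun_def)
  moreover have "\<exists>A. \<forall>x. \<bar>unit_fun x\<bar> \<le> A" by (rule exI[of _ 1]) (simp add: unit_fun_def indicator_def)
  ultimately show ?thesis unfolding Lipb_iff by (auto simp: unit_fun_def intro!: exI[of _ 1])
qed

lemma Lipb_const: "(\<lambda>x. c * unit_fun x) \<in> Lipb T d"
  by (intro Lipb_scale Lipb_unit)

section \<open>Separation of points and compact sets\<close>

lemma Lipb_separates:
  assumes "x \<in> topspace T" "y \<in> topspace T" "x \<noteq> y"
  shows "\<exists>f\<in>Lipb T d. f x = 1 \<and> f y = 0"
proof -
  have "\<exists>f\<in>Lipb T d. f x \<noteq> f y"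
  proof (rule ccontr)
    assume no: "\<not> ?thesis"
    \<comment> \<open>If no function separated the points, the formula recovering the distance would
      give 0.\<close>
    have "d x y = (SUP f\<in>{f \<in> Lipb T d. Lip d f (topspace T) \<le> 1}. ennreal \<bar>f x - f y\<bar>)"
      using emtm assms by (simp add: emtm_space_def extended_metric_topological_space_def)
    also have "\<dots> \<le> 0" using no by (intro SUP_least) auto
    finally show False using d_eq_0 assms by simp
  qed
  then obtain f where f: "f \<in> Lipb T d" "f x \<noteq> f y" by blast
  have "(\<lambda>z. 1 / (f x - f y) * (f z + (- f y) * unit_fun z)) \<in> Lipb T d"
    by (intro Lipb_scale Lipb_add f Lipb_unit)
  then show ?thesis using f assms by (intro bexI) (auto simp: unit_fun_def)
qed

text \<open>By compactness finitely many functions suffice, and their minimum keeps the value 1 at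
  \<open>x\<close>. The threshold 1 / 3, together with 2 / 3 below, leaves room for a final
  truncation.\<close>

lemma Lipb_separates_compact_point:
  assumes K: "compactin T K" and x: "x \<in> topspace T" "x \<notin> K"
  shows "\<exists>f\<in>Lipb T d. f x = 1 \<and> (\<forall>y\<in>K. f y < 1 / 3)"
proof (rule compactin_finite_union_induct[OF K])
  show "\<exists>f\<in>Lipb T d. f x = 1 \<and> (\<forall>y\<in>{}. f y < 1 / 3)"
    using x by (intro bexI[OF _ Lipb_unit]) (simp add: unit_fun_def)
  fix U V assume "\<exists>f\<in>Lipb T d. f x = 1 \<and> (\<forall>y\<in>U. f y < 1 / 3)" "\<exists>f\<in>Lipb T d. f x = 1 \<and> (\<forall>y\<in>V. f y < 1 / 3)"
  then obtain f g where fg: "f \<in> Lipb T d" "g \<in> Lipb T d" "f x = 1" "g x = 1"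
    "\<forall>y\<in>U. f y < 1 / 3" "\<forall>y\<in>V. g y < 1 / 3" by blast
  then show "\<exists>f\<in>Lipb T d. f x = 1 \<and> (\<forall>y\<in>U \<union> V. f y < 1 / 3)"
    by (intro bexI[OF _ Lipb_min[OF fg(1,2)]]) (auto simp: min_def)
next
  fix y assume y: "y \<in> K"
  then have "y \<in> topspace T" using compactin_subset_topspace[OF K] by auto
  then obtain f where f: "f \<in> Lipb T d" "f x = 1" "f y = 0" using Lipb_separates[OF x(1)] y x by metis
  then show "\<exists>U. openin T U \<and> y \<in> U \<and> (\<exists>f\<in>Lipb T d. f x = 1 \<and> (\<forall>y\<in>U. f y < 1 / 3))"
    using \<open>y \<in> topspace T\<close> Lipb_openin[OF f(1), of "{..<1/3}"]
    by (intro exI[of _ "{x \<in> topspace T. f x \<in> {..<1/3}}"]) auto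
qed blast

text \<open>The dual step: maxima over a finite cover of \<open>K\<close> are large on
  \<open>K\<close> and preserve smallness on \<open>K'\<close>.\<close>

lemma Lipb_Urysohn:
  assumes K: "compactin T K" and K': "compactin T K'" and disj: "K \<inter> K' = {}"
  shows "\<exists>h\<in>Lipb T d. (\<forall>x. 0 \<le> h x \<and> h x \<le> 1) \<and> (\<forall>x\<in>K. h x = 1) \<and> (\<forall>x\<in>K'. h x = 0)"
proof -
  have "\<exists>f\<in>Lipb T d. (\<forall>x\<in>K. 2 / 3 < f x) \<and> (\<forall>y\<in>K'. f y < 1 / 3)"
  proof (rule compactin_finite_union_induct[OF K])
    show "\<exists>f\<in>Lipb T d. (\<forall>x\<in>{}. 2 / 3 < f x) \<and> (\<forall>y\<in>K'. f y < 1 / 3)"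
      by (intro bexI[OF _ Lipb_const[of 0]]) simp
    fix U V assume "\<exists>f\<in>Lipb T d. (\<forall>x\<in>U. 2 / 3 < f x) \<and> (\<forall>y\<in>K'. f y < 1 / 3)"
      "\<exists>f\<in>Lipb T d. (\<forall>x\<in>V. 2 / 3 < f x) \<and> (\<forall>y\<in>K'. f y < 1 / 3)"
    then obtain f g where fg: "f \<in> Lipb T d" "g \<in> Lipb T d" "\<forall>x\<in>U. 2 / 3 < f x" "\<forall>x\<in>V. 2 / 3 < g x"
      "\<forall>y\<in>K'. f y < 1 / 3" "\<forall>y\<in>K'. g y < 1 / 3" by blast
    then show "\<exists>f\<in>Lipb T d. (\<forall>x\<in>U \<union> V. 2 / 3 < f x) \<and> (\<forall>y\<in>K'. f y < 1 / 3)"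
      by (intro bexI[OF _ Lipb_max[OF fg(1,2)]]) (auto simp: max_def)
  next
    fix x assume x: "x \<in> K"
    then have X: "x \<in> topspace T" "x \<notin> K'" using compactin_subset_topspace[OF K] disj by auto
    obtain f where f: "f \<in> Lipb T d" "f x = 1" "\<forall>y\<in>K'. f y < 1 / 3"
      using Lipb_separates_compact_point[OF K' X] by blast
    then show "\<exists>U. openin T U \<and> x \<in> U \<and> (\<exists>f\<in>Lipb T d. (\<forall>x\<in>U. 2 / 3 < f x) \<and> (\<forall>y\<in>K'. f y < 1 / 3))"
      using X Lipb_openin[OF f(1), of "{2/3<..}"]
      by (intro exI[of _ "{x \<in> topspace T. f x \<in> {2/3<..}}"]) auto
  qed blast
  then obtain f where f: "f \<in> Lipb T d" "\<forall>x\<in>K. 2 / 3 < f x" "\<forall>y\<in>K'. f y < 1 / 3" by blast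
  \<comment> \<open>The affine map \<open>3 * f - 1\<close> sends values above 2 / 3 above 1 and
    values below 1 / 3 below 0; clipping to [0, 1] makes both exact.\<close>
  define h where "h x = max (0 * unit_fun x) (min (1 * unit_fun x) (3 * f x + (- 1) * unit_fun x))" for x
  have "h \<in> Lipb T d"
    unfolding h_def by (intro Lipb_max Lipb_min Lipb_add Lipb_scale f Lipb_unit)
  moreover have "0 \<le> h x \<and> h x \<le> 1" for x by (auto simp: h_def unit_fun_def indicator_def)
  moreover have "h x = 1" if "x \<in> K" for x
  proof -
    have "unit_fun x = 1" "2 / 3 < f x"
      using that f(2) compactin_subset_topspace[OF K] by (auto simp: unit_fun_def)
    then show ?thesis by (simp add: h_def)
  qed
  moreover have "h x = 0" if "x \<in> K'" for x
  proof -
    have "unit_fun x = 1" "f x < 1 / 3"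
      using that f(3) compactin_subset_topspace[OF K'] by (auto simp: unit_fun_def)
    then show ?thesis by (simp add: h_def)
  qed
  ultimately show ?thesis by blast
qed

section \<open>Density by inner regularity\<close>

lemma inner_regular_approx:
  assumes A: "A \<in> sets M" and e: "0 < e"
  shows "\<exists>K. compactin T K \<and> K \<subseteq> A \<and> measure M A - e < measure M K"
proof (rule ccontr)
  assume "\<not> ?thesis"
  then have le: "measure M K \<le> measure M A - e" if "compactin T K" "K \<subseteq> A" for K
    using that by (meson not_less)
  have "0 \<le> measure M A - e" using le[of "{}"] by simp
  have "ennreal (measure M A) = (SUP K\<in>{K. compactin T K \<and> K \<subseteq> A}. emeasure M K)"
    using inner_regular[OF A] by (simp add: emeasure_eq_measure)
  also have "\<dots> \<le> ennreal (measure M A - e)"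
    using le by (intro SUP_least) (auto simp: emeasure_eq_measure intro!: ennreal_leI)
  finally have "measure M A \<le> measure M A - e" using \<open>0 \<le> measure M A - e\<close> by simp
  then show False using e by simp
qed

text \<open>Compact sets fill both \<open>A\<close> and its complement up to measure
  \<open>e / 2\<close>. A Urysohn function for the two compact sets differs from the indicator only
  on the leftovers, and there by at most 1.\<close>

lemma Lipb_dense_indicator:
  assumes A: "A \<in> sets M" and e: "0 < e"
  shows "\<exists>h\<in>Lipb T d. (\<integral>x. \<bar>indicator A x - h x\<bar> \<partial>M) < e"
proof -
  have e2: "0 < e / 2" using e by simp
  obtain K where K: "compactin T K" "K \<subseteq> A" "measure M A - e / 2 < measure M K"
    using inner_regular_approx[OF A e2] by blast
  have A': "space M - A \<in> sets M" using A by auto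
  obtain K' where K': "compactin T K'" "K' \<subseteq> space M - A" "measure M (space M - A) - e / 2 < measure M K'"
    using inner_regular_approx[OF A' e2] by blast
  have "K \<inter> K' = {}" using K K' by auto
  then obtain h where h: "h \<in> Lipb T d" "\<And>x. 0 \<le> h x" "\<And>x. h x \<le> 1" "\<forall>x\<in>K. h x = 1" "\<forall>x\<in>K'. h x = 0"
    using Lipb_Urysohn[OF K(1) K'(1)] by blast
  have Ks: "K \<in> sets M" "K' \<in> sets M" using compactin_sets K K' by auto
  have [measurable]: "h \<in> borel_measurable M" using Lipb_measurable[OF h(1)] .
  let ?R = "\<lambda>x. indicator (A - K) x + indicator (space M - A - K') x :: real"
  have le: "\<bar>indicator A x - h x\<bar> \<le> ?R x" if "x \<in> space M" for x
    using that h(2,3)[of x] h(4,5) K K' by (auto split: split_indicator)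
  have intR: "integrable M ?R" using A A' Ks by (auto intro!: Bochner_Integration.integrable_add integrable_real_indicator simp: less_top[symmetric])
  have "(\<integral>x. \<bar>indicator A x - h x\<bar> \<partial>M) \<le> (\<integral>x. ?R x \<partial>M)"
    using le A by (intro integral_mono_AE' intR) auto
  also have "\<dots> = measure M (A - K) + measure M (space M - A - K')"
    using A A' Ks by (subst Bochner_Integration.integral_add)
      (auto intro!: integrable_real_indicator simp: less_top[symmetric])
  also have "\<dots> = (measure M A - measure M K) + (measure M (space M - A) - measure M K')"
    using A A' Ks K K' by (simp add: finite_measure_Diff)
  also have "\<dots> < e" using K K' by linarith
  finally show ?thesis using h by blast
qed

lemma Lipb_integrable: "h \<in> Lipb T d \<Longrightarrow> integrable M h"
  using bounded_mult_integrable[OF Lipb_bounded_measurable, of h "\<lambda>x. 1"] by simp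

lemma Lipb_dense_L1:
  assumes "integrable M f"
  shows "0 < e \<Longrightarrow> \<exists>h\<in>Lipb T d. (\<integral>x. \<bar>f x - h x\<bar> \<partial>M) < e"
  using assms
proof (induction f arbitrary: e rule: integrable_induct)
  case (base A c)
  have "0 < e / (\<bar>c\<bar> + 1)" using base by simp
  then obtain h where h: "h \<in> Lipb T d" "(\<integral>x. \<bar>indicator A x - h x\<bar> \<partial>M) < e / (\<bar>c\<bar> + 1)"
    using Lipb_dense_indicator[OF base(1)] by blast
  have "(\<integral>x. \<bar>indicator A x *\<^sub>R c - c * h x\<bar> \<partial>M) = (\<integral>x. \<bar>c\<bar> * \<bar>indicator A x - h x\<bar> \<partial>M)"
    by (intro Bochner_Integration.integral_cong refl) (simp add: abs_mult[symmetric] algebra_simps)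
  also have "\<dots> = \<bar>c\<bar> * (\<integral>x. \<bar>indicator A x - h x\<bar> \<partial>M)" by simp
  also have "\<dots> \<le> (\<bar>c\<bar> + 1) * (\<integral>x. \<bar>indicator A x - h x\<bar> \<partial>M)" by (intro mult_right_mono) auto
  also have "\<dots> < e" using h(2) by (simp add: pos_less_divide_eq mult.commute)
  finally show ?case by (rule bexI[OF _ Lipb_scale[OF h(1)]])
next
  case (add f g)
  then have e: "0 < e / 2" by simp
  obtain h where h: "h \<in> Lipb T d" "(\<integral>x. \<bar>f x - h x\<bar> \<partial>M) < e / 2" using add.IH(1)[OF e] by blast
  obtain k where k: "k \<in> Lipb T d" "(\<integral>x. \<bar>g x - k x\<bar> \<partial>M) < e / 2" using add.IH(2)[OF e] by blast
  have i: "integrable M (\<lambda>x. \<bar>f x - h x\<bar>)" "integrable M (\<lambda>x. \<bar>g x - k x\<bar>)"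
    using add h k Lipb_integrable by auto
  have "(\<integral>x. \<bar>(f x + g x) - (h x + k x)\<bar> \<partial>M) \<le> (\<integral>x. \<bar>f x - h x\<bar> + \<bar>g x - k x\<bar> \<partial>M)"
    using add h k Lipb_integrable i by (intro integral_mono) auto
  also have "\<dots> < e" using h k i by simp
  finally show ?case by (rule bexI[OF _ Lipb_add[OF h(1) k(1)]])
next
  case (lim f s)
  then have e: "0 < e / 2" by simp
  have "(\<lambda>i. \<integral>x. \<bar>f x - s i x\<bar> \<partial>M) \<longlonglongrightarrow> (\<integral>x. \<bar>f x - f x\<bar> \<partial>M)"
  proof (rule integral_dominated_convergence)
    show "integrable M (\<lambda>x. 3 * \<bar>f x\<bar>)" using lim by auto
    show "AE x in M. (\<lambda>i. \<bar>f x - s i x\<bar>) \<longlonglongrightarrow> \<bar>f x - f x\<bar>"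
      using lim by (intro AE_I2 tendsto_intros) auto
    show "AE x in M. norm \<bar>f x - s i x\<bar> \<le> 3 * \<bar>f x\<bar>" for i
      using lim.hyps(3)[of _ i] by (intro AE_I2) fastforce
  qed (use lim in auto)
  then have "(\<lambda>i. \<integral>x. \<bar>f x - s i x\<bar> \<partial>M) \<longlonglongrightarrow> 0" by simp
  then obtain i where i: "(\<integral>x. \<bar>f x - s i x\<bar> \<partial>M) < e / 2"
    using order_tendstoD(2)[OF _ e] by (metis (no_types, lifting) eventually_sequentially order_refl)
  obtain h where h: "h \<in> Lipb T d" "(\<integral>x. \<bar>s i x - h x\<bar> \<partial>M) < e / 2" using lim.IH[OF e] by blast
  have ii: "integrable M (\<lambda>x. \<bar>f x - s i x\<bar>)" "integrable M (\<lambda>x. \<bar>s i x - h x\<bar>)"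
    using lim h Lipb_integrable by auto
  have "(\<integral>x. \<bar>f x - h x\<bar> \<partial>M) \<le> (\<integral>x. \<bar>f x - s i x\<bar> + \<bar>s i x - h x\<bar> \<partial>M)"
    using lim h Lipb_integrable ii by (intro integral_mono) auto
  also have "\<dots> < e" using h i ii by simp
  finally show ?case using h by blast
qed

text \<open>L^1 approximants are clipped at the bound of \<open>h\<close>, which brings them no
  farther from \<open>h\<close>; a subsequence then converges almost everywhere under a uniform
  bound.\<close>

lemma Lipb_dense_bounded:
  assumes "h \<in> bounded_measurable M"
  shows "\<exists>s K. (\<forall>n. s n \<in> Lipb T d) \<and> 0 \<le> K \<and> (\<forall>n. \<forall>x\<in>space M. \<bar>s n x - h x\<bar> \<le> K) \<and>
    (AE x in M. (\<lambda>n. s n x) \<longlonglongrightarrow> h x)"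
proof (rule bounded_measurableE[OF assms])
  fix K assume K: "0 \<le> K" "\<And>x. x \<in> space M \<Longrightarrow> \<bar>h x\<bar> \<le> K" and [measurable]: "h \<in> borel_measurable M"
  have int: "integrable M h" using bounded_mult_integrable[OF assms, of "\<lambda>x. 1"] by simp
  have "\<exists>g\<in>Lipb T d. (\<integral>x. \<bar>h x - g x\<bar> \<partial>M) < 1 / real (Suc n)" for n
    by (rule Lipb_dense_L1[OF int]) simp
  then obtain g where g: "\<And>n. g n \<in> Lipb T d" "\<And>n. (\<integral>x. \<bar>h x - g n x\<bar> \<partial>M) < 1 / real (Suc n)" by metis
  define k where "k n x = max (- K * unit_fun x) (min (K * unit_fun x) (g n x))" for n x
  have k: "k n \<in> Lipb T d" for n
    unfolding k_def by (intro Lipb_max Lipb_min g Lipb_const)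
  have kh: "\<bar>k n x - h x\<bar> \<le> \<bar>h x - g n x\<bar>" if "x \<in> space M" for n x
    using K(2)[OF that] that by (auto simp: k_def unit_fun_def space_M)
  have kb: "\<bar>k n x - h x\<bar> \<le> 2 * K" if "x \<in> space M" for n x
    using K(1) K(2)[OF that] that by (auto simp: k_def unit_fun_def space_M)
  have ik: "integrable M (\<lambda>x. k n x - h x)" for n using int Lipb_integrable[OF k] by auto
  have "(\<lambda>n. \<integral>x. norm (k n x - h x) \<partial>M) \<longlonglongrightarrow> 0"
  proof (rule tendsto_sandwich[OF _ _ tendsto_const])
    show "(\<lambda>n. 1 / real (Suc n)) \<longlonglongrightarrow> 0" using LIMSEQ_inverse_real_of_nat by (simp add: inverse_eq_divide)
    show "\<forall>\<^sub>F n in sequentially. (\<integral>x. norm (k n x - h x) \<partial>M) \<le> 1 / real (Suc n)"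
    proof (intro always_eventually allI)
      fix n
      have "(\<integral>x. norm (k n x - h x) \<partial>M) \<le> (\<integral>x. \<bar>h x - g n x\<bar> \<partial>M)"
        using ik[of n] int Lipb_integrable[OF g(1)] kh by (intro integral_mono) auto
      then show "(\<integral>x. norm (k n x - h x) \<partial>M) \<le> 1 / real (Suc n)" using g(2)[of n] by linarith
    qed
  qed simp
  then obtain r :: "nat \<Rightarrow> nat" where r: "AE x in M. (\<lambda>n. k (r n) x - h x) \<longlonglongrightarrow> 0"
    using tendsto_L1_AE_subseq[of M "\<lambda>n x. k n x - h x", OF ik] by blast
  have "AE x in M. (\<lambda>n. k (r n) x) \<longlonglongrightarrow> h x" using r by eventually_elim (simp add: LIM_zero_iff)
  then show ?thesis using k kb K by (intro exI[of _ "\<lambda>n. k (r n)"] exI[of _ "2 * K"]) auto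
qed

text \<open>By dominated convergence a single sequence serves all exponents and weights. This
  matters where an L^1 and an L^q approximation must use the same Lipschitz coefficient.\<close>

lemma Lipb_approx_mult:
  assumes "h \<in> bounded_measurable M"
  obtains s where "\<And>n. s n \<in> Lipb T d"
    "\<And>p u. 0 < p \<Longrightarrow> u \<in> Lpf M p \<Longrightarrow> (\<lambda>n. Npf M p (\<lambda>x. (s n x - h x) * u x)) \<longlonglongrightarrow> 0"
proof -
  obtain s K where s: "\<And>n. s n \<in> Lipb T d" "0 \<le> K" "\<And>n x. x \<in> space M \<Longrightarrow> \<bar>s n x - h x\<bar> \<le> K"
    "AE x in M. (\<lambda>n. s n x) \<longlonglongrightarrow> h x" using Lipb_dense_bounded[OF assms] by blast
  have [measurable]: "s n \<in> borel_measurable M" "h \<in> borel_measurable M" for n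
    using Lipb_measurable s assms by (auto simp: bounded_measurable_def)
  have "(\<lambda>n. Npf M p (\<lambda>x. (s n x - h x) * u x)) \<longlonglongrightarrow> 0" if "0 < p" "u \<in> Lpf M p" for p u
  proof (rule Npf_tendsto_0)
    have [measurable]: "u \<in> borel_measurable M" using that by (simp add: Lpf_def)
    show "(\<lambda>x. K * u x) \<in> Lpf M p" using that by (intro Lpf_scale)
    show "(\<lambda>x. (s n x - h x) * u x) \<in> borel_measurable M" for n by measurable
    show "AE x in M. (\<lambda>n. (s n x - h x) * u x) \<longlonglongrightarrow> 0"
      using s(4)
    proof eventually_elim
      case (elim x)
      have "(\<lambda>n. (s n x - h x) * u x) \<longlonglongrightarrow> (h x - h x) * u x" by (intro tendsto_intros elim)
      then show ?case by simp
    qed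
    show "AE x in M. \<bar>(s n x - h x) * u x\<bar> \<le> \<bar>K * u x\<bar>" for n
      unfolding abs_mult using s(2,3) by (intro AE_I2 mult_right_mono) auto
  qed fact
  then show thesis using s(1) by (intro that[of s])
qed

text \<open>Approximate the sign of \<open>u - v\<close> by Lipschitz functions. Since integrals
  against these vanish, the integral of \<open>\<bar>u - v\<bar>\<close> is bounded by the
  approximation error. Uniqueness of divergences, of operators and of representing functions rests
  on this.\<close>

lemma Lipb_test_integral_eq:
  assumes u: "integrable M u" and v: "integrable M v"
    and eq: "\<And>h. h \<in> Lipb T d \<Longrightarrow> (\<integral>x. h x * u x \<partial>M) = (\<integral>x. h x * v x \<partial>M)"
  shows "AE x in M. u x = v x"
proof -
  define w where "w x = u x - v x" for x
  have w: "integrable M w" unfolding w_def using u v by auto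
  then have [measurable]: "w \<in> borel_measurable M" by auto
  have zero: "(\<integral>x. h x * w x \<partial>M) = 0" if h: "h \<in> Lipb T d" for h
  proof -
    have "(\<integral>x. h x * w x \<partial>M) = (\<integral>x. h x * u x - h x * v x \<partial>M)" by (simp add: w_def algebra_simps)
    also have "\<dots> = 0"
      using eq[OF h] bounded_mult_integrable[OF Lipb_bounded_measurable[OF h] u]
        bounded_mult_integrable[OF Lipb_bounded_measurable[OF h] v] by simp
    finally show ?thesis .
  qed
  have sg: "(\<lambda>x. sgn (w x)) \<in> bounded_measurable M"
    by (intro bounded_measurableI[where K = 1]) (auto simp: sgn_if)
  obtain s where s: "\<And>n. s n \<in> Lipb T d"
      "\<And>p u. 0 < p \<Longrightarrow> u \<in> Lpf M p \<Longrightarrow> (\<lambda>n. Npf M p (\<lambda>x. (s n x - sgn (w x)) * u x)) \<longlonglongrightarrow> 0"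
    using Lipb_approx_mult[OF sg] by blast
  have lim: "(\<lambda>n. \<integral>x. \<bar>(s n x - sgn (w x)) * w x\<bar> \<partial>M) \<longlonglongrightarrow> 0"
    using s(2)[of 1 w] w by (simp add: Lpf_1 Npf_1)
  have le: "(\<integral>x. \<bar>w x\<bar> \<partial>M) \<le> (\<integral>x. \<bar>(s n x - sgn (w x)) * w x\<bar> \<partial>M)" for n
  proof -
    note i = bounded_mult_integrable[OF Lipb_bounded_measurable[OF s(1)[of n]] w] bounded_mult_integrable[OF sg w]
    have "(\<integral>x. \<bar>w x\<bar> \<partial>M) = (\<integral>x. sgn (w x) * w x \<partial>M)" by (simp add: linordered_idom_class.abs_sgn mult.commute)
    also have "\<dots> = (\<integral>x. sgn (w x) * w x - s n x * w x \<partial>M)" using i zero[OF s(1)] by simp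
    also have "\<dots> \<le> (\<integral>x. \<bar>(s n x - sgn (w x)) * w x\<bar> \<partial>M)"
    proof (rule integral_mono)
      show "integrable M (\<lambda>x. \<bar>(s n x - sgn (w x)) * w x\<bar>)" using i by (auto simp: left_diff_distrib)
      show "sgn (w x) * w x - s n x * w x \<le> \<bar>(s n x - sgn (w x)) * w x\<bar>" for x
        by (simp add: left_diff_distrib)
    qed (use i in auto)
    finally show ?thesis .
  qed
  have "(\<integral>x. \<bar>w x\<bar> \<partial>M) \<le> 0" by (rule tendsto_lowerbound[OF lim]) (auto simp: le)
  moreover have "0 \<le> (\<integral>x. \<bar>w x\<bar> \<partial>M)" by simp
  ultimately have "(\<integral>x. \<bar>w x\<bar> \<partial>M) = 0" by linarith
  then have "AE x in M. \<bar>w x\<bar> = 0" using w by (subst (asm) integral_nonneg_eq_0_iff_AE) auto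
  then show ?thesis by eventually_elim (simp add: w_def)
qed

end

section \<open>Derivations\<close>

text \<open>Pointwise bounds and Sobolev bounds are both of the form \<open>\<bar>r\<^sub>i\<bar> \<le> g w\<^sub>i\<close>.\<close>

lemma essential_infimum_weighted_bounds:
  fixes r w :: "'i \<Rightarrow> 'a \<Rightarrow> real"
  assumes "finite_measure M" and p: "1 \<le> p" and w: "\<And>i. i \<in> I \<Longrightarrow> AE x in M. 0 \<le> w i x"
    and B_def: "\<B> = {g \<in> Lp_nonneg M p. \<forall>i\<in>I. AE x in M. \<bar>r i x\<bar> \<le> rep g x * w i x}"
    and ne: "\<B> \<noteq> {}"
  shows "essential_infimum M \<B> \<in> \<B>"
    and "G \<in> Lpf M p \<Longrightarrow> AE x in M. 0 \<le> G x \<Longrightarrow> (\<And>i. i \<in> I \<Longrightarrow> AE x in M. \<bar>r i x\<bar> \<le> G x * w i x) \<Longrightarrow>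
      AE x in M. rep (essential_infimum M \<B>) x \<le> G x"
proof -
  interpret finite_measure M by fact
  \<comment> \<open>Functions that are nonnegative everywhere, in place of classes, so that
    countable infima are real at every point.\<close>
  define \<G> where "\<G> = {G \<in> Lpf M p. (\<forall>x. 0 \<le> G x) \<and> (\<forall>i\<in>I. AE x in M. \<bar>r i x\<bar> \<le> G x * w i x)}"
  have abs_in: "(\<lambda>x. \<bar>G x\<bar>) \<in> \<G>"
    if G: "G \<in> Lpf M p" "AE x in M. 0 \<le> G x" "\<And>i. i \<in> I \<Longrightarrow> AE x in M. \<bar>r i x\<bar> \<le> G x * w i x" for G
  proof -
    have "AE x in M. \<bar>r i x\<bar> \<le> \<bar>G x\<bar> * w i x" if i: "i \<in> I" for i
      using G(2) G(3)[OF i] by eventually_elim simp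
    then show ?thesis using G(1) by (simp add: \<G>_def Lpf_abs)
  qed
  have B_abs: "(\<lambda>x. \<bar>rep g x\<bar>) \<in> \<G>" if "g \<in> \<B>" for g
    using that by (intro abs_in) (auto simp: B_def Lp_nonneg_def Lp_iff)
  have class_in: "ae_class M G \<in> \<B>" if G: "G \<in> \<G>" for G
  proof -
    have m: "G \<in> Lpf M p" using G by (simp add: \<G>_def)
    note eq = rep_ae_class[OF Lpf_measurable[OF m]]
    have "ae_class M G \<in> Lp M p" using m p by (intro ae_class_in_Lp) auto
    moreover have "AE x in M. 0 \<le> rep (ae_class M G) x"
      using eq by eventually_elim (use G in \<open>simp add: \<G>_def\<close>)
    moreover have "AE x in M. \<bar>r i x\<bar> \<le> rep (ae_class M G) x * w i x" if "i \<in> I" for i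
    proof -
      have "AE x in M. \<bar>r i x\<bar> \<le> G x * w i x" using G that by (simp add: \<G>_def)
      then show ?thesis using eq by eventually_elim simp
    qed
    ultimately show ?thesis by (simp add: B_def Lp_nonneg_def)
  qed
  have "\<exists>u\<in>\<G>. \<forall>G\<in>\<G>. AE x in M. u x \<le> G x"
  proof (rule ex_ess_inf)
    show "\<G> \<noteq> {}" using ne B_abs by blast
    show "integrable M G" if "G \<in> \<G>" for G using that p by (auto simp: \<G>_def intro: Lpf_imp_integrable)
    show "AE x in M. 0 \<le> G x" if "G \<in> \<G>" for G using that by (simp add: \<G>_def)
    fix G :: "nat \<Rightarrow> 'a \<Rightarrow> real" assume G: "\<And>n. G n \<in> \<G>"
    have G0: "0 \<le> G n x" for n x using G by (simp add: \<G>_def)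
    have bdd: "bdd_below (range (\<lambda>n. G n x))" for x using G0 by (auto intro!: bdd_belowI2[where m = 0])
    have m: "G n \<in> borel_measurable M" for n using G[of n] by (auto simp: \<G>_def Lpf_def)
    have le: "(INF n. G n x) \<le> G n x" for n x by (intro cINF_lower bdd) auto
    have nn: "0 \<le> (INF n. G n x)" for x by (intro cINF_greatest G0) auto
    have m_inf: "(\<lambda>x. INF n. G n x) \<in> borel_measurable M"
      by (intro borel_measurable_cINF m bdd) auto
    have G0L: "G 0 \<in> Lpf M p" using G[of 0] unfolding \<G>_def by blast
    have G0_le: "AE x in M. \<bar>INF n. G n x\<bar> \<le> \<bar>G 0 x\<bar>"
      by (intro AE_I2) (simp only: abs_of_nonneg[OF nn] abs_of_nonneg[OF G0] le)
    have inL: "(\<lambda>x. INF n. G n x) \<in> Lpf M p"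
      by (rule Lpf_mono(1)[OF G0L m_inf G0_le]) (use p in linarith)
    have "AE x in M. \<bar>r i x\<bar> \<le> (INF n. G n x) * w i x" if i: "i \<in> I" for i
    proof -
      have "AE x in M. \<forall>n. \<bar>r i x\<bar> \<le> G n x * w i x"
        using G i by (auto simp: AE_all_countable \<G>_def)
      then show ?thesis using w[OF i]
      proof eventually_elim
        case (elim x)
        show ?case
        \<comment> \<open>Where the weight vanishes the bounds already force
          \<open>r i x = 0\<close>; elsewhere division by the weight carries them to the
          infimum.\<close>
        proof (cases "w i x = 0")
          case False
          then have "0 < w i x" using elim by simp
          then have "\<bar>r i x\<bar> / w i x \<le> (INF n. G n x)"
            using elim by (intro cINF_greatest) (auto simp: pos_divide_le_eq)
          then show ?thesis using \<open>0 < w i x\<close> by (simp add: pos_divide_le_eq)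
        qed (use elim in auto)
      qed
    qed
    then show "(\<lambda>x. INF n. G n x) \<in> \<G>" using nn inL by (simp add: \<G>_def)
  qed
  then obtain u where u: "u \<in> \<G>" "\<And>G. G \<in> \<G> \<Longrightarrow> AE x in M. u x \<le> G x" by blast
  have um: "u \<in> borel_measurable M" using u(1) by (auto simp: \<G>_def Lpf_def)
  have u_le: "AE x in M. rep (ae_class M u) x \<le> G x"
    if G: "G \<in> Lpf M p" "AE x in M. 0 \<le> G x" "\<And>i. i \<in> I \<Longrightarrow> AE x in M. \<bar>r i x\<bar> \<le> G x * w i x" for G
  proof -
    have "(\<lambda>x. \<bar>G x\<bar>) \<in> \<G>" using G by (rule abs_in)
    from u(2)[OF this] show ?thesis using G(2) rep_ae_class[OF um] by eventually_elim simp
  qed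
  have eq: "essential_infimum M \<B> = ae_class M u"
  proof (rule essential_infimum_eq[OF class_in[OF u(1)]])
    show "\<B> \<subseteq> L0 M" by (auto simp: B_def Lp_nonneg_def Lp_iff)
    show "AE x in M. rep (ae_class M u) x \<le> rep g x" if "g \<in> \<B>" for g
      using that by (intro u_le) (auto simp: B_def Lp_nonneg_def Lp_iff)
  qed
  show "essential_infimum M \<B> \<in> \<B>" unfolding eq by (rule class_in[OF u(1)])
  show "AE x in M. rep (essential_infimum M \<B>) x \<le> G x"
    if "G \<in> Lpf M p" "AE x in M. 0 \<le> G x" "\<And>i. i \<in> I \<Longrightarrow> AE x in M. \<bar>r i x\<bar> \<le> G x * w i x"
    unfolding eq using that by (rule u_le)
qed

section \<open>Slopes and pointwise operations on derivations\<close>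

context emtm
begin

text \<open>On the space the conversion to real values loses nothing for Lipschitz functions,
  because the global Lipschitz constant bounds the asymptotic slope.\<close>

definition slope :: "('a \<Rightarrow> real) \<Rightarrow> 'a \<Rightarrow> real" where
  "slope f x = enn2real (asymptotic_slope T d f x)"

lemma slope_nonneg: "0 \<le> slope f x"
  by (simp add: slope_def)

lemma asymptotic_slope_le: "x \<in> topspace T \<Longrightarrow> asymptotic_slope T d f x \<le> Lip d f (topspace T)"
  unfolding asymptotic_slope_def by (intro INF_lower) auto

lemma asymptotic_slope_eq:
  assumes "f \<in> Lipb T d" "x \<in> topspace T"
  shows "asymptotic_slope T d f x = ennreal (slope f x)"
proof -
  have "asymptotic_slope T d f x < top"
    using asymptotic_slope_le[OF assms(2), of f] assms(1) by (auto simp: Lipb_def order_le_less_trans)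
  then show ?thesis by (simp add: slope_def)
qed

lemma slope_bounded:
  assumes "f \<in> Lipb T d"
  shows "\<exists>S\<ge>0. \<forall>x\<in>topspace T. slope f x \<le> S"
proof (intro exI[of _ "enn2real (Lip d f (topspace T))"] conjI ballI)
  fix x assume "x \<in> topspace T"
  then show "slope f x \<le> enn2real (Lip d f (topspace T))"
    unfolding slope_def using assms asymptotic_slope_le[of x f] by (intro enn2real_mono) (auto simp: Lipb_def)
qed simp

text \<open>Brings the pointwise bounds into the real-valued shape treated by the common essential
  infimum argument.\<close>

lemma der_bounds_eq: "der_bounds T d M q b =
  {g \<in> Lp_nonneg M q. \<forall>f\<in>Lipb T d. AE x in M. \<bar>rep (b f) x\<bar> \<le> rep g x * slope f x}"
proof -
  have "(AE x in M. ennreal \<bar>rep (b f) x\<bar> \<le> ennreal (rep g x) * asymptotic_slope T d f x) \<longleftrightarrow>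
      (AE x in M. \<bar>rep (b f) x\<bar> \<le> rep g x * slope f x)"
    if g: "g \<in> Lp_nonneg M q" and f: "f \<in> Lipb T d" for g f
  proof -
    have "AE x in M. 0 \<le> rep g x" using g by (simp add: Lp_nonneg_def)
    then have "AE x in M. (ennreal \<bar>rep (b f) x\<bar> \<le> ennreal (rep g x) * asymptotic_slope T d f x) \<longleftrightarrow>
      (\<bar>rep (b f) x\<bar> \<le> rep g x * slope f x)"
      using AE_space
    proof eventually_elim
      case (elim x)
      then show ?case
        by (simp add: asymptotic_slope_eq[OF f] space_M ennreal_mult[symmetric] slope_nonneg)
    qed
    then show ?thesis by (rule eventually_subst)
  qed
  then show ?thesis unfolding der_bounds_def by auto
qed

lemma derivations_L0: "b \<in> derivations T d M \<Longrightarrow> f \<in> Lipb T d \<Longrightarrow> b f \<in> L0 M"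
  by (auto simp: derivations_def)

lemma derivations_ext: "b \<in> derivations T d M \<Longrightarrow> f \<notin> Lipb T d \<Longrightarrow> b f = undefined"
  by (auto simp: derivations_def)

text \<open>On representatives the derivation laws become almost everywhere identities, which
  combine by pointwise algebra; \<open>derivationsI\<close> is the way back to classes.\<close>

lemma derivationsD:
  assumes b: "b \<in> derivations T d M" and f: "f \<in> Lipb T d"
  shows "g \<in> Lipb T d \<Longrightarrow> AE x in M. rep (b (\<lambda>x. f x + g x)) x = rep (b f) x + rep (b g) x"
    and "AE x in M. rep (b (\<lambda>x. c * f x)) x = c * rep (b f) x"
    and "g \<in> Lipb T d \<Longrightarrow> AE x in M. rep (b (\<lambda>x. f x * g x)) x = f x * rep (b g) x + g x * rep (b f) x"
proof -
  show "AE x in M. rep (b (\<lambda>x. f x + g x)) x = rep (b f) x + rep (b g) x" if g: "g \<in> Lipb T d"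
    using assms g rep_add[OF derivations_L0[OF b f] derivations_L0[OF b g]] by (simp add: derivations_def)
  show "AE x in M. rep (b (\<lambda>x. c * f x)) x = c * rep (b f) x"
    using assms rep_scale[OF derivations_L0[OF b f]] by (simp add: derivations_def)
  show "AE x in M. rep (b (\<lambda>x. f x * g x)) x = f x * rep (b g) x + g x * rep (b f) x" if g: "g \<in> Lipb T d"
  proof -
    note m = Lipb_measurable[OF f] Lipb_measurable[OF g]
    note L = derivations_L0[OF b f] derivations_L0[OF b g]
    have "b (\<lambda>x. f x * g x) = L0_add M (L0_fmult M f (b g)) (L0_fmult M g (b f))"
      using assms g by (simp add: derivations_def)
    then show ?thesis
      using rep_add[OF L0_fmult_in[OF L(2) m(1)] L0_fmult_in[OF L(1) m(2)]]
        rep_fmult[OF L(2) m(1)] rep_fmult[OF L(1) m(2)] by auto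
  qed
qed

lemma derivationsI:
  assumes ext: "b \<in> extensional (Lipb T d)" and L0: "\<And>f. f \<in> Lipb T d \<Longrightarrow> b f \<in> L0 M"
    and add: "\<And>f g. f \<in> Lipb T d \<Longrightarrow> g \<in> Lipb T d \<Longrightarrow>
      AE x in M. rep (b (\<lambda>x. f x + g x)) x = rep (b f) x + rep (b g) x"
    and scale: "\<And>c f. f \<in> Lipb T d \<Longrightarrow> AE x in M. rep (b (\<lambda>x. c * f x)) x = c * rep (b f) x"
    and mult: "\<And>f g. f \<in> Lipb T d \<Longrightarrow> g \<in> Lipb T d \<Longrightarrow>
      AE x in M. rep (b (\<lambda>x. f x * g x)) x = f x * rep (b g) x + g x * rep (b f) x"
  shows "b \<in> derivations T d M"
proof -
  have 1: "b (\<lambda>x. f x + g x) = L0_add M (b f) (b g)" if fg: "f \<in> Lipb T d" "g \<in> Lipb T d" for f g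
    using add[OF fg] rep_add[OF L0[OF fg(1)] L0[OF fg(2)]]
    by (intro L0_eqI[where M = M] L0_add_in L0 Lipb_add fg) auto
  have 2: "b (\<lambda>x. c * f x) = L0_scale M c (b f)" if f: "f \<in> Lipb T d" for f c
    using scale[OF f, of c] rep_scale[OF L0[OF f], of c]
    by (intro L0_eqI[where M = M] L0_scale_in L0 Lipb_scale f) auto
  have 3: "b (\<lambda>x. f x * g x) = L0_add M (L0_fmult M f (b g)) (L0_fmult M g (b f))"
    if fg: "f \<in> Lipb T d" "g \<in> Lipb T d" for f g
  proof -
    note m = Lipb_measurable[OF fg(1)] Lipb_measurable[OF fg(2)]
    note L = L0[OF fg(1)] L0[OF fg(2)]
    show ?thesis
      using mult[OF fg] rep_add[OF L0_fmult_in[OF L(2) m(1)] L0_fmult_in[OF L(1) m(2)]]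
        rep_fmult[OF L(2) m(1)] rep_fmult[OF L(1) m(2)]
      by (intro L0_eqI[where M = M] L0_add_in L0_fmult_in L0 Lipb_mult fg m) auto
  qed
  show ?thesis using ext L0 1 2 3 by (auto simp: derivations_def PiE_def)
qed

lemma derivations_eqI:
  assumes "b \<in> derivations T d M" "c \<in> derivations T d M"
    and "\<And>f. f \<in> Lipb T d \<Longrightarrow> AE x in M. rep (b f) x = rep (c f) x"
  shows "b = c"
proof
  fix f show "b f = c f"
  proof (cases "f \<in> Lipb T d")
    case True
    show ?thesis by (rule L0_eqI[OF derivations_L0[OF assms(1) True] derivations_L0[OF assms(2) True] assms(3)[OF True]])
  qed (simp add: derivations_ext assms)
qed

lemma rep_der_add: "b \<in> derivations T d M \<Longrightarrow> c \<in> derivations T d M \<Longrightarrow> f \<in> Lipb T d \<Longrightarrow>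
    AE x in M. rep (der_add T d M b c f) x = rep (b f) x + rep (c f) x"
  using rep_add derivations_L0 by (fastforce simp: der_add_def)

lemma rep_der_scale: "b \<in> derivations T d M \<Longrightarrow> f \<in> Lipb T d \<Longrightarrow>
    AE x in M. rep (der_scale T d M a b f) x = a * rep (b f) x"
  using rep_scale derivations_L0 by (fastforce simp: der_scale_def)

lemma rep_der_fmult: "b \<in> derivations T d M \<Longrightarrow> h \<in> Lipb T d \<Longrightarrow> f \<in> Lipb T d \<Longrightarrow>
    AE x in M. rep (der_fmult T d M h b f) x = h x * rep (b f) x"
  using rep_fmult[OF derivations_L0 Lipb_measurable] by (simp add: der_fmult_def)

lemma derivations_add:
  assumes b: "b \<in> derivations T d M" and c: "c \<in> derivations T d M"
  shows "der_add T d M b c \<in> derivations T d M"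
proof (rule derivationsI)
  show "der_add T d M b c f \<in> L0 M" if "f \<in> Lipb T d" for f
    using that derivations_L0[OF b that] derivations_L0[OF c that] by (simp add: der_add_def L0_add_in)
  note r = rep_der_add[OF b c]
  show "AE x in M. rep (der_add T d M b c (\<lambda>x. f x + g x)) x = rep (der_add T d M b c f) x + rep (der_add T d M b c g) x"
    if "f \<in> Lipb T d" "g \<in> Lipb T d" for f g
    using r[OF Lipb_add[OF that]] r[OF that(1)] r[OF that(2)] derivationsD(1)[OF b that] derivationsD(1)[OF c that]
    by eventually_elim simp
  show "AE x in M. rep (der_add T d M b c (\<lambda>x. a * f x)) x = a * rep (der_add T d M b c f) x"
    if "f \<in> Lipb T d" for f a
    using r[OF Lipb_scale[OF that, of a]] r[OF that(1)] derivationsD(2)[OF b that, of a] derivationsD(2)[OF c that, of a]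
    by eventually_elim (simp add: distrib_left)
  show "AE x in M. rep (der_add T d M b c (\<lambda>x. f x * g x)) x
      = f x * rep (der_add T d M b c g) x + g x * rep (der_add T d M b c f) x"
    if "f \<in> Lipb T d" "g \<in> Lipb T d" for f g
    using r[OF Lipb_mult[OF that]] r[OF that(1)] r[OF that(2)] derivationsD(3)[OF b that] derivationsD(3)[OF c that]
    by eventually_elim (simp add: algebra_simps)
qed (simp add: der_add_def)

lemma derivations_fmult:
  assumes b: "b \<in> derivations T d M" and h: "h \<in> Lipb T d"
  shows "der_fmult T d M h b \<in> derivations T d M"
proof (rule derivationsI)
  show "der_fmult T d M h b f \<in> L0 M" if "f \<in> Lipb T d" for f
    using that derivations_L0[OF b that] Lipb_measurable[OF h] by (simp add: der_fmult_def L0_fmult_in)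
  note r = rep_der_fmult[OF b h]
  show "AE x in M. rep (der_fmult T d M h b (\<lambda>x. f x + g x)) x = rep (der_fmult T d M h b f) x + rep (der_fmult T d M h b g) x"
    if "f \<in> Lipb T d" "g \<in> Lipb T d" for f g
    using r[OF Lipb_add[OF that]] r[OF that(1)] r[OF that(2)] derivationsD(1)[OF b that]
    by eventually_elim (simp add: algebra_simps)
  show "AE x in M. rep (der_fmult T d M h b (\<lambda>x. a * f x)) x = a * rep (der_fmult T d M h b f) x"
    if "f \<in> Lipb T d" for f a
    using r[OF Lipb_scale[OF that, of a]] r[OF that(1)] derivationsD(2)[OF b that, of a]
    by eventually_elim simp
  show "AE x in M. rep (der_fmult T d M h b (\<lambda>x. f x * g x)) x
      = f x * rep (der_fmult T d M h b g) x + g x * rep (der_fmult T d M h b f) x"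
    if "f \<in> Lipb T d" "g \<in> Lipb T d" for f g
    using r[OF Lipb_mult[OF that]] r[OF that(1)] r[OF that(2)] derivationsD(3)[OF b that]
    by eventually_elim (simp add: algebra_simps)
qed (simp add: der_fmult_def)

lemma derivations_scale:
  assumes b: "b \<in> derivations T d M"
  shows "der_scale T d M c b \<in> derivations T d M"
proof (rule derivationsI)
  show "der_scale T d M c b f \<in> L0 M" if "f \<in> Lipb T d" for f
    using that derivations_L0[OF b that] by (simp add: der_scale_def L0_scale_in)
  note r = rep_der_scale[OF b, where a = c]
  show "AE x in M. rep (der_scale T d M c b (\<lambda>x. f x + g x)) x = rep (der_scale T d M c b f) x + rep (der_scale T d M c b g) x"
    if "f \<in> Lipb T d" "g \<in> Lipb T d" for f g
    using r[OF Lipb_add[OF that]] r[OF that(1)] r[OF that(2)] derivationsD(1)[OF b that]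
    by eventually_elim (simp add: algebra_simps)
  show "AE x in M. rep (der_scale T d M c b (\<lambda>x. a * f x)) x = a * rep (der_scale T d M c b f) x"
    if "f \<in> Lipb T d" for f a
    using r[OF Lipb_scale[OF that, of a]] r[OF that(1)] derivationsD(2)[OF b that, of a]
    by eventually_elim simp
  show "AE x in M. rep (der_scale T d M c b (\<lambda>x. f x * g x)) x
      = f x * rep (der_scale T d M c b g) x + g x * rep (der_scale T d M c b f) x"
    if "f \<in> Lipb T d" "g \<in> Lipb T d" for f g
    using r[OF Lipb_mult[OF that]] r[OF that(1)] r[OF that(2)] derivationsD(3)[OF b that]
    by eventually_elim (simp add: algebra_simps)
qed (simp add: der_scale_def)

end

section \<open>Derivations with integrable length\<close>

locale emtm_exponent = emtm +
  fixes q :: real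
  assumes q: "1 < q"
begin

abbreviation "D \<equiv> Der T d M q"
abbreviation "DD \<equiv> Der_div T d M q"

definition der_len :: "'a lderivation \<Rightarrow> 'a \<Rightarrow> real" where "der_len b = rep (der_abs T d M q b)"

definition div_fun :: "'a lderivation \<Rightarrow> 'a \<Rightarrow> real" where "div_fun b = rep (divergence T d M b)"

lemma D_derivation: "b \<in> D \<Longrightarrow> b \<in> derivations T d M"
  by (simp add: Der_def)

text \<open>The family of bounds has a least member, so the length is itself a bound and may be used
  in pointwise estimates.\<close>

lemma der_len_props:
  assumes b: "b \<in> D"
  shows "der_len b \<in> Lpf M q" "AE x in M. 0 \<le> der_len b x"
    "f \<in> Lipb T d \<Longrightarrow> AE x in M. \<bar>rep (b f) x\<bar> \<le> der_len b x * slope f x"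
    "G \<in> Lpf M q \<Longrightarrow> AE x in M. 0 \<le> G x \<Longrightarrow>
      (\<And>f. f \<in> Lipb T d \<Longrightarrow> AE x in M. \<bar>rep (b f) x\<bar> \<le> G x * slope f x) \<Longrightarrow> AE x in M. der_len b x \<le> G x"
proof -
  have ne: "der_bounds T d M q b \<noteq> {}" using b by (simp add: Der_def)
  note ei = essential_infimum_weighted_bounds[where M = M and p = q and I = "Lipb T d"
      and r = "\<lambda>f x. rep (b f) x" and w = slope and \<B> = "der_bounds T d M q b",
      OF finite_measure_axioms _ _ der_bounds_eq ne]
  have "der_abs T d M q b \<in> der_bounds T d M q b"
    unfolding der_abs_def using q by (intro ei) (auto simp: slope_nonneg)
  then show "der_len b \<in> Lpf M q" "AE x in M. 0 \<le> der_len b x"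
    "f \<in> Lipb T d \<Longrightarrow> AE x in M. \<bar>rep (b f) x\<bar> \<le> der_len b x * slope f x"
    by (auto simp: der_bounds_eq der_len_def Lp_nonneg_def Lp_iff)
  show "AE x in M. der_len b x \<le> G x" if "G \<in> Lpf M q" "AE x in M. 0 \<le> G x"
      "\<And>f. f \<in> Lipb T d \<Longrightarrow> AE x in M. \<bar>rep (b f) x\<bar> \<le> G x * slope f x"
    unfolding der_len_def der_abs_def using q that by (intro ei) (auto simp: slope_nonneg)
qed

text \<open>Accepts a bound given as a function; minimality of the length then yields the estimates
  for sums and multiples of derivations.\<close>

lemma DI:
  assumes b: "b \<in> derivations T d M" and G: "G \<in> Lpf M q" "AE x in M. 0 \<le> G x"
    "\<And>f. f \<in> Lipb T d \<Longrightarrow> AE x in M. \<bar>rep (b f) x\<bar> \<le> G x * slope f x"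
  shows "b \<in> D" "AE x in M. der_len b x \<le> G x"
proof -
  note eq = rep_ae_class[OF Lpf_measurable[OF G(1)]]
  have "ae_class M G \<in> Lp M q" using G q by (intro ae_class_in_Lp) auto
  moreover have "AE x in M. 0 \<le> rep (ae_class M G) x" using eq G(2) by eventually_elim simp
  moreover have "AE x in M. \<bar>rep (b f) x\<bar> \<le> rep (ae_class M G) x * slope f x" if "f \<in> Lipb T d" for f
    using eq G(3)[OF that] by eventually_elim simp
  ultimately have "ae_class M G \<in> der_bounds T d M q b" by (simp add: der_bounds_eq Lp_nonneg_def)
  then show "b \<in> D" using b by (auto simp: Der_def)
  then show "AE x in M. der_len b x \<le> G x" using G by (rule der_len_props(4))
qed

lemma D_add:
  assumes b: "b \<in> D" and c: "c \<in> D"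
  shows "der_add T d M b c \<in> D" "AE x in M. der_len (der_add T d M b c) x \<le> der_len b x + der_len c x"
proof -
  note * = derivations_add[OF D_derivation[OF b] D_derivation[OF c]]
  have 1: "(\<lambda>x. der_len b x + der_len c x) \<in> Lpf M q" using der_len_props(1)[OF b] der_len_props(1)[OF c] q by (intro Lpf_add) auto
  have 2: "AE x in M. 0 \<le> der_len b x + der_len c x" using der_len_props(2)[OF b] der_len_props(2)[OF c] by eventually_elim simp
  have 3: "AE x in M. \<bar>rep (der_add T d M b c f) x\<bar> \<le> (der_len b x + der_len c x) * slope f x" if f: "f \<in> Lipb T d" for f
    using rep_der_add[OF D_derivation[OF b] D_derivation[OF c] f] der_len_props(3)[OF b f] der_len_props(3)[OF c f]
    by eventually_elim (simp add: distrib_right)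
  show "der_add T d M b c \<in> D" "AE x in M. der_len (der_add T d M b c) x \<le> der_len b x + der_len c x"
    using DI[OF * 1 2 3] by auto
qed

lemma D_scale:
  assumes b: "b \<in> D"
  shows "der_scale T d M c b \<in> D" "AE x in M. der_len (der_scale T d M c b) x \<le> \<bar>c\<bar> * der_len b x"
proof -
  note * = derivations_scale[OF D_derivation[OF b]]
  have 1: "(\<lambda>x. \<bar>c\<bar> * der_len b x) \<in> Lpf M q" using der_len_props(1)[OF b] q by (intro Lpf_scale) auto
  have 2: "AE x in M. 0 \<le> \<bar>c\<bar> * der_len b x" using der_len_props(2)[OF b] by eventually_elim simp
  have 3: "AE x in M. \<bar>rep (der_scale T d M c b f) x\<bar> \<le> (\<bar>c\<bar> * der_len b x) * slope f x" if f: "f \<in> Lipb T d" for f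
    using rep_der_scale[OF D_derivation[OF b] f, of c] der_len_props(3)[OF b f]
    by eventually_elim (simp add: abs_mult mult.assoc mult_left_mono)
  show "der_scale T d M c b \<in> D" "AE x in M. der_len (der_scale T d M c b) x \<le> \<bar>c\<bar> * der_len b x"
    using DI[OF * 1 2 3] by auto
qed

lemma D_fmult:
  assumes b: "b \<in> D" and h: "h \<in> Lipb T d"
  shows "der_fmult T d M h b \<in> D" "AE x in M. der_len (der_fmult T d M h b) x \<le> \<bar>h x\<bar> * der_len b x"
proof -
  note * = derivations_fmult[OF D_derivation[OF b] h]
  have "(\<lambda>x. h x * der_len b x) \<in> Lpf M q"
    using der_len_props(1)[OF b] q by (intro bounded_mult_Lpf Lipb_bounded_measurable h) auto
  then have "(\<lambda>x. \<bar>h x * der_len b x\<bar>) \<in> Lpf M q" by (rule Lpf_abs)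
  then have 1: "(\<lambda>x. \<bar>h x\<bar> * \<bar>der_len b x\<bar>) \<in> Lpf M q" by (simp add: abs_mult)
  have 2: "AE x in M. 0 \<le> \<bar>h x\<bar> * \<bar>der_len b x\<bar>" by simp
  have 3: "AE x in M. \<bar>rep (der_fmult T d M h b f) x\<bar> \<le> (\<bar>h x\<bar> * \<bar>der_len b x\<bar>) * slope f x" if f: "f \<in> Lipb T d" for f
    using rep_der_fmult[OF D_derivation[OF b] h f] der_len_props(3)[OF b f] der_len_props(2)[OF b]
    by eventually_elim (simp add: abs_mult mult.assoc mult_left_mono)
  show "der_fmult T d M h b \<in> D" using DI[OF * 1 2 3] by auto
  show "AE x in M. der_len (der_fmult T d M h b) x \<le> \<bar>h x\<bar> * der_len b x"
  proof -
    have "AE x in M. der_len (der_fmult T d M h b) x \<le> \<bar>h x\<bar> * \<bar>der_len b x\<bar>" using * 1 2 3 by (rule DI(2))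
    then show ?thesis using der_len_props(2)[OF b] by eventually_elim simp
  qed
qed

text \<open>The slope of a Lipschitz function is bounded, so \<open>b f\<close> inherits the
  integrability of the length.\<close>

lemma D_integrable:
  assumes b: "b \<in> D" and f: "f \<in> Lipb T d"
  shows "rep (b f) \<in> Lpf M q" "integrable M (rep (b f))"
proof -
  obtain S where S: "0 \<le> S" "\<And>x. x \<in> topspace T \<Longrightarrow> slope f x \<le> S" using slope_bounded[OF f] by blast
  have m: "rep (b f) \<in> borel_measurable M" using rep_measurable derivations_L0 D_derivation b f by blast
  have "AE x in M. \<bar>rep (b f) x\<bar> \<le> \<bar>S * der_len b x\<bar>"
    using der_len_props(3)[OF b f] der_len_props(2)[OF b] AE_space
  proof eventually_elim
    case (elim x)
    have "der_len b x * slope f x \<le> der_len b x * S" using elim S by (intro mult_left_mono) (auto simp: space_M)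
    then show ?case using elim S by (simp add: mult.commute)
  qed
  then show "rep (b f) \<in> Lpf M q" using q der_len_props(1)[OF b] by (intro Lpf_mono(1)[OF Lpf_scale(1) m]) auto
  then show "integrable M (rep (b f))" using q by (intro Lpf_imp_integrable) auto
qed

lemma norm_D: "nnorm (Der_nspace T d M q) b = Npf M q (der_len b)"
  by (simp add: Der_nspace_def Lp_norm_eq der_len_def)

lemma zero_D: "(\<lambda>f\<in>Lipb T d. ae_class M (\<lambda>x. 0)) \<in> D" (is "?z \<in> _")
proof -
  have z: "AE x in M. rep (?z f) x = 0" if "f \<in> Lipb T d" for f
    using that rep_ae_class[of "\<lambda>x. 0" M] by simp
  have "?z \<in> derivations T d M"
  proof (rule derivationsI)
    fix f g assume fg: "f \<in> Lipb T d" "g \<in> Lipb T d"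
    show "AE x in M. rep (?z (\<lambda>x. f x + g x)) x = rep (?z f) x + rep (?z g) x"
      using z[OF fg(1)] z[OF fg(2)] z[OF Lipb_add[OF fg]] by eventually_elim simp
    show "AE x in M. rep (?z (\<lambda>x. f x * g x)) x = f x * rep (?z g) x + g x * rep (?z f) x"
      using z[OF fg(1)] z[OF fg(2)] z[OF Lipb_mult[OF fg]] by eventually_elim simp
  next
    fix f c assume f: "f \<in> Lipb T d"
    show "AE x in M. rep (?z (\<lambda>x. c * f x)) x = c * rep (?z f) x"
      using z[OF f] z[OF Lipb_scale[OF f]] by eventually_elim simp
  qed (auto intro: ae_class_in_L0)
  moreover have "(\<lambda>x. 0) \<in> Lpf M q" by (simp add: Lpf_def)
  moreover have "AE x in M. \<bar>rep (?z f) x\<bar> \<le> 0 * slope f x" if f: "f \<in> Lipb T d" for f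
    using z[OF f] by eventually_elim simp
  ultimately show ?thesis by (intro DI(1)[where G = "\<lambda>x. 0"]) auto
qed

lemma normed_D: "normed_nspace (Der_nspace T d M q)"
proof -
  have nspace: "nvec (Der_nspace T d M q) = D" "nadd (Der_nspace T d M q) = der_add T d M"
    "nscale (Der_nspace T d M q) = der_scale T d M"
    by (simp_all add: Der_nspace_def)
  have L0: "b f \<in> L0 M" if "b \<in> D" "f \<in> Lipb T d" for b f using that derivations_L0 D_derivation by blast
  note alg = der_add_def der_scale_def fun_eq_iff restrict_def
  show ?thesis
  proof (unfold_locales, unfold nspace norm_D, goal_cases)
    case 1
    show ?case using zero_D by blast
  next
    case (2 x y)
    then show ?case by (rule D_add)
  next
    case (3 c x)
    then show ?case by (rule D_scale)
  next
    case (4 x y z)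
    then show ?case by (auto simp: alg L0_add_assoc L0)
  next
    case (5 x y)
    then show ?case by (auto simp: alg L0_add_commute)
  next
    case (6 c x y)
    then show ?case by (auto simp: alg L0_scale_right L0)
  next
    case (7 a b x)
    then show ?case by (auto simp: alg L0_scale_left L0)
  next
    case (8 a b x)
    then show ?case by (auto simp: alg L0_scale_scale L0)
  next
    case (9 x)
    then show ?case using derivations_ext[OF D_derivation] by (auto simp: alg L0_scale_one L0)
  next
    case (10 x y)
    then show ?case by (auto simp: alg L0_scale_def)
  next
    case (11 x)
    show ?case by (rule Npf_nonneg)
  next
    case (12 x y)
    have "AE z in M. \<bar>der_len (der_add T d M x y) z\<bar> \<le> \<bar>der_len x z + der_len y z\<bar>"
      using D_add(2)[OF 12] der_len_props(2)[OF D_add(1)[OF 12]] by eventually_elim simp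
    then have "Npf M q (der_len (der_add T d M x y)) \<le> Npf M q (\<lambda>z. der_len x z + der_len y z)"
      using 12 q by (intro Lpf_mono(2)[where p = q] Lpf_add(1) der_len_props(1) D_add(1) Lpf_measurable[OF der_len_props(1)]) simp_all
    also have "\<dots> \<le> Npf M q (der_len x) + Npf M q (der_len y)" using 12 q by (intro Lpf_add(2) der_len_props(1)) simp_all
    finally show ?case .
  next
    case (13 c x)
    have "AE z in M. \<bar>der_len (der_scale T d M c x) z\<bar> \<le> \<bar>\<bar>c\<bar> * der_len x z\<bar>"
      using D_scale(2)[OF 13, of c] der_len_props(2)[OF D_scale(1)[OF 13, of c]] by eventually_elim simp
    then have "Npf M q (der_len (der_scale T d M c x)) \<le> Npf M q (\<lambda>z. \<bar>c\<bar> * der_len x z)"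
      using 13 q by (intro Lpf_mono(2)[where p = q] Lpf_scale(1) der_len_props(1) D_scale(1) Lpf_measurable[OF der_len_props(1)]) simp_all
    also have "\<dots> = \<bar>c\<bar> * Npf M q (der_len x)" using 13 q by (simp add: Lpf_scale(2) der_len_props(1))
    finally show ?case .
  next
    case (14 x)
    \<comment> \<open>Definiteness of the norm: a derivation of length 0 is killed by its own
      pointwise bound.\<close>
    have z: "AE y in M. der_len x y = 0" using 14 q by (intro Npf_eq_0[of _ M q] der_len_props(1)) auto
    show ?case
    proof (rule derivations_eqI)
      fix f assume f: "f \<in> Lipb T d"
      show "AE y in M. rep (x f) y = rep (der_scale T d M 0 x f) y"
        using z der_len_props(3)[OF 14(1) f] rep_der_scale[OF D_derivation[OF 14(1)] f, of 0]
        by eventually_elim simp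
    qed (use 14 D_derivation derivations_scale in auto)
  qed
qed

section \<open>Divergences\<close>

lemma is_divergence_unique:
  assumes "is_divergence T d M b u" "is_divergence T d M b v"
  shows "u = v"
proof -
  have uv: "integrable M (rep u)" "integrable M (rep v)" "u \<in> L0 M" "v \<in> L0 M"
    using assms by (auto simp: is_divergence_def Lp_iff Lpf_1)
  then show ?thesis
    using assms by (intro L0_eqI[OF uv(3,4)] Lipb_test_integral_eq uv) (auto simp: is_divergence_def)
qed

lemma divergence_eq: "is_divergence T d M b u \<Longrightarrow> divergence T d M b = u"
  unfolding divergence_def by (rule the_equality[OF _ is_divergence_unique])

lemma DD_D: "b \<in> DD \<Longrightarrow> b \<in> D"
  by (simp add: Der_div_def)

lemma DD_props:
  assumes b: "b \<in> DD"
  shows "divergence T d M b \<in> Lp M q" "div_fun b \<in> Lpf M q" "integrable M (div_fun b)"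
    "f \<in> Lipb T d \<Longrightarrow> (\<integral>x. rep (b f) x \<partial>M) = - (\<integral>x. f x * div_fun b x \<partial>M)"
proof -
  obtain u where "is_divergence T d M b u" using b by (auto simp: Der_div_def has_divergence_def)
  then have u: "is_divergence T d M b (divergence T d M b)" using divergence_eq by simp
  show 1: "divergence T d M b \<in> Lp M q" using b by (simp add: Der_div_def)
  then show 2: "div_fun b \<in> Lpf M q" by (simp add: div_fun_def Lp_iff)
  show "integrable M (div_fun b)" using Lpf_imp_integrable[OF 2] q by simp
  show "(\<integral>x. rep (b f) x \<partial>M) = - (\<integral>x. f x * div_fun b x \<partial>M)" if "f \<in> Lipb T d"
    using u that by (simp add: is_divergence_def div_fun_def)
qed

text \<open>By uniqueness any L^q function with the right integrals is the divergence; integrability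
  of each \<open>b f\<close> comes from membership in \<open>D\<close>.\<close>

lemma DDI:
  assumes b: "b \<in> D" and v: "v \<in> Lpf M q"
    and eq: "\<And>f. f \<in> Lipb T d \<Longrightarrow> (\<integral>x. rep (b f) x \<partial>M) = - (\<integral>x. f x * v x \<partial>M)"
  shows "b \<in> DD" "divergence T d M b = ae_class M v"
proof -
  note m = Lpf_measurable[OF v]
  have vi: "integrable M v" using v q by (intro Lpf_imp_integrable) auto
  have "is_divergence T d M b (ae_class M v)"
    unfolding is_divergence_def
  proof (intro conjI ballI)
    show "ae_class M v \<in> Lp M 1" using vi by (intro ae_class_in_Lp) (auto simp: Lpf_1)
    fix f assume f: "f \<in> Lipb T d"
    have "(\<integral>x. f x * rep (ae_class M v) x \<partial>M) = (\<integral>x. f x * v x \<partial>M)"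
      using rep_ae_class[OF m] Lipb_measurable[OF f] m rep_measurable[OF ae_class_in_L0[OF m]]
      by (intro integral_cong_AE) auto
    then show "(\<integral>x. rep (b f) x \<partial>M) = - (\<integral>x. f x * rep (ae_class M v) x \<partial>M)" using eq[OF f] by simp
  qed
  then have div: "divergence T d M b = ae_class M v" "\<exists>u. is_divergence T d M b u"
    using divergence_eq by auto
  moreover have "ae_class M v \<in> Lp M q" using v q by (intro ae_class_in_Lp) auto
  moreover have "b f \<in> Lp M 1" if "f \<in> Lipb T d" for f
    using D_integrable(2)[OF b that] derivations_L0[OF D_derivation[OF b] that] by (simp add: Lp_iff Lpf_1)
  ultimately show "b \<in> DD" "divergence T d M b = ae_class M v"
    using b by (auto simp: Der_div_def has_divergence_def)
qed

lemma zero_DD: "(\<lambda>f\<in>Lipb T d. ae_class M (\<lambda>x. 0)) \<in> DD"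
proof (rule DDI(1)[OF zero_D, where v = "\<lambda>x. 0"])
  fix f assume f: "f \<in> Lipb T d"
  have "(\<integral>x. rep (ae_class M (\<lambda>x. 0)) x \<partial>M) = (\<integral>x. 0 \<partial>M)"
    using rep_ae_class[of "\<lambda>x. 0" M] rep_measurable[OF ae_class_in_L0[of "\<lambda>x. 0" M]] by (intro integral_cong_AE) auto
  then show "(\<integral>x. rep ((\<lambda>f\<in>Lipb T d. ae_class M (\<lambda>x. 0)) f) x \<partial>M) = - (\<integral>x. f x * 0 \<partial>M)"
    using f by simp
qed (simp add: Lpf_def)

lemma DD_add:
  assumes b: "b \<in> DD" and c: "c \<in> DD"
  shows "der_add T d M b c \<in> DD"
    "divergence T d M (der_add T d M b c) = L0_add M (divergence T d M b) (divergence T d M c)"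
proof -
  note bD = DD_D[OF b] and cD = DD_D[OF c]
  have v: "(\<lambda>x. div_fun b x + div_fun c x) \<in> Lpf M q" using DD_props(2)[OF b] DD_props(2)[OF c] q by (intro Lpf_add) auto
  have eq: "(\<integral>x. rep (der_add T d M b c f) x \<partial>M) = - (\<integral>x. f x * (div_fun b x + div_fun c x) \<partial>M)" if f: "f \<in> Lipb T d" for f
  proof -
    have "(\<integral>x. rep (der_add T d M b c f) x \<partial>M) = (\<integral>x. rep (b f) x + rep (c f) x \<partial>M)"
      using rep_der_add[OF D_derivation[OF bD] D_derivation[OF cD] f]
        D_integrable(2)[OF D_add(1)[OF bD cD] f] D_integrable(2)[OF bD f] D_integrable(2)[OF cD f]
      by (intro integral_cong_AE) auto
    also have "\<dots> = - (\<integral>x. f x * div_fun b x \<partial>M) - (\<integral>x. f x * div_fun c x \<partial>M)"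
      using D_integrable(2)[OF bD f] D_integrable(2)[OF cD f] DD_props(4)[OF b f] DD_props(4)[OF c f] by simp
    also have "\<dots> = - (\<integral>x. f x * div_fun b x + f x * div_fun c x \<partial>M)"
      using bounded_mult_integrable[OF Lipb_bounded_measurable[OF f] DD_props(3)[OF b]]
        bounded_mult_integrable[OF Lipb_bounded_measurable[OF f] DD_props(3)[OF c]] by simp
    finally show ?thesis by (simp add: distrib_left)
  qed
  show "der_add T d M b c \<in> DD"
    "divergence T d M (der_add T d M b c) = L0_add M (divergence T d M b) (divergence T d M c)"
    using DDI[OF D_add(1)[OF bD cD] v eq] by (auto simp: L0_add_def div_fun_def)
qed

lemma DD_scale:
  assumes b: "b \<in> DD"
  shows "der_scale T d M a b \<in> DD" "divergence T d M (der_scale T d M a b) = L0_scale M a (divergence T d M b)"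
proof -
  note bD = DD_D[OF b]
  have v: "(\<lambda>x. a * div_fun b x) \<in> Lpf M q" using DD_props(2)[OF b] q by (intro Lpf_scale) auto
  have eq: "(\<integral>x. rep (der_scale T d M a b f) x \<partial>M) = - (\<integral>x. f x * (a * div_fun b x) \<partial>M)" if f: "f \<in> Lipb T d" for f
  proof -
    have "(\<integral>x. rep (der_scale T d M a b f) x \<partial>M) = (\<integral>x. a * rep (b f) x \<partial>M)"
      using rep_der_scale[OF D_derivation[OF bD] f]
        D_integrable(2)[OF D_scale(1)[OF bD] f] D_integrable(2)[OF bD f]
      by (intro integral_cong_AE) auto
    then show ?thesis using DD_props(4)[OF b f] by (simp add: mult.left_commute)
  qed
  show "der_scale T d M a b \<in> DD" "divergence T d M (der_scale T d M a b) = L0_scale M a (divergence T d M b)"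
    using DDI[OF D_scale(1)[OF bD] v eq] by (auto simp: L0_scale_def div_fun_def)
qed

text \<open>By the Leibniz rule the divergence of \<open>h b\<close> is
  \<open>h div(b) + b(h)\<close>, and both terms are in L^q. For merely measurable \<open>h\<close>
  the second term has no meaning, which is why multipliers of derivations are Lipschitz.\<close>

lemma DD_fmult:
  assumes b: "b \<in> DD" and h: "h \<in> Lipb T d"
  shows "der_fmult T d M h b \<in> DD"
proof -
  note bD = DD_D[OF b]
  note hm = Lipb_bounded_measurable[OF h]
  have v: "(\<lambda>x. h x * div_fun b x + rep (b h) x) \<in> Lpf M q"
    using DD_props(2)[OF b] D_integrable(1)[OF bD h] q by (intro Lpf_add bounded_mult_Lpf hm) auto
  have eq: "(\<integral>x. rep (der_fmult T d M h b f) x \<partial>M) = - (\<integral>x. f x * (h x * div_fun b x + rep (b h) x) \<partial>M)"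
    if f: "f \<in> Lipb T d" for f
  proof -
    note fm = Lipb_bounded_measurable[OF f]
    note i = bounded_mult_integrable[OF hm D_integrable(2)[OF bD f]] bounded_mult_integrable[OF fm D_integrable(2)[OF bD h]]
      bounded_mult_integrable[OF bounded_measurable_mult[OF hm fm] DD_props(3)[OF b]]
    have "(\<integral>x. rep (der_fmult T d M h b f) x \<partial>M) = (\<integral>x. h x * rep (b f) x \<partial>M)"
      using rep_der_fmult[OF D_derivation[OF bD] h f] i D_integrable(2)[OF D_fmult(1)[OF bD h] f]
      by (intro integral_cong_AE) auto
    \<comment> \<open>Adding and subtracting \<open>f b(h)\<close> completes the Leibniz expression
      for \<open>b(h f)\<close>, to which the divergence formula applies.\<close>
    also have "\<dots> = (\<integral>x. h x * rep (b f) x + f x * rep (b h) x \<partial>M) - (\<integral>x. f x * rep (b h) x \<partial>M)"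
      using i by simp
    also have "(\<integral>x. h x * rep (b f) x + f x * rep (b h) x \<partial>M) = (\<integral>x. rep (b (\<lambda>x. h x * f x)) x \<partial>M)"
      using derivationsD(3)[OF D_derivation[OF bD] h f] i D_integrable(2)[OF bD Lipb_mult[OF h f]]
      by (intro integral_cong_AE) auto
    also have "\<dots> = - (\<integral>x. h x * f x * div_fun b x \<partial>M)" by (rule DD_props(4)[OF b Lipb_mult[OF h f]])
    also have "\<dots> - (\<integral>x. f x * rep (b h) x \<partial>M) = - (\<integral>x. h x * f x * div_fun b x + f x * rep (b h) x \<partial>M)"
      using i by simp
    finally show ?thesis by (simp add: algebra_simps)
  qed
  show ?thesis by (rule DDI(1)[OF D_fmult(1)[OF bD h] v eq])
qed

section \<open>Module identities for derivations\<close>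

lemma der_eqI: "b \<in> D \<Longrightarrow> c \<in> D \<Longrightarrow> (\<And>f. f \<in> Lipb T d \<Longrightarrow> AE x in M. rep (b f) x = rep (c f) x) \<Longrightarrow> b = c"
  by (rule derivations_eqI) (auto intro: D_derivation)

lemma fmult_add_left:
  assumes b: "b \<in> D" and g: "g \<in> Lipb T d" and h: "h \<in> Lipb T d"
  shows "der_fmult T d M (\<lambda>x. g x + h x) b = der_add T d M (der_fmult T d M g b) (der_fmult T d M h b)"
proof (rule der_eqI)
  fix f assume f: "f \<in> Lipb T d"
  note bd = D_derivation[OF b]
  show "AE x in M. rep (der_fmult T d M (\<lambda>x. g x + h x) b f) x =
      rep (der_add T d M (der_fmult T d M g b) (der_fmult T d M h b) f) x"
    using rep_der_fmult[OF bd Lipb_add[OF g h] f] rep_der_fmult[OF bd g f] rep_der_fmult[OF bd h f]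
      rep_der_add[OF derivations_fmult[OF bd g] derivations_fmult[OF bd h] f]
    by eventually_elim (simp add: distrib_right)
qed (use b g h in \<open>auto intro: D_fmult D_add Lipb_add\<close>)

lemma fmult_scale_left:
  assumes b: "b \<in> D" and h: "h \<in> Lipb T d"
  shows "der_fmult T d M (\<lambda>x. c * h x) b = der_scale T d M c (der_fmult T d M h b)"
proof (rule der_eqI)
  fix f assume f: "f \<in> Lipb T d"
  note bd = D_derivation[OF b]
  show "AE x in M. rep (der_fmult T d M (\<lambda>x. c * h x) b f) x = rep (der_scale T d M c (der_fmult T d M h b) f) x"
    using rep_der_fmult[OF bd Lipb_scale[OF h, of c] f] rep_der_fmult[OF bd h f]
      rep_der_scale[OF derivations_fmult[OF bd h] f, of c]
    by eventually_elim simp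
qed (use b h in \<open>auto intro: D_fmult D_scale Lipb_scale\<close>)

lemma fmult_add_right:
  assumes b: "b \<in> D" and c: "c \<in> D" and h: "h \<in> Lipb T d"
  shows "der_fmult T d M h (der_add T d M b c) = der_add T d M (der_fmult T d M h b) (der_fmult T d M h c)"
proof (rule der_eqI)
  fix f assume f: "f \<in> Lipb T d"
  note bd = D_derivation[OF b] and cd = D_derivation[OF c]
  show "AE x in M. rep (der_fmult T d M h (der_add T d M b c) f) x =
      rep (der_add T d M (der_fmult T d M h b) (der_fmult T d M h c) f) x"
    using rep_der_fmult[OF bd h f] rep_der_fmult[OF cd h f] rep_der_fmult[OF derivations_add[OF bd cd] h f]
      rep_der_add[OF derivations_fmult[OF bd h] derivations_fmult[OF cd h] f] rep_der_add[OF bd cd f]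
    by eventually_elim (simp add: distrib_left)
qed (use b c h in \<open>auto intro: D_fmult D_add\<close>)

lemma fmult_scale_right:
  assumes b: "b \<in> D" and h: "h \<in> Lipb T d"
  shows "der_fmult T d M h (der_scale T d M c b) = der_scale T d M c (der_fmult T d M h b)"
proof (rule der_eqI)
  fix f assume f: "f \<in> Lipb T d"
  note bd = D_derivation[OF b]
  show "AE x in M. rep (der_fmult T d M h (der_scale T d M c b) f) x = rep (der_scale T d M c (der_fmult T d M h b) f) x"
    using rep_der_fmult[OF bd h f] rep_der_fmult[OF derivations_scale[OF bd, of c] h f]
      rep_der_scale[OF derivations_fmult[OF bd h] f, of c] rep_der_scale[OF bd f, of c]
    by eventually_elim simp
qed (use b h in \<open>auto intro: D_fmult D_scale\<close>)

lemma fmult_fmult: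
  assumes b: "b \<in> D" and g: "g \<in> Lipb T d" and h: "h \<in> Lipb T d"
  shows "der_fmult T d M g (der_fmult T d M h b) = der_fmult T d M (\<lambda>x. g x * h x) b"
proof (rule der_eqI)
  fix f assume f: "f \<in> Lipb T d"
  note bd = D_derivation[OF b]
  show "AE x in M. rep (der_fmult T d M g (der_fmult T d M h b) f) x = rep (der_fmult T d M (\<lambda>x. g x * h x) b f) x"
    using rep_der_fmult[OF bd h f] rep_der_fmult[OF bd Lipb_mult[OF g h] f]
      rep_der_fmult[OF derivations_fmult[OF bd h] g f]
    by eventually_elim simp
qed (use b g h in \<open>auto intro: D_fmult Lipb_mult\<close>)

lemma fmult_unit:
  assumes b: "b \<in> D"
  shows "der_fmult T d M unit_fun b = b"
proof (rule der_eqI)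
  fix f assume f: "f \<in> Lipb T d"
  show "AE x in M. rep (der_fmult T d M unit_fun b f) x = rep (b f) x"
    using rep_der_fmult[OF D_derivation[OF b] Lipb_unit f] AE_space
    by eventually_elim (simp add: unit_fun_def space_M)
qed (use b in \<open>auto intro: D_fmult Lipb_unit\<close>)

lemma bounded_measurable_Lpf: "h \<in> bounded_measurable M \<Longrightarrow> h \<in> Lpf M q"
  using q by (elim bounded_measurableE) (rule Lpf_bounded, auto)

end

section \<open>Sobolev functions as functionals\<close>

context normed_nspace
begin

lemma in_closureI:
  assumes "D \<subseteq> nvec V" "x \<in> D"
  shows "x \<in> ntopology V closure_of D"
  unfolding in_closure_iff[OF assms(1)]
proof (intro conjI allI impI)
  show x: "x \<in> nvec V" using assms by auto
  show "\<exists>y\<in>D. nnorm V (diff x y) < e" if "0 < e" for e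
    using that assms(2) norm_diff_self[OF x] by (intro bexI[of _ x]) auto
qed

lemma bounded_functional_zero_closure:
  assumes psi: "bounded_functional \<psi> K" and D: "D \<subseteq> nvec V" "\<And>y. y \<in> D \<Longrightarrow> \<psi> y = 0"
    and x: "x \<in> ntopology V closure_of D"
  shows "\<psi> x = 0"
proof (rule abs_le_if_small[where C = "\<bar>K\<bar>"])
  fix e :: real assume "0 < e"
  have xV: "x \<in> nvec V" using x by (simp add: in_closure_iff[OF D(1)])
  obtain y where y: "y \<in> D" "nnorm V (diff x y) < e"
    using x \<open>0 < e\<close> unfolding in_closure_iff[OF D(1)] by blast
  have yV: "y \<in> nvec V" using y D by auto
  have "\<psi> x = \<psi> (diff x y)" using bounded_functional_diff[OF psi xV yV] D(2)[OF y(1)] by simp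
  also have "\<bar>\<dots>\<bar> \<le> K * nnorm V (diff x y)"
    using psi diff_closed[OF xV yV] by (simp add: bounded_functional_def)
  also have "\<dots> \<le> \<bar>K\<bar> * e" using y(2) norm_nonneg[OF diff_closed[OF xV yV]] by (intro mult_mono) auto
  finally show "\<bar>\<psi> x\<bar> \<le> \<bar>K\<bar> * e" .
qed

end

locale emtm_conjugate = emtm_exponent +
  fixes p :: real
  assumes p: "1 < p" and conj: "1 / p + 1 / q = 1"
begin

abbreviation "W \<equiv> W1p_nspace T d M p q"
abbreviation "TX \<equiv> LLip_nspace T d M q"
abbreviation "P \<equiv> LqLLip_nspace T d M q"
abbreviation "B \<equiv> BXq T d M q"

sublocale Dn: normed_nspace "Der_nspace T d M q" by (rule normed_D)

lemma TX_simps: "nadd TX = der_add T d M" "nscale TX = der_scale T d M" "nnorm TX b = Npf M q (der_len b)"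
  "nvec TX = ntopology (Der_nspace T d M q) closure_of DD"
  by (simp_all add: LLip_nspace_def Der_nspace_def Lp_norm_eq der_len_def)

lemma DD_nsubspace: "Dn.nsubspace DD"
  unfolding Dn.nsubspace_def
  using DD_add(1) DD_scale(1) zero_DD DD_D by (auto simp: Der_nspace_def)

lemma D_carrier: "nvec (Der_nspace T d M q) = D"
  by (simp add: Der_nspace_def)

sublocale TX: normed_nspace TX
  unfolding LLip_nspace_def by (intro Dn.nsubspace_normed Dn.nsubspace_closure DD_nsubspace)

lemma TX_diff: "TX.diff = Dn.diff"
  unfolding fun_eq_iff TX.diff_def Dn.diff_def by (simp add: LLip_nspace_def)

lemma TX_iff: "b \<in> nvec TX \<longleftrightarrow> b \<in> D \<and> (\<forall>e>0. \<exists>c\<in>DD. nnorm TX (TX.diff b c) < e)"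
  unfolding TX_simps(4) TX_diff
  by (subst Dn.in_closure_iff) (auto simp: D_carrier DD_D TX_simps norm_D)

lemma TX_D: "b \<in> nvec TX \<Longrightarrow> b \<in> D"
  by (simp add: TX_iff)

lemma DD_TX: "b \<in> DD \<Longrightarrow> b \<in> nvec TX"
  unfolding TX_simps using DD_nsubspace by (intro Dn.in_closureI) (auto simp: Dn.nsubspace_def)

lemma DD_nsubspace_TX: "TX.nsubspace DD"
  unfolding TX.nsubspace_def TX_simps(1,2)
  using DD_add(1) DD_scale(1) zero_DD DD_TX by auto

lemma DD_dense: "TX.dense DD"
  by (auto simp: TX.dense_def TX_iff)

sublocale Lq: normed_nspace "Lp_nspace M q"
  using q by (intro normed_Lp) simp

sublocale P: normed_nspace P
  unfolding LqLLip_nspace_def using q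
  by (intro normed_prod_nspace Lq.normed_nspace_axioms TX.normed_nspace_axioms) simp

lemma P_simps: "nvec P = Lp M q \<times> nvec TX" "nadd P (g, b) (g', b') = (L0_add M g g', der_add T d M b b')"
  "nscale P c (g, b) = (L0_scale M c g, der_scale T d M c b)"
  "nnorm P (g, b) = (Npf M q (rep g) powr q + Npf M q (der_len b) powr q) powr (1 / q)"
  by (simp_all add: LqLLip_nspace_def prod_nspace_def TX_simps Lp_nspace_def Lp_norm_eq)

definition graph :: "('a aeclass \<times> 'a lderivation) set" where
  "graph = {(g, b). g \<in> Lp M q \<and> b \<in> DD \<and> g = divergence T d M b}"

lemma graphI: "b \<in> DD \<Longrightarrow> (divergence T d M b, b) \<in> graph"
  by (simp add: graph_def DD_props)

lemma graph_nsubspace: "P.nsubspace graph"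
proof -
  have "graph \<noteq> {}" using graphI[OF zero_DD] by blast
  then show ?thesis using DD_TX q
    by (auto simp: P.nsubspace_def graph_def P_simps DD_add DD_scale Lp_add Lp_scale)
qed

lemma B_eq: "B = ntopology P closure_of graph"
  by (simp add: BXq_def graph_def)

lemma B_nsubspace: "P.nsubspace B"
  unfolding B_eq by (rule P.nsubspace_closure[OF graph_nsubspace])

lemma graph_B: "x \<in> graph \<Longrightarrow> x \<in> B"
  unfolding B_eq using graph_nsubspace by (intro P.in_closureI) (auto simp: P.nsubspace_def)

text \<open>The zero of the tangent module; pairs with this second entry embed L^q into the
  product.\<close>

definition zero_der :: "'a lderivation" where "zero_der = (\<lambda>f\<in>Lipb T d. ae_class M (\<lambda>x. 0))"

lemma zero_der_DD: "zero_der \<in> DD"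
  unfolding zero_der_def by (rule zero_DD)

lemma zero_der_TX: "zero_der \<in> nvec TX"
  by (rule DD_TX[OF zero_der_DD])

lemma rep_zero_der: "f \<in> Lipb T d \<Longrightarrow> AE x in M. rep (zero_der f) x = 0"
  using rep_ae_class[of "\<lambda>x. 0" M] by (simp add: zero_der_def)

lemma scale_zero_eq_zero_der:
  assumes b: "b \<in> D"
  shows "der_scale T d M 0 b = zero_der"
proof (rule derivations_eqI)
  fix f assume f: "f \<in> Lipb T d"
  show "AE x in M. rep (der_scale T d M 0 b f) x = rep (zero_der f) x"
    using rep_der_scale[OF D_derivation[OF b] f, of 0] rep_zero_der[OF f] by eventually_elim simp
qed (use D_derivation b derivations_scale DD_D zero_der_DD in auto)

lemma add_zero_der: "b \<in> nvec TX \<Longrightarrow> der_add T d M b zero_der = b"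
  using TX.add_zero[of b b] scale_zero_eq_zero_der[OF TX_D, of b] by (simp add: TX_simps)

lemma scale_zero_der: "der_scale T d M c zero_der = zero_der"
  using TX.scale_scale[OF zero_der_TX, of c 0] scale_zero_eq_zero_der[OF TX_D[OF zero_der_TX]] by (simp add: TX_simps)

lemma norm_zero_der: "Npf M q (der_len zero_der) = 0"
  using TX.norm_zero[OF zero_der_TX] scale_zero_eq_zero_der[OF TX_D[OF zero_der_TX]] by (simp add: TX_simps)

text \<open>Module linearity turns the integrated identity for \<open>h b\<close> into the integral
  of \<open>L b\<close> against \<open>h\<close>. The right side depends on \<open>f\<close> only,
  so these integrals determine \<open>L b\<close>.\<close>

lemma sobolev_operator_test:
  assumes L: "is_sobolev_operator T d M p q f L" and b: "b \<in> DD" and h: "h \<in> Lipb T d"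
  shows "(\<integral>x. h x * rep (L b) x \<partial>M) = - (\<integral>x. rep f x * div_fun (der_fmult T d M h b) x \<partial>M)"
proof -
  have Lb: "L b \<in> Lp M 1" using L b by (auto simp: is_sobolev_operator_def)
  then have L0: "L b \<in> L0 M" by (simp add: Lp_L0)
  have "AE x in M. rep (L (der_fmult T d M h b)) x = h x * rep (L b) x"
    using L b h rep_fmult[OF L0 Lipb_measurable[OF h]] by (simp add: is_sobolev_operator_def)
  then have "(\<integral>x. h x * rep (L b) x \<partial>M) = (\<integral>x. rep (L (der_fmult T d M h b)) x \<partial>M)"
    using L DD_fmult[OF b h] Lipb_measurable[OF h] rep_measurable[OF L0]
    by (intro integral_cong_AE) (auto simp: is_sobolev_operator_def intro!: rep_measurable Lp_L0)
  also have "\<dots> = - (\<integral>x. rep f x * div_fun (der_fmult T d M h b) x \<partial>M)"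
    using L DD_fmult[OF b h] by (simp add: is_sobolev_operator_def div_fun_def)
  finally show ?thesis .
qed

lemma sobolev_operator_unique:
  assumes L: "is_sobolev_operator T d M p q f L" and L': "is_sobolev_operator T d M p q f L'"
  shows "L = L'"
proof
  fix b
  show "L b = L' b"
  proof (cases "b \<in> DD")
    case True
    then have in_L: "L b \<in> Lp M 1" "L' b \<in> Lp M 1" using L L' by (auto simp: is_sobolev_operator_def)
    show ?thesis
    proof (rule L0_eqI)
      show "AE x in M. rep (L b) x = rep (L' b) x"
        using in_L sobolev_operator_test[OF L True] sobolev_operator_test[OF L' True]
        by (intro Lipb_test_integral_eq) (auto simp: Lp_iff Lpf_1)
    qed (use in_L in \<open>auto simp: Lp_L0\<close>)
  next
    case False
    have "L \<in> extensional DD" "L' \<in> extensional DD" using L L' by (simp_all add: is_sobolev_operator_def PiE_def)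
    then show ?thesis using False by (simp add: extensional_def)
  qed
qed

lemma sobolev_operator_eq: "is_sobolev_operator T d M p q f L \<Longrightarrow> sobolev_operator T d M p q f = L"
  unfolding sobolev_operator_def by (rule the_equality[OF _ sobolev_operator_unique])

text \<open>An instance of the weighted bounds, indexed by derivations with weights
  \<open>der_len\<close>: the gradient is an admissible bound and lies below all others.\<close>

lemma sobolev_gradient_props:
  assumes L: "is_sobolev_operator T d M p q f L"
  defines "G \<equiv> rep (sobolev_gradient T d M p q f)"
  shows "G \<in> Lpf M p" "AE x in M. 0 \<le> G x" "b \<in> DD \<Longrightarrow> AE x in M. \<bar>rep (L b) x\<bar> \<le> G x * der_len b x"
    "H \<in> Lpf M p \<Longrightarrow> AE x in M. 0 \<le> H x \<Longrightarrow>
      (\<And>b. b \<in> DD \<Longrightarrow> AE x in M. \<bar>rep (L b) x\<bar> \<le> H x * der_len b x) \<Longrightarrow> AE x in M. G x \<le> H x"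
proof -
  have ne: "sobolev_bounds T d M p q L \<noteq> {}" using L by (simp add: is_sobolev_operator_def)
  have eq: "sobolev_bounds T d M p q L =
      {g \<in> Lp_nonneg M p. \<forall>b\<in>DD. AE x in M. \<bar>rep (L b) x\<bar> \<le> rep g x * der_len b x}"
    by (simp add: sobolev_bounds_def der_len_def)
  note ei = essential_infimum_weighted_bounds[where M = M and p = p and I = DD
      and r = "\<lambda>b x. rep (L b) x" and w = der_len and \<B> = "sobolev_bounds T d M p q L",
      OF finite_measure_axioms _ _ eq ne]
  have G: "G = rep (essential_infimum M (sobolev_bounds T d M p q L))"
    by (simp add: G_def sobolev_gradient_def sobolev_operator_eq[OF L])
  have "essential_infimum M (sobolev_bounds T d M p q L) \<in> sobolev_bounds T d M p q L"
    using p der_len_props(2)[OF DD_D] by (intro ei) auto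
  then show "G \<in> Lpf M p" "AE x in M. 0 \<le> G x" "b \<in> DD \<Longrightarrow> AE x in M. \<bar>rep (L b) x\<bar> \<le> G x * der_len b x"
    by (auto simp: eq G Lp_nonneg_def Lp_iff)
  show "AE x in M. G x \<le> H x" if "H \<in> Lpf M p" "AE x in M. 0 \<le> H x"
      "\<And>b. b \<in> DD \<Longrightarrow> AE x in M. \<bar>rep (L b) x\<bar> \<le> H x * der_len b x"
    unfolding G using p der_len_props(2)[OF DD_D] that by (intro ei) auto
qed

section \<open>The correspondence with functionals on the quotient\<close>

lemma W_iff: "f \<in> nvec W \<longleftrightarrow> f \<in> Lp M p \<and> (\<exists>L. is_sobolev_operator T d M p q f L)"
  by (simp add: W1p_nspace_def)

lemma norm_W: "nnorm W f = (Npf M p (rep f) powr p + Npf M p (rep (sobolev_gradient T d M p q f)) powr p) powr (1 / p)"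
  by (simp add: W1p_nspace_def Lp_norm_eq)

abbreviation "Q' \<equiv> dual_nspace (quotient_nspace P B)"

text \<open>A relation rather than a map: uniqueness on both sides later yields linearity,
  injectivity and equality of norms. It tests on pairs \<open>(g, zero_der)\<close> alone; vanishing
  on the graph fixes the derivation part.\<close>

definition represents :: "'a aeclass \<Rightarrow> (('a aeclass \<times> 'a lderivation) set \<Rightarrow> real) \<Rightarrow> bool" where
  "represents f \<phi> \<longleftrightarrow> f \<in> nvec W \<and> \<phi> \<in> nvec Q' \<and>
    (\<forall>g\<in>Lp M q. \<phi> (P.coset B (g, zero_der)) = (\<integral>x. rep f x * rep g x \<partial>M))"

lemma integral_mult_le:
  assumes "f \<in> Lpf M p" "g \<in> Lpf M q"
  shows "\<bar>\<integral>x. f x * g x \<partial>M\<bar> \<le> Npf M p f * Npf M q g"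
  using Holder[OF p q conj assms] integral_abs_bound[of M "\<lambda>x. f x * g x"] by linarith

text \<open>The derivation part integrates \<open>L b\<close>; it is bounded by the norm of the
  gradient and extends from \<open>DD\<close> by density. The function part integrates against
  \<open>f\<close>. Their sum vanishes on the graph by the integration by parts formula for
  \<open>L\<close>.\<close>

lemma functional_of_sobolev:
  assumes f: "f \<in> nvec W"
  shows "\<exists>\<phi>. represents f \<phi> \<and> nnorm Q' \<phi> \<le> nnorm W f"
proof -
  obtain L where L: "is_sobolev_operator T d M p q f L" and fp: "f \<in> Lp M p" using f by (auto simp: W_iff)
  have fL: "rep f \<in> Lpf M p" using fp by (simp add: Lp_iff)
  define G where "G = rep (sobolev_gradient T d M p q f)"
  note G = sobolev_gradient_props[OF L, folded G_def]
  define l where "l b = (\<integral>x. rep (L b) x \<partial>M)" for b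
  have LL: "L b \<in> Lp M 1" if "b \<in> DD" for b using L that by (auto simp: is_sobolev_operator_def)
  have Li: "integrable M (rep (L b))" if "b \<in> DD" for b using LL[OF that] by (simp add: Lp_iff Lpf_1)
  have L0: "L b \<in> L0 M" if "b \<in> DD" for b using LL[OF that] by (simp add: Lp_L0)
  have l_bd: "\<bar>l b\<bar> \<le> Npf M p G * nnorm TX b" if b: "b \<in> DD" for b
  proof -
    note h = Holder[OF p q conj G(1) der_len_props(1)[OF DD_D[OF b]]]
    have "\<bar>l b\<bar> \<le> (\<integral>x. \<bar>rep (L b) x\<bar> \<partial>M)" unfolding l_def by (rule integral_abs_bound)
    also have "\<dots> \<le> (\<integral>x. \<bar>G x * der_len b x\<bar> \<partial>M)"
      using G(3)[OF b] h Li[OF b] by (intro integral_mono_AE) (auto elim!: eventually_mono)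
    also have "\<dots> \<le> Npf M p G * nnorm TX b" using h by (simp add: TX_simps)
    finally show ?thesis .
  qed
  have l_add: "l (nadd TX b c) = l b + l c" if "b \<in> DD" "c \<in> DD" for b c
  proof -
    have "l (nadd TX b c) = (\<integral>x. rep (L b) x + rep (L c) x \<partial>M)"
      using that L rep_add[OF L0[OF that(1)] L0[OF that(2)]] Li rep_measurable[OF L0_add_in[OF L0[OF that(1)] L0[OF that(2)]]]
      unfolding l_def TX_simps
      by (intro integral_cong_AE) (auto simp: is_sobolev_operator_def)
    then show ?thesis using Li that by (simp add: l_def)
  qed
  have l_scale: "l (nscale TX c b) = c * l b" if "b \<in> DD" for b c
  proof -
    have "l (nscale TX c b) = (\<integral>x. c * rep (L b) x \<partial>M)"
      using that L rep_scale[OF L0[OF that]] Li rep_measurable[OF L0_scale_in[OF L0[OF that(1)]]]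
      unfolding l_def TX_simps
      by (intro integral_cong_AE) (auto simp: is_sobolev_operator_def)
    then show ?thesis by (simp add: l_def)
  qed
  obtain \<Lambda> where \<Lambda>: "\<And>x y. x \<in> nvec TX \<Longrightarrow> y \<in> nvec TX \<Longrightarrow> \<Lambda> (nadd TX x y) = \<Lambda> x + \<Lambda> y"
    "\<And>c x. x \<in> nvec TX \<Longrightarrow> \<Lambda> (nscale TX c x) = c * \<Lambda> x"
    "\<And>x. x \<in> nvec TX \<Longrightarrow> \<bar>\<Lambda> x\<bar> \<le> Npf M p G * nnorm TX x" "\<And>x. x \<in> DD \<Longrightarrow> \<Lambda> x = l x"
    using TX.extend_functional[OF DD_nsubspace_TX DD_dense Npf_nonneg l_add l_scale l_bd] by blast
  define \<psi> where "\<psi> v = (\<integral>x. rep f x * rep (fst v) x \<partial>M) + \<Lambda> (snd v)" for v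
  have fg: "integrable M (\<lambda>x. rep f x * rep g x)" if "g \<in> Lp M q" for g
    using that by (intro Holder[OF p q conj fL]) (simp add: Lp_iff)
  have psi: "P.bounded_functional \<psi> (nnorm W f)"
    unfolding P.bounded_functional_def
  proof (intro conjI ballI allI)
    fix x y assume "x \<in> nvec P" "y \<in> nvec P"
    then obtain g b g' b' where eq: "x = (g, b)" "y = (g', b')" and
      in_P: "g \<in> Lp M q" "b \<in> nvec TX" "g' \<in> Lp M q" "b' \<in> nvec TX" by (auto simp: P_simps)
    have gg: "L0_add M g g' \<in> Lp M q" using in_P q by (intro Lp_add) auto
    have "(\<integral>x. rep f x * rep (L0_add M g g') x \<partial>M) = (\<integral>x. rep f x * rep g x + rep f x * rep g' x \<partial>M)"
      using rep_add[OF Lp_L0[OF in_P(1)] Lp_L0[OF in_P(3)]] fg[OF gg] fg[OF in_P(1)] fg[OF in_P(3)]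
      by (intro integral_cong_AE) (auto simp: distrib_left elim!: eventually_mono)
    then show "\<psi> (nadd P x y) = \<psi> x + \<psi> y"
      using \<Lambda>(1)[OF in_P(2,4)] fg in_P by (simp add: eq P_simps \<psi>_def TX_simps)
  next
    fix c x assume "x \<in> nvec P"
    then obtain g b where eq: "x = (g, b)" and in_P: "g \<in> Lp M q" "b \<in> nvec TX" by (auto simp: P_simps)
    have gg: "L0_scale M c g \<in> Lp M q" using in_P q by (intro Lp_scale) auto
    have "(\<integral>x. rep f x * rep (L0_scale M c g) x \<partial>M) = (\<integral>x. c * (rep f x * rep g x) \<partial>M)"
      using rep_scale[OF Lp_L0[OF in_P(1)], of c] fg[OF gg] fg[OF in_P(1)]
      by (intro integral_cong_AE) (auto elim!: eventually_mono)
    then show "\<psi> (nscale P c x) = c * \<psi> x"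
      using \<Lambda>(2)[OF in_P(2)] by (simp add: eq P_simps \<psi>_def TX_simps distrib_left)
  next
    fix x assume "x \<in> nvec P"
    then obtain g b where eq: "x = (g, b)" and in_P: "g \<in> Lp M q" "b \<in> nvec TX" by (auto simp: P_simps)
    have "\<bar>\<psi> x\<bar> \<le> Npf M p (rep f) * Npf M q (rep g) + Npf M p G * Npf M q (der_len b)"
      using integral_mult_le[OF fL, of "rep g"] \<Lambda>(3)[OF in_P(2)] in_P(1)
      by (auto simp: eq \<psi>_def TX_simps Lp_iff)
    \<comment> \<open>Hoelder for the pair of function norm and gradient norm against the pair of
      norms of \<open>g\<close> and \<open>b\<close>; the constant is exactly the Sobolev
      norm.\<close>
    also have "\<dots> \<le> nnorm W f * nnorm P x"
      unfolding eq P_simps norm_W G_def[symmetric] by (intro Holder_pair p q conj Npf_nonneg)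
    finally show "\<bar>\<psi> x\<bar> \<le> nnorm W f * nnorm P x" .
  qed
  have psi_graph: "\<psi> x = 0" if "x \<in> graph" for x
    using that \<Lambda>(4) L by (auto simp: graph_def \<psi>_def l_def is_sobolev_operator_def)
  have graph_P: "graph \<subseteq> nvec P" using graph_nsubspace by (simp add: P.nsubspace_def)
  have "\<psi> x = 0" if "x \<in> B" for x
    using psi graph_P psi_graph that[unfolded B_eq] by (rule P.bounded_functional_zero_closure)
  moreover have "0 \<le> nnorm W f" by (simp add: norm_W)
  ultimately have "\<exists>\<phi>\<in>nvec Q'. nnorm Q' \<phi> \<le> nnorm W f \<and> (\<forall>v\<in>nvec P. \<phi> (P.coset B v) = \<psi> v)"
    using P.dual_quotientI[OF B_nsubspace psi] by blast
  then obtain \<phi> where phi: "\<phi> \<in> nvec Q'" "nnorm Q' \<phi> \<le> nnorm W f" "\<And>v. v \<in> nvec P \<Longrightarrow> \<phi> (P.coset B v) = \<psi> v"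
    by blast
  have "\<Lambda> zero_der = 0" using \<Lambda>(3)[OF zero_der_TX] by (simp add: TX_simps norm_zero_der)
  then have "represents f \<phi>"
    using phi f zero_der_TX by (auto simp: represents_def P_simps \<psi>_def)
  then show ?thesis using phi by blast
qed

text \<open>Testing with classes of Lipschitz functions determines \<open>f\<close>. The second
  function enters through its integrals alone, which is how sums and multiples are recognised as
  Sobolev functions.\<close>

lemma represents_left_unique:
  assumes "represents f \<phi>" "f' \<in> Lp M p" "\<And>g. g \<in> Lp M q \<Longrightarrow> \<phi> (P.coset B (g, zero_der)) = (\<integral>x. rep f' x * rep g x \<partial>M)"
  shows "f = f'"
proof -
  have f: "f \<in> Lp M p" using assms by (simp add: represents_def W_iff)
  have int: "integrable M (rep f)" "integrable M (rep f')"
    using f assms(2) p by (auto simp: Lp_iff intro: Lpf_imp_integrable)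
  have "AE x in M. rep f x = rep f' x"
  proof (rule Lipb_test_integral_eq[OF int])
    fix h assume h: "h \<in> Lipb T d"
    note hm = Lipb_measurable[OF h]
    obtain H where "\<And>x. \<bar>h x\<bar> \<le> H" using Lipb_bound[OF h] by blast
    then have "h \<in> Lpf M q" using q by (intro Lpf_bounded hm) auto
    then have g: "ae_class M h \<in> Lp M q" using q by (intro ae_class_in_Lp) auto
    have eq: "(\<integral>x. rep u x * rep (ae_class M h) x \<partial>M) = (\<integral>x. h x * rep u x \<partial>M)" if "u \<in> Lp M p" for u
      using rep_ae_class[OF hm] rep_measurable[OF ae_class_in_L0[OF hm]] hm rep_measurable[OF Lp_L0[OF that]]
      by (intro integral_cong_AE) (auto simp: mult.commute elim!: eventually_mono)
    show "(\<integral>x. h x * rep f x \<partial>M) = (\<integral>x. h x * rep f' x \<partial>M)"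
      using assms(1,3) g eq[OF f] eq[OF assms(2)] by (auto simp: represents_def)
  qed
  then show ?thesis using f assms(2) by (intro L0_eqI) (auto simp: Lp_L0)
qed

text \<open>The pulled back difference vanishes on the pairs \<open>(g, zero_der)\<close> and on the
  graph. Together these span all pairs with derivation part in \<open>DD\<close>, and such pairs are
  dense in the product.\<close>

lemma represents_right_unique:
  assumes "represents f \<phi>" "represents f \<phi>'"
  shows "\<phi> = \<phi>'"
proof (rule P.dual_quotient_eqI[OF B_nsubspace])
  show phi: "\<phi> \<in> nvec Q'" "\<phi>' \<in> nvec Q'" using assms by (auto simp: represents_def)
  define \<psi> where "\<psi> v = \<phi> (P.coset B v) + - 1 * \<phi>' (P.coset B v)" for v
  note F = P.dual_quotientD[OF B_nsubspace phi(1)] P.dual_quotientD[OF B_nsubspace phi(2)]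
  define K where "K = nnorm Q' \<phi> + nnorm Q' \<phi>'"
  have psi: "P.bounded_functional \<psi> K"
    unfolding P.bounded_functional_def
  proof (intro conjI ballI allI)
    show "\<psi> (nadd P x y) = \<psi> x + \<psi> y" if "x \<in> nvec P" "y \<in> nvec P" for x y
      using that F(1,3) by (simp add: \<psi>_def P.bounded_functional_def)
    show "\<psi> (nscale P c x) = c * \<psi> x" if "x \<in> nvec P" for c x
      using that F(1,3) by (simp add: \<psi>_def P.bounded_functional_def right_diff_distrib)
    show "\<bar>\<psi> x\<bar> \<le> K * nnorm P x" if "x \<in> nvec P" for x
    proof -
      have "\<bar>\<phi> (P.coset B x)\<bar> \<le> nnorm Q' \<phi> * nnorm P x" "\<bar>\<phi>' (P.coset B x)\<bar> \<le> nnorm Q' \<phi>' * nnorm P x"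
        using that F(1,3) by (auto simp: P.bounded_functional_def)
      then show ?thesis by (simp add: \<psi>_def K_def distrib_right)
    qed
  qed
  have zero: "\<psi> (g, zero_der) = 0" if "g \<in> Lp M q" for g
    using assms that by (simp add: \<psi>_def represents_def)
  have zeroB: "\<psi> v = 0" if "v \<in> B" for v
    using F(2)[OF that] F(4)[OF that] by (simp add: \<psi>_def)
  have zeroD: "\<psi> (g, b) = 0" if g: "g \<in> Lp M q" and b: "b \<in> DD" for g b
  proof -
    \<comment> \<open>\<open>c\<close> is \<open>g - div(b)\<close>, so \<open>(g, b)\<close> is
      \<open>(c, zero_der)\<close> plus a point of the graph.\<close>
    define c where "c = L0_add M g (L0_scale M (- 1) (divergence T d M b))"
    note dL = DD_props(1)[OF b]
    have c: "c \<in> Lp M q" unfolding c_def using g dL q by (intro Lp_add Lp_scale) auto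
    have "L0_add M c (divergence T d M b) = g"
      using Lq.diff_add[of g "divergence T d M b"] g dL
      by (simp add: c_def Lq.diff_def) (simp add: Lp_nspace_def)
    moreover have "der_add T d M zero_der b = b"
      using add_zero_der[OF DD_TX[OF b]] TX.add_commute[OF zero_der_TX DD_TX[OF b]] by (simp add: TX_simps)
    ultimately have "(g, b) = nadd P (c, zero_der) (divergence T d M b, b)" by (simp add: P_simps)
    moreover have "(c, zero_der) \<in> nvec P" "(divergence T d M b, b) \<in> nvec P"
      using c dL zero_der_TX DD_TX[OF b] by (simp_all add: P_simps)
    ultimately have "\<psi> (g, b) = \<psi> (c, zero_der) + \<psi> (divergence T d M b, b)"
      using psi unfolding P.bounded_functional_def by metis
    then show ?thesis using zero[OF c] zeroB[OF graph_B[OF graphI[OF b]]] by simp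
  qed
  show "\<phi> (P.coset B v) = \<phi>' (P.coset B v)" if v: "v \<in> nvec P" for v
  proof -
    obtain g b where eq: "v = (g, b)" and gb: "g \<in> Lp M q" "b \<in> nvec TX" using v by (auto simp: P_simps)
    have sub: "Lp M q \<times> DD \<subseteq> nvec P" using DD_TX by (auto simp: P_simps)
    have cl: "v \<in> ntopology P closure_of (Lp M q \<times> DD)"
      unfolding P.in_closure_iff[OF sub]
    proof (intro conjI allI impI v)
      fix e :: real assume "0 < e"
      then obtain c where c: "c \<in> DD" "nnorm TX (TX.diff b c) < e" using gb by (auto simp: TX_iff)
      \<comment> \<open>Only the second entry is approximated, so the product norm of the error is
        the norm of its derivation part.\<close>
      have "P.diff v (g, c) = (Lq.diff g g, TX.diff b c)"
        unfolding P.diff_def Lq.diff_def TX.diff_def eq P_simps TX_simps by (simp add: Lp_nspace_def)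
      moreover have "Npf M q (rep (Lq.diff g g)) = 0"
        using Lq.norm_diff_self[of g] gb by (simp add: Lp_nspace_def Lp_norm_eq)
      moreover have "0 \<le> Npf M q (der_len (TX.diff b c))" by (rule Npf_nonneg)
      ultimately have "nnorm P (P.diff v (g, c)) = nnorm TX (TX.diff b c)"
        using q by (simp add: P_simps TX_simps powr_powr)
      then have lt: "nnorm P (P.diff v (g, c)) < e" using c(2) by (simp only:)
      have "(g, c) \<in> Lp M q \<times> DD" using c(1) gb(1) by simp
      then show "\<exists>y\<in>Lp M q \<times> DD. nnorm P (P.diff v y) < e"
        using lt by (rule bexI[where x = "(g, c)", rotated])
    qed
    have "\<psi> y = 0" if "y \<in> Lp M q \<times> DD" for y
      using that by (cases y) (simp only: mem_Times_iff fst_conv snd_conv zeroD)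
    with psi sub have "\<psi> v = 0" using cl by (rule P.bounded_functional_zero_closure)
    then show ?thesis by (simp add: \<psi>_def)
  qed
qed

end

section \<open>Functionals as Sobolev functions\<close>

text \<open>A test with conjugate powers bounds a quantity \<open>x\<close> by \<open>K\<close>
  times its own power \<open>1 / q\<close>; cancelling that power leaves
  \<open>x powr (1 / p) \<le> K\<close>.\<close>

lemma le_powr_of_le_mult:
  fixes x K p q :: real
  assumes "1 < p" "1 < q" "1 / p + 1 / q = 1" "0 \<le> x" "0 \<le> K" "x \<le> K * x powr (1 / q)"
  shows "x \<le> K powr p"
proof (cases "x = 0")
  case False
  then have x: "0 < x" using assms by simp
  have "x = x powr (1 / p) * x powr (1 / q)" using x assms(3) by (simp add: powr_add[symmetric])
  then have "x powr (1 / p) * x powr (1 / q) \<le> K * x powr (1 / q)" using assms(6) by simp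
  then have "x powr (1 / p) \<le> K" using x by simp
  then show ?thesis using assms powr_inverse_le_iff[of p x K] by simp
qed simp

text \<open>Integrability of the limit is part of the conclusion; a bound on cut-off integrals that
  is uniform in the level thus becomes membership in L^p.\<close>

lemma integrable_of_bounded_mono:
  fixes u :: "nat \<Rightarrow> 'a \<Rightarrow> real"
  assumes u: "\<And>n. integrable M (u n)" "AE x in M. mono (\<lambda>n. u n x)" "\<And>n. AE x in M. 0 \<le> u n x"
    and v: "AE x in M. (\<lambda>n. u n x) \<longlonglongrightarrow> v x" "v \<in> borel_measurable M"
    and le: "\<And>n. (\<integral>x. u n x \<partial>M) \<le> C"
  shows "integrable M v" "(\<integral>x. v x \<partial>M) \<le> C"
proof -
  have "incseq (\<lambda>n. \<integral>x. u n x \<partial>M)"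
  proof (rule monoI)
    fix m n :: nat assume "m \<le> n"
    then show "(\<integral>x. u m x \<partial>M) \<le> (\<integral>x. u n x \<partial>M)"
      using u(2) by (intro integral_mono_AE u(1)) (auto elim!: eventually_mono dest: monoD)
  qed
  then obtain L where L: "(\<lambda>n. \<integral>x. u n x \<partial>M) \<longlonglongrightarrow> L" using incseq_convergent le by metis
  show "integrable M v"
    by (rule integral_monotone_convergence_nonneg(1)[OF u(1) u(2) u(3) v(1) L v(2)])
  have "(\<integral>x. v x \<partial>M) = L"
    by (rule integral_monotone_convergence_nonneg(2)[OF u(1) u(2) u(3) v(1) L v(2)])
  moreover have "L \<le> C" using L le by (intro LIMSEQ_le_const2[OF L]) auto
  ultimately show "(\<integral>x. v x \<partial>M) \<le> C" by simp
qed

text \<open>\<open>F\<close> is controlled on Lipschitz multipliers only. In the seminorm given by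
  the norm of \<open>h w\<close> these are dense among bounded measurable functions, so
  \<open>F\<close> extends with the same constant and the extension has a density. The last clause
  keeps the bound for discontinuous multipliers such as signs on a set.\<close>

lemma (in emtm) Riesz_Lipb:
  fixes F :: "('a \<Rightarrow> real) \<Rightarrow> real"
  assumes w: "w \<in> Lpf M q" and q: "1 \<le> q" and C: "0 \<le> C"
    and add: "\<And>g h. g \<in> Lipb T d \<Longrightarrow> h \<in> Lipb T d \<Longrightarrow> F (\<lambda>x. g x + h x) = F g + F h"
    and scale: "\<And>c h. h \<in> Lipb T d \<Longrightarrow> F (\<lambda>x. c * h x) = c * F h"
    and bd: "\<And>h. h \<in> Lipb T d \<Longrightarrow> \<bar>F h\<bar> \<le> C * Npf M q (\<lambda>x. h x * w x)"
  shows "\<exists>l. integrable M l \<and> (\<forall>h\<in>Lipb T d. F h = (\<integral>x. h x * l x \<partial>M)) \<and>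
    (\<forall>h\<in>bounded_measurable M. \<bar>\<integral>x. h x * l x \<partial>M\<bar> \<le> C * Npf M q (\<lambda>x. h x * w x))"
proof -
  \<comment> \<open>Only a seminorm, since \<open>w\<close> may vanish on a set of positive
    measure.\<close>
  define V where "V = \<lparr>nvec = bounded_measurable M, nadd = \<lambda>g h x. g x + h x, nscale = \<lambda>c h x. c * h x,
    nnorm = \<lambda>h. Npf M q (\<lambda>x. h x * w x)\<rparr>"
  have Vs: "nvec V = bounded_measurable M" "nadd V = (\<lambda>g h x. g x + h x)" "nscale V = (\<lambda>c h x. c * h x)"
    "nnorm V = (\<lambda>h. Npf M q (\<lambda>x. h x * w x))" by (simp_all add: V_def)
  have hw: "(\<lambda>x. h x * w x) \<in> Lpf M q" if "h \<in> bounded_measurable M" for h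
    using that w q by (intro bounded_mult_Lpf) auto
  interpret V: seminormed_nspace V
  proof (unfold_locales, unfold Vs, goal_cases)
    case 1
    show ?case using bounded_measurable_const by blast
  next
    case (11 x)
    show ?case by (rule Npf_nonneg)
  next
    case (12 x y)
    then show ?case using Lpf_add(2)[OF hw[OF 12(1)] hw[OF 12(2)] q] by (simp add: distrib_right)
  next
    case (13 c x)
    then show ?case using Lpf_scale(2)[OF hw[OF 13], of c] q by (simp add: mult.assoc)
  qed (auto simp: bounded_measurable_add bounded_measurable_scale algebra_simps)
  have D: "V.nsubspace (Lipb T d)"
    unfolding V.nsubspace_def Vs
    using Lipb_bounded_measurable Lipb_add Lipb_scale Lipb_unit by blast
  have dense: "V.dense (Lipb T d)"
    unfolding V.dense_def Vs V.diff_def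
  proof (intro ballI allI impI)
    fix h :: "'a \<Rightarrow> real" and e :: real assume h: "h \<in> bounded_measurable M" and e: "0 < e"
    obtain s where s: "\<And>n. s n \<in> Lipb T d"
      "\<And>p u. 0 < p \<Longrightarrow> u \<in> Lpf M p \<Longrightarrow> (\<lambda>n. Npf M p (\<lambda>x. (s n x - h x) * u x)) \<longlonglongrightarrow> 0"
      using Lipb_approx_mult[OF h] by blast
    have "(\<lambda>n. Npf M q (\<lambda>x. (s n x - h x) * w x)) \<longlonglongrightarrow> 0" using s(2)[of q w] w q by simp
    then obtain n where n: "Npf M q (\<lambda>x. (s n x - h x) * w x) < e"
      using order_tendstoD(2)[OF _ e] by (metis (no_types, lifting) eventually_sequentially order_refl)
    have "Npf M q (\<lambda>x. (h x + - 1 * s n x) * w x) = Npf M q (\<lambda>x. - 1 * ((s n x - h x) * w x))"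
      by (simp add: algebra_simps)
    also have "\<dots> = Npf M q (\<lambda>x. (s n x - h x) * w x)" by (simp add: Npf_def)
    finally have "Npf M q (\<lambda>x. (h x + - 1 * s n x) * w x) < e" using n by simp
    then show "\<exists>y\<in>Lipb T d. Npf M q (\<lambda>x. (h x + - 1 * y x) * w x) < e" using s(1) by (rule bexI)
  qed
  obtain E where E: "\<And>g h. g \<in> bounded_measurable M \<Longrightarrow> h \<in> bounded_measurable M \<Longrightarrow> E (\<lambda>x. g x + h x) = E g + E h"
    "\<And>c h. h \<in> bounded_measurable M \<Longrightarrow> E (\<lambda>x. c * h x) = c * E h"
    "\<And>h. h \<in> bounded_measurable M \<Longrightarrow> \<bar>E h\<bar> \<le> C * Npf M q (\<lambda>x. h x * w x)" "\<And>h. h \<in> Lipb T d \<Longrightarrow> E h = F h"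
    using V.extend_functional[OF D dense C, of F, unfolded Vs, OF add scale bd] by blast
  obtain l where l: "integrable M l" "\<And>h. h \<in> bounded_measurable M \<Longrightarrow> E h = (\<integral>x. h x * l x \<partial>M)"
    using Riesz_bounded_measurable[OF finite_measure_axioms w q, of E C, OF E(1-3)] by blast
  show ?thesis
    using l E(3,4) Lipb_bounded_measurable by (intro exI[of _ l]) (auto simp: l(2)[symmetric])
qed

section \<open>Densities of a functional that vanishes on the graph\<close>

locale emtm_functional = emtm_conjugate +
  fixes \<psi> :: "'a aeclass \<times> 'a lderivation \<Rightarrow> real" and K :: real
  assumes psi: "P.bounded_functional \<psi> K" and K: "0 \<le> K" and graph0: "\<And>v. v \<in> graph \<Longrightarrow> \<psi> v = 0"
begin

lemma psi_add: "g \<in> Lp M q \<Longrightarrow> g' \<in> Lp M q \<Longrightarrow> b \<in> nvec TX \<Longrightarrow> b' \<in> nvec TX \<Longrightarrow>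
    \<psi> (L0_add M g g', der_add T d M b b') = \<psi> (g, b) + \<psi> (g', b')"
  using psi by (auto simp: P.bounded_functional_def P_simps)

lemma psi_scale: "g \<in> Lp M q \<Longrightarrow> b \<in> nvec TX \<Longrightarrow> \<psi> (L0_scale M c g, der_scale T d M c b) = c * \<psi> (g, b)"
  using psi by (auto simp: P.bounded_functional_def P_simps)

lemma psi_bound: "g \<in> Lp M q \<Longrightarrow> b \<in> nvec TX \<Longrightarrow>
    \<bar>\<psi> (g, b)\<bar> \<le> K * (Npf M q (rep g) powr q + Npf M q (der_len b) powr q) powr (1 / q)"
  using psi by (auto simp: P.bounded_functional_def P_simps)

definition zero_class :: "'a aeclass" where "zero_class = ae_class M (\<lambda>x. 0)"

lemma zero_class: "zero_class \<in> Lp M q" "Npf M q (rep zero_class) = 0" "L0_add M g zero_class = ae_class M (rep g)" "L0_scale M c zero_class = zero_class"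
proof -
  have 0: "(\<lambda>x. 0) \<in> Lpf M q" by (simp add: Lpf_def)
  show 1: "zero_class \<in> Lp M q" "Npf M q (rep zero_class) = 0"
    using ae_class_in_Lp[OF 0] q by (auto simp: zero_class_def Lp_norm_eq Npf_def)
  have r: "AE x in M. rep zero_class x = 0" unfolding zero_class_def by (rule rep_ae_class) simp
  show "L0_scale M c zero_class = zero_class"
    using rep_scale[OF Lp_L0[OF 1(1)], of c] r by (intro L0_eqI[where M = M] L0_scale_in Lp_L0[OF 1(1)]) auto
  have "(AE x in M. h x = rep g x + rep zero_class x) \<longleftrightarrow> (AE x in M. h x = rep g x)" for h :: "'a \<Rightarrow> real"
  proof
    show "AE x in M. h x = rep g x" if "AE x in M. h x = rep g x + rep zero_class x" using that r by eventually_elim simp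
    show "AE x in M. h x = rep g x + rep zero_class x" if "AE x in M. h x = rep g x" using that r by eventually_elim simp
  qed
  then show "L0_add M g zero_class = ae_class M (rep g)" by (simp add: L0_add_def ae_class_def)
qed

lemma psi_split:
  assumes "g \<in> Lp M q" "b \<in> nvec TX"
  shows "\<psi> (g, b) = \<psi> (g, zero_der) + \<psi> (zero_class, b)"
  using psi_add[OF assms(1) zero_class(1) zero_der_TX assms(2)] add_zero_der[OF assms(2)] TX.add_commute[OF zero_der_TX assms(2)] assms(1)
  by (simp add: zero_class(3) ae_class_rep Lp_L0 TX_simps)

text \<open>The function part of \<open>\<psi>\<close>, taken on functions so that the Riesz lemma
  applies; \<open>vpart\<close> below is the derivation part.\<close>

definition gpart :: "('a \<Rightarrow> real) \<Rightarrow> real" where "gpart h = \<psi> (ae_class M h, zero_der)"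

lemma gpart:
  assumes "g \<in> Lpf M q"
  shows "h \<in> Lpf M q \<Longrightarrow> gpart (\<lambda>x. g x + h x) = gpart g + gpart h"
    and "gpart (\<lambda>x. c * g x) = c * gpart g" and "\<bar>gpart g\<bar> \<le> K * Npf M q g"
proof -
  note gm = Lpf_measurable[OF assms]
  have gL: "ae_class M g \<in> Lp M q" "Npf M q (rep (ae_class M g)) = Npf M q g"
    using ae_class_in_Lp[OF assms] q by (auto simp: Lp_norm_eq)
  show "gpart (\<lambda>x. g x + h x) = gpart g + gpart h" if h: "h \<in> Lpf M q"
  proof -
    note hm = Lpf_measurable[OF h]
    have hL: "ae_class M h \<in> Lp M q" using ae_class_in_Lp[OF h] q by auto
    have "ae_class M (\<lambda>x. g x + h x) = L0_add M (ae_class M g) (ae_class M h)"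
      unfolding L0_add_def using rep_ae_class[OF gm] rep_ae_class[OF hm] gm hm
        rep_measurable[OF Lp_L0[OF gL(1)]] rep_measurable[OF Lp_L0[OF hL]]
      by (subst ae_class_eq_iff) auto
    then show ?thesis using psi_add[OF gL(1) hL zero_der_TX zero_der_TX] add_zero_der[OF zero_der_TX] by (simp add: gpart_def)
  qed
  have "AE x in M. c * g x = c * rep (ae_class M g) x"
    using rep_ae_class[OF gm] by eventually_elim simp
  then have "ae_class M (\<lambda>x. c * g x) = L0_scale M c (ae_class M g)"
    unfolding L0_scale_def using gm rep_measurable[OF Lp_L0[OF gL(1)]] by (subst ae_class_eq_iff) auto
  then show "gpart (\<lambda>x. c * g x) = c * gpart g" using psi_scale[OF gL(1) zero_der_TX, of c] by (simp add: gpart_def scale_zero_der)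
  show "\<bar>gpart g\<bar> \<le> K * Npf M q g"
    using psi_bound[OF gL(1) zero_der_TX] q by (simp add: gpart_def norm_zero_der gL powr_powr Npf_nonneg)
qed

lemma ex_density_gpart: "\<exists>f. integrable M f \<and> (\<forall>h\<in>bounded_measurable M. gpart h = (\<integral>x. h x * f x \<partial>M))"
proof (rule Riesz_bounded_measurable[OF finite_measure_axioms])
  show "(\<lambda>x. 1) \<in> Lpf M q" by (simp add: Lpf_def)
  show "\<bar>gpart h\<bar> \<le> K * Npf M q (\<lambda>x. h x * 1)" if "h \<in> bounded_measurable M" for h
    using gpart(3)[OF bounded_measurable_Lpf[OF that]] by simp
qed (use q gpart bounded_measurable_Lpf in auto)

text \<open>The candidate Sobolev function. At this stage it is integrable; membership in L^p is
  obtained together with the gradient bound.\<close>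

definition fun_density :: "'a \<Rightarrow> real" where
  "fun_density = (SOME f. integrable M f \<and> (\<forall>h\<in>bounded_measurable M. gpart h = (\<integral>x. h x * f x \<partial>M)))"

lemma fun_density: "integrable M fun_density" "h \<in> bounded_measurable M \<Longrightarrow> gpart h = (\<integral>x. h x * fun_density x \<partial>M)"
proof -
  note * = someI_ex[OF ex_density_gpart, folded fun_density_def]
  show "integrable M fun_density" using * by (rule conjunct1)
  show "gpart h = (\<integral>x. h x * fun_density x \<partial>M)" if "h \<in> bounded_measurable M"
    using *[THEN conjunct2] that by (rule bspec)
qed

definition vpart :: "'a lderivation \<Rightarrow> real" where "vpart b = \<psi> (zero_class, b)"

lemma vpart:
  assumes "b \<in> nvec TX"
  shows "c \<in> nvec TX \<Longrightarrow> vpart (der_add T d M b c) = vpart b + vpart c"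
    and "vpart (der_scale T d M a b) = a * vpart b" and "\<bar>vpart b\<bar> \<le> K * Npf M q (der_len b)"
proof -
  have zz: "L0_add M zero_class zero_class = zero_class" using zero_class(3)[of zero_class] zero_class(1) by (simp add: ae_class_rep Lp_L0)
  show "vpart (der_add T d M b c) = vpart b + vpart c" if "c \<in> nvec TX"
    using psi_add[OF zero_class(1) zero_class(1) assms that] by (simp add: vpart_def zz)
  show "vpart (der_scale T d M a b) = a * vpart b"
    using psi_scale[OF zero_class(1) assms, of a] by (simp add: vpart_def zero_class)
  show "\<bar>vpart b\<bar> \<le> K * Npf M q (der_len b)"
    using psi_bound[OF zero_class(1) assms] q by (simp add: vpart_def zero_class powr_powr Npf_nonneg)
qed

text \<open>The length of \<open>h b\<close> is at most \<open>\<bar>h\<bar>\<close> times that of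
  \<open>b\<close>, so the bound on \<open>vpart\<close> becomes the weighted bound of the Riesz
  lemma with \<open>w = der_len b\<close>.\<close>

lemma ex_density_vpart:
  assumes b: "b \<in> DD"
  shows "\<exists>l. integrable M l \<and> (\<forall>h\<in>Lipb T d. vpart (der_fmult T d M h b) = (\<integral>x. h x * l x \<partial>M)) \<and>
    (\<forall>h\<in>bounded_measurable M. \<bar>\<integral>x. h x * l x \<partial>M\<bar> \<le> K * Npf M q (\<lambda>x. h x * der_len b x))"
proof (rule Riesz_Lipb)
  note bD = DD_D[OF b]
  note hb = DD_TX[OF DD_fmult[OF b]]
  show "der_len b \<in> Lpf M q" by (rule der_len_props(1)[OF bD])
  show "vpart (der_fmult T d M (\<lambda>x. g x + h x) b) = vpart (der_fmult T d M g b) + vpart (der_fmult T d M h b)"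
    if "g \<in> Lipb T d" "h \<in> Lipb T d" for g h
    using vpart(1)[OF hb[OF that(1)] hb[OF that(2)]] by (simp add: fmult_add_left[OF bD that])
  show "vpart (der_fmult T d M (\<lambda>x. c * h x) b) = c * vpart (der_fmult T d M h b)" if "h \<in> Lipb T d" for c h
    using vpart(2)[OF hb[OF that]] by (simp add: fmult_scale_left[OF bD that])
  show "\<bar>vpart (der_fmult T d M h b)\<bar> \<le> K * Npf M q (\<lambda>x. h x * der_len b x)" if h: "h \<in> Lipb T d" for h
  proof -
    have "AE x in M. \<bar>der_len (der_fmult T d M h b) x\<bar> \<le> \<bar>h x * der_len b x\<bar>"
      using D_fmult(2)[OF bD h] der_len_props(2)[OF D_fmult(1)[OF bD h]] der_len_props(2)[OF bD]
      by eventually_elim (simp add: abs_mult)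
    then have "Npf M q (der_len (der_fmult T d M h b)) \<le> Npf M q (\<lambda>x. h x * der_len b x)"
      using q by (intro Lpf_mono(2)[where p = q] bounded_mult_Lpf Lipb_bounded_measurable h der_len_props(1)[OF bD]
        Lpf_measurable[OF der_len_props(1)] D_fmult(1)[OF bD h]) simp_all
    then have "K * Npf M q (der_len (der_fmult T d M h b)) \<le> K * Npf M q (\<lambda>x. h x * der_len b x)"
      using K by (intro mult_left_mono)
    then show ?thesis using vpart(3)[OF hb[OF h]] by linarith
  qed
qed (use q K in auto)

text \<open>The value at \<open>b\<close> of the future Sobolev operator, as a function. The clause
  for bounded measurable \<open>h\<close> serves to control it where the length of \<open>b\<close>
  vanishes.\<close>

definition op_density :: "'a lderivation \<Rightarrow> 'a \<Rightarrow> real" where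
  "op_density b = (SOME l. integrable M l \<and> (\<forall>h\<in>Lipb T d. vpart (der_fmult T d M h b) = (\<integral>x. h x * l x \<partial>M)) \<and>
    (\<forall>h\<in>bounded_measurable M. \<bar>\<integral>x. h x * l x \<partial>M\<bar> \<le> K * Npf M q (\<lambda>x. h x * der_len b x)))"

lemma op_density:
  assumes "b \<in> DD"
  shows "integrable M (op_density b)" "h \<in> Lipb T d \<Longrightarrow> vpart (der_fmult T d M h b) = (\<integral>x. h x * op_density b x \<partial>M)"
    "h \<in> bounded_measurable M \<Longrightarrow> \<bar>\<integral>x. h x * op_density b x \<partial>M\<bar> \<le> K * Npf M q (\<lambda>x. h x * der_len b x)"
proof -
  note * = someI_ex[OF ex_density_vpart[OF assms], folded op_density_def]
  show "integrable M (op_density b)" using * by (rule conjunct1)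
  show "vpart (der_fmult T d M h b) = (\<integral>x. h x * op_density b x \<partial>M)" if "h \<in> Lipb T d"
    using *[THEN conjunct2, THEN conjunct1] that by (rule bspec)
  show "\<bar>\<integral>x. h x * op_density b x \<partial>M\<bar> \<le> K * Npf M q (\<lambda>x. h x * der_len b x)" if "h \<in> bounded_measurable M"
    using *[THEN conjunct2, THEN conjunct2] that by (rule bspec)
qed

lemma op_density_measurable: "b \<in> DD \<Longrightarrow> op_density b \<in> borel_measurable M"
  using op_density(1) by auto

lemma der_len_measurable: "b \<in> D \<Longrightarrow> der_len b \<in> borel_measurable M"
  using der_len_props(1) Lpf_measurable by blast

lemma op_density_integral:
  assumes b: "b \<in> DD"
  shows "vpart b = (\<integral>x. op_density b x \<partial>M)"
proof -
  have "vpart b = (\<integral>x. unit_fun x * op_density b x \<partial>M)"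
    using op_density(2)[OF b Lipb_unit] by (simp add: fmult_unit DD_D b)
  also have "\<dots> = (\<integral>x. op_density b x \<partial>M)"
    by (intro Bochner_Integration.integral_cong refl) (simp add: unit_fun_def space_M)
  finally show ?thesis .
qed

text \<open>Linearity, here and in the next two lemmas, is checked against Lipschitz
  \<open>h\<close>: there the integral of the density is \<open>vpart\<close> of \<open>h b\<close>,
  and the module identities for derivations apply.\<close>

lemma op_density_add:
  assumes b: "b \<in> DD" and c: "c \<in> DD"
  shows "AE x in M. op_density (der_add T d M b c) x = op_density b x + op_density c x"
proof (rule Lipb_test_integral_eq)
  show "integrable M (op_density (der_add T d M b c))" "integrable M (\<lambda>x. op_density b x + op_density c x)"
    using op_density(1) DD_add(1) b c by auto
  fix h assume h: "h \<in> Lipb T d"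
  note i = bounded_mult_integrable[OF Lipb_bounded_measurable[OF h] op_density(1)[OF b]]
    bounded_mult_integrable[OF Lipb_bounded_measurable[OF h] op_density(1)[OF c]]
  have "(\<integral>x. h x * op_density (der_add T d M b c) x \<partial>M) = vpart (der_fmult T d M h (der_add T d M b c))"
    by (rule op_density(2)[OF DD_add(1)[OF b c] h, symmetric])
  also have "\<dots> = vpart (der_fmult T d M h b) + vpart (der_fmult T d M h c)"
    using vpart(1)[OF DD_TX[OF DD_fmult[OF b h]] DD_TX[OF DD_fmult[OF c h]]]
    by (simp add: fmult_add_right DD_D b c h)
  also have "\<dots> = (\<integral>x. h x * (op_density b x + op_density c x) \<partial>M)"
    using i by (simp add: op_density(2)[OF b h] op_density(2)[OF c h] distrib_left)
  finally show "(\<integral>x. h x * op_density (der_add T d M b c) x \<partial>M) = (\<integral>x. h x * (op_density b x + op_density c x) \<partial>M)" .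
qed

lemma op_density_scale:
  assumes b: "b \<in> DD"
  shows "AE x in M. op_density (der_scale T d M a b) x = a * op_density b x"
proof (rule Lipb_test_integral_eq)
  show "integrable M (op_density (der_scale T d M a b))" "integrable M (\<lambda>x. a * op_density b x)"
    using op_density(1) DD_scale(1) b by auto
  fix h assume h: "h \<in> Lipb T d"
  have "(\<integral>x. h x * op_density (der_scale T d M a b) x \<partial>M) = vpart (der_fmult T d M h (der_scale T d M a b))"
    by (rule op_density(2)[OF DD_scale(1)[OF b] h, symmetric])
  also have "\<dots> = a * vpart (der_fmult T d M h b)"
    using vpart(2)[OF DD_TX[OF DD_fmult[OF b h]]] by (simp add: fmult_scale_right DD_D b h)
  also have "\<dots> = (\<integral>x. h x * (a * op_density b x) \<partial>M)"
    by (simp add: op_density(2)[OF b h] mult.left_commute)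
  finally show "(\<integral>x. h x * op_density (der_scale T d M a b) x \<partial>M) = (\<integral>x. h x * (a * op_density b x) \<partial>M)" .
qed

lemma op_density_fmult:
  assumes b: "b \<in> DD" and g: "g \<in> Lipb T d"
  shows "AE x in M. op_density (der_fmult T d M g b) x = g x * op_density b x"
proof (rule Lipb_test_integral_eq)
  show "integrable M (op_density (der_fmult T d M g b))" "integrable M (\<lambda>x. g x * op_density b x)"
    using op_density(1) DD_fmult b g bounded_mult_integrable[OF Lipb_bounded_measurable] by auto
  fix h assume h: "h \<in> Lipb T d"
  have "(\<integral>x. h x * op_density (der_fmult T d M g b) x \<partial>M) = vpart (der_fmult T d M h (der_fmult T d M g b))"
    by (rule op_density(2)[OF DD_fmult[OF b g] h, symmetric])
  also have "\<dots> = (\<integral>x. h x * (g x * op_density b x) \<partial>M)"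
    using op_density(2)[OF b Lipb_mult[OF h g]] by (simp add: fmult_fmult DD_D b g h mult.assoc)
  finally show "(\<integral>x. h x * op_density (der_fmult T d M g b) x \<partial>M) = (\<integral>x. h x * (g x * op_density b x) \<partial>M)" .
qed

text \<open>The sign of the density, restricted to the set where the length is 0, has weighted norm
  0, so the density has integral 0 in modulus over that set. Hence quotients by the length lose
  nothing where they are set to 0.\<close>

lemma op_density_zero:
  assumes b: "b \<in> DD"
  shows "AE x in M. der_len b x = 0 \<longrightarrow> op_density b x = 0"
proof -
  note [measurable] = op_density_measurable[OF b] der_len_measurable[OF DD_D[OF b]]
  define h where "h x = (if der_len b x = 0 then sgn (op_density b x) else 0)" for x
  have hm: "h \<in> bounded_measurable M"
  proof (rule bounded_measurableI[where K = 1])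
    show "h \<in> borel_measurable M" unfolding h_def[abs_def] by measurable
  qed (auto simp: h_def sgn_if)
  have "Npf M q (\<lambda>x. h x * der_len b x) = Npf M q (\<lambda>x. 0)" by (intro arg_cong[where f = "Npf M q"]) (auto simp: h_def)
  also have "\<dots> = 0" using q by (simp add: Npf_def)
  finally have "(\<integral>x. h x * op_density b x \<partial>M) = 0" using op_density(3)[OF b hm] by simp
  moreover have "0 \<le> h x * op_density b x" for x by (auto simp: h_def sgn_if)
  ultimately have "AE x in M. h x * op_density b x = 0"
    using bounded_mult_integrable[OF hm op_density(1)[OF b]] by (subst (asm) integral_nonneg_eq_0_iff_AE) auto
  then show ?thesis by eventually_elim (auto simp: h_def sgn_if split: if_splits)
qed

text \<open>The pairs \<open>(\<Sum> h\<^sub>i L(b\<^sub>i), \<Sum> \<bar>h\<^sub>i\<bar> \<bar>b\<^sub>i\<bar>)\<close> with bounded measurable \<open>h\<^sub>i\<close>, described through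
  approximation by Lipschitz coefficients; they substitute for measurable gluing of derivations.\<close>

definition pairs :: "(('a \<Rightarrow> real) \<times> ('a \<Rightarrow> real)) set" where
  "pairs = {(l, s). integrable M l \<and> s \<in> Lpf M q \<and> (\<forall>e>0. \<exists>b\<in>DD. \<exists>r\<in>Lpf M q.
     (AE x in M. der_len b x \<le> r x) \<and> (\<integral>x. \<bar>op_density b x - l x\<bar> \<partial>M) < e \<and> Npf M q (\<lambda>x. r x - s x) < e)}"

section \<open>Stability of the approximable pairs\<close>

lemma pairs_op_density:
  assumes b: "b \<in> DD"
  shows "(op_density b, der_len b) \<in> pairs"
  unfolding pairs_def using b op_density(1)[OF b] der_len_props(1)[OF DD_D[OF b]] q
  by (auto simp: Npf_def intro!: bexI[of _ b] bexI[of _ "der_len b"])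

text \<open>Lengths of sums only satisfy a triangle inequality, whereas the bounding functions
  \<open>r\<close> add exactly; this is why a pair records a bound of the length instead of the
  length.\<close>

lemma pairs_add:
  assumes "(l, s) \<in> pairs" "(l', s') \<in> pairs"
  shows "(\<lambda>x. l x + l' x, \<lambda>x. s x + s' x) \<in> pairs"
proof -
  have ls: "integrable M l" "s \<in> Lpf M q" "integrable M l'" "s' \<in> Lpf M q" using assms by (auto simp: pairs_def)
  have "\<exists>b\<in>DD. \<exists>r\<in>Lpf M q. (AE x in M. der_len b x \<le> r x) \<and>
      (\<integral>x. \<bar>op_density b x - (l x + l' x)\<bar> \<partial>M) < e \<and> Npf M q (\<lambda>x. r x - (s x + s' x)) < e" if "0 < e" for e
  proof -
    have e: "0 < e / 2" using that by simp
    obtain b r where b: "b \<in> DD" "r \<in> Lpf M q" "AE x in M. der_len b x \<le> r x" "(\<integral>x. \<bar>op_density b x - l x\<bar> \<partial>M) < e / 2"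
      "Npf M q (\<lambda>x. r x - s x) < e / 2" using assms(1) e unfolding pairs_def by blast
    obtain c t where c: "c \<in> DD" "t \<in> Lpf M q" "AE x in M. der_len c x \<le> t x" "(\<integral>x. \<bar>op_density c x - l' x\<bar> \<partial>M) < e / 2"
      "Npf M q (\<lambda>x. t x - s' x) < e / 2" using assms(2) e unfolding pairs_def by blast
    note i = op_density(1)[OF b(1)] op_density(1)[OF c(1)] op_density(1)[OF DD_add(1)[OF b(1) c(1)]]
    show ?thesis
    proof (intro bexI conjI)
      show "der_add T d M b c \<in> DD" by (rule DD_add(1)[OF b(1) c(1)])
      show "(\<lambda>x. r x + t x) \<in> Lpf M q" using b c q by (intro Lpf_add) auto
      show "AE x in M. der_len (der_add T d M b c) x \<le> r x + t x"
        using D_add(2)[OF DD_D[OF b(1)] DD_D[OF c(1)]] b(3) c(3) by eventually_elim simp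
      have "(\<integral>x. \<bar>op_density (der_add T d M b c) x - (l x + l' x)\<bar> \<partial>M) \<le> (\<integral>x. \<bar>op_density b x - l x\<bar> + \<bar>op_density c x - l' x\<bar> \<partial>M)"
        using i ls op_density_add[OF b(1) c(1)] by (intro integral_mono_AE) (auto elim!: eventually_mono)
      also have "\<dots> < e" using i ls b c by simp
      finally show "(\<integral>x. \<bar>op_density (der_add T d M b c) x - (l x + l' x)\<bar> \<partial>M) < e" .
      have "Npf M q (\<lambda>x. r x + t x - (s x + s' x)) = Npf M q (\<lambda>x. (r x - s x) + (t x - s' x))"
        by (simp add: algebra_simps)
      also have "\<dots> \<le> Npf M q (\<lambda>x. r x - s x) + Npf M q (\<lambda>x. t x - s' x)"
        using b c ls q by (intro Lpf_add(2) Lpf_diff) auto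
      also have "\<dots> < e" using b c by simp
      finally show "Npf M q (\<lambda>x. r x + t x - (s x + s' x)) < e" .
    qed
  qed
  then show ?thesis using ls q by (auto simp: pairs_def intro!: Lpf_add)
qed

lemma pairs_mult:
  assumes ls: "(l, s) \<in> pairs" and h: "h \<in> bounded_measurable M"
  shows "(\<lambda>x. h x * l x, \<lambda>x. \<bar>h x\<bar> * s x) \<in> pairs"
proof -
  have l: "integrable M l" and s: "s \<in> Lpf M q" using ls by (auto simp: pairs_def)
  obtain H where H: "0 \<le> H" "\<And>x. x \<in> space M \<Longrightarrow> \<bar>h x\<bar> \<le> H" "h \<in> borel_measurable M"
    using bounded_measurableE[OF h] by metis
  have habs: "(\<lambda>x. \<bar>h x\<bar>) \<in> bounded_measurable M" using H by (intro bounded_measurableI[where K = H]) auto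
  obtain a where a: "\<And>n. a n \<in> Lipb T d"
      "\<And>p u. 0 < p \<Longrightarrow> u \<in> Lpf M p \<Longrightarrow> (\<lambda>n. Npf M p (\<lambda>x. (a n x - h x) * u x)) \<longlonglongrightarrow> 0"
    using Lipb_approx_mult[OF h] by blast
  have "\<exists>b\<in>DD. \<exists>r\<in>Lpf M q. (AE x in M. der_len b x \<le> r x) \<and>
      (\<integral>x. \<bar>op_density b x - h x * l x\<bar> \<partial>M) < e \<and> Npf M q (\<lambda>x. r x - \<bar>h x\<bar> * s x) < e" if e: "0 < e" for e
  proof -
    \<comment> \<open>The error of the given pair is multiplied by at most \<open>H\<close>; this
      leaves \<open>e / 2\<close> for replacing \<open>h\<close> by a Lipschitz coefficient.\<close>
    define e1 where "e1 = e / 2 / (H + 1)"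
    have e1: "0 < e1" using e H by (simp add: e1_def)
    have He1: "H * e1 \<le> e / 2" using e H by (simp add: e1_def field_simps)
    obtain b r where b: "b \<in> DD" "r \<in> Lpf M q" "AE x in M. der_len b x \<le> r x" "(\<integral>x. \<bar>op_density b x - l x\<bar> \<partial>M) < e1"
      "Npf M q (\<lambda>x. r x - s x) < e1" using ls e1 unfolding pairs_def by blast
    have "(\<lambda>n. Npf M 1 (\<lambda>x. (a n x - h x) * op_density b x)) \<longlonglongrightarrow> 0" "(\<lambda>n. Npf M q (\<lambda>x. (a n x - h x) * r x)) \<longlonglongrightarrow> 0"
      using a(2)[of 1 "op_density b"] a(2)[of q r] op_density(1)[OF b(1)] b(2) q by (auto simp: Lpf_1)
    then have "\<forall>\<^sub>F n in sequentially. Npf M 1 (\<lambda>x. (a n x - h x) * op_density b x) < e / 2"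
      "\<forall>\<^sub>F n in sequentially. Npf M q (\<lambda>x. (a n x - h x) * r x) < e / 2"
      using e by (auto dest: order_tendstoD(2)[where a = "e / 2"])
    then have "\<forall>\<^sub>F n in sequentially. Npf M 1 (\<lambda>x. (a n x - h x) * op_density b x) < e / 2 \<and>
      Npf M q (\<lambda>x. (a n x - h x) * r x) < e / 2" by (rule eventually_conj)
    then obtain n where n: "(\<integral>x. \<bar>(a n x - h x) * op_density b x\<bar> \<partial>M) < e / 2"
      "Npf M q (\<lambda>x. (a n x - h x) * r x) < e / 2"
      by (auto simp: Npf_1 eventually_sequentially)
    define k where "k = a n"
    have kL: "k \<in> Lipb T d" by (simp add: k_def a)
    note kb = Lipb_bounded_measurable[OF kL]
    have kabs: "(\<lambda>x. \<bar>k x\<bar>) \<in> bounded_measurable M"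
      using kb by (auto simp: bounded_measurable_def)
    have kh: "(\<lambda>x. k x + - 1 * h x) \<in> bounded_measurable M" by (intro bounded_measurable_add kb bounded_measurable_scale h)
    note i = op_density(1)[OF b(1)] op_density(1)[OF DD_fmult[OF b(1) kL]] bounded_mult_integrable[OF kh op_density(1)[OF b(1)]]
      bounded_mult_integrable[OF h l]
    show ?thesis
    proof (intro bexI conjI)
      show "der_fmult T d M k b \<in> DD" by (rule DD_fmult[OF b(1) kL])
      show "(\<lambda>x. \<bar>k x\<bar> * r x) \<in> Lpf M q" using b q by (intro bounded_mult_Lpf kabs) auto
      show "AE x in M. der_len (der_fmult T d M k b) x \<le> \<bar>k x\<bar> * r x"
        using D_fmult(2)[OF DD_D[OF b(1)] kL] b(3)
      proof eventually_elim
        case (elim x)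
        have "\<bar>k x\<bar> * der_len b x \<le> \<bar>k x\<bar> * r x" using elim by (intro mult_left_mono) auto
        then show ?case using elim by linarith
      qed
      have "(\<integral>x. \<bar>op_density (der_fmult T d M k b) x - h x * l x\<bar> \<partial>M)
          \<le> (\<integral>x. \<bar>(k x - h x) * op_density b x\<bar> + H * \<bar>op_density b x - l x\<bar> \<partial>M)"
      proof (rule integral_mono_AE)
        show "AE x in M. \<bar>op_density (der_fmult T d M k b) x - h x * l x\<bar> \<le> \<bar>(k x - h x) * op_density b x\<bar> + H * \<bar>op_density b x - l x\<bar>"
          using op_density_fmult[OF b(1) kL] AE_space
        proof eventually_elim
          case (elim x)
          \<comment> \<open>Split as \<open>(k - h) L(b) + h (L(b) - l)\<close>; the lengths below
            are split in the same way.\<close>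
          have "\<bar>k x * op_density b x - h x * l x\<bar> \<le> \<bar>(k x - h x) * op_density b x\<bar> + \<bar>h x * (op_density b x - l x)\<bar>"
            using abs_triangle_ineq[of "(k x - h x) * op_density b x" "h x * (op_density b x - l x)"] by (simp add: algebra_simps)
          moreover have "\<bar>h x * (op_density b x - l x)\<bar> \<le> H * \<bar>op_density b x - l x\<bar>"
            unfolding abs_mult using H(2)[OF elim(2)] by (intro mult_right_mono) auto
          ultimately show ?case using elim by simp
        qed
      qed (use i l in auto)
      also have "\<dots> = (\<integral>x. \<bar>(k x - h x) * op_density b x\<bar> \<partial>M) + H * (\<integral>x. \<bar>op_density b x - l x\<bar> \<partial>M)"
        using i l by simp
      also have "H * (\<integral>x. \<bar>op_density b x - l x\<bar> \<partial>M) \<le> H * e1" using b H by (intro mult_left_mono) auto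
      finally show "(\<integral>x. \<bar>op_density (der_fmult T d M k b) x - h x * l x\<bar> \<partial>M) < e" using n He1 by (simp add: k_def)
      have 1: "(\<lambda>x. (k x - h x) * r x) \<in> Lpf M q" using bounded_mult_Lpf[OF kh b(2)] q by simp
      have 2: "(\<lambda>x. r x - s x) \<in> Lpf M q" using b s q by (intro Lpf_diff) auto
      have 3: "(\<lambda>x. (\<bar>k x\<bar> + - 1 * \<bar>h x\<bar>) * r x) \<in> Lpf M q"
        using b q by (intro bounded_mult_Lpf bounded_measurable_add kabs bounded_measurable_scale habs) auto
      have 4: "(\<lambda>x. \<bar>h x\<bar> * (r x - s x)) \<in> Lpf M q" using 2 q by (intro bounded_mult_Lpf habs) auto
      have "Npf M q (\<lambda>x. \<bar>k x\<bar> * r x - \<bar>h x\<bar> * s x)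
          = Npf M q (\<lambda>x. (\<bar>k x\<bar> + - 1 * \<bar>h x\<bar>) * r x + \<bar>h x\<bar> * (r x - s x))"
        by (simp add: algebra_simps)
      also have "\<dots> \<le> Npf M q (\<lambda>x. (\<bar>k x\<bar> + - 1 * \<bar>h x\<bar>) * r x) + Npf M q (\<lambda>x. \<bar>h x\<bar> * (r x - s x))"
        using 3 4 q by (intro Lpf_add(2)) auto
      also have "Npf M q (\<lambda>x. (\<bar>k x\<bar> + - 1 * \<bar>h x\<bar>) * r x) \<le> Npf M q (\<lambda>x. (k x - h x) * r x)"
        using 1 3 q by (intro Lpf_mono(2)[where p = q] Lpf_measurable[OF 3]) (auto simp: abs_mult intro!: mult_right_mono)
      also have "Npf M q (\<lambda>x. \<bar>h x\<bar> * (r x - s x)) \<le> Npf M q (\<lambda>x. H * (r x - s x))"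
        using 2 q H by (intro Lpf_mono(2)[where p = q] Lpf_measurable[OF 4] Lpf_scale)
          (auto simp: abs_mult intro!: mult_right_mono AE_I2)
      also have "\<dots> = H * Npf M q (\<lambda>x. r x - s x)" using Lpf_scale(2)[OF 2, of H] q H by simp
      also have "\<dots> \<le> H * e1" using b H by (intro mult_left_mono) auto
      finally show "Npf M q (\<lambda>x. \<bar>k x\<bar> * r x - \<bar>h x\<bar> * s x) < e" using n He1 by (simp add: k_def)
    qed
  qed
  then show ?thesis
    using bounded_mult_integrable[OF h l] bounded_mult_Lpf[OF habs s] q by (auto simp: pairs_def)
qed

lemma pairs_cong:
  assumes "(l, s) \<in> pairs" "AE x in M. l x = l' x" "AE x in M. s x = s' x"
    "l' \<in> borel_measurable M" "s' \<in> borel_measurable M"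
  shows "(l', s') \<in> pairs"
proof -
  have l: "integrable M l" and s: "s \<in> Lpf M q" using assms by (auto simp: pairs_def)
  have l': "integrable M l'" using integrable_cong_AE[of l M l'] l assms by auto
  have "AE x in M. s' x = s x" using assms(3) by eventually_elim simp
  then have s': "s' \<in> Lpf M q" using assms(5) q by (intro Lpf_cong_AE[OF s]) auto
  have eq: "(\<integral>x. \<bar>op_density b x - l' x\<bar> \<partial>M) = (\<integral>x. \<bar>op_density b x - l x\<bar> \<partial>M)" if "b \<in> DD" for b
    using assms(2) op_density(1)[OF that] l l' by (intro integral_cong_AE) (auto elim!: eventually_mono)
  have eq': "Npf M q (\<lambda>x. r x - s' x) = Npf M q (\<lambda>x. r x - s x)" if "r \<in> Lpf M q" for r
    using assms(3) Lpf_measurable[OF that] Lpf_measurable[OF s] assms(5)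
    by (intro Npf_cong_AE) (auto elim!: eventually_mono)
  show ?thesis using assms(1) l' s' unfolding pairs_def by (simp add: eq eq' cong: bex_cong conj_cong)
qed

text \<open>The estimate for \<open>\<psi>\<close> at the class of \<open>k\<close> and an
  approximating \<open>b\<close> passes to the limit: the density of \<open>b\<close> tends to
  \<open>l\<close>, and its length is at most a function tending to \<open>s\<close>.\<close>

lemma pairs_bound:
  assumes ls: "(l, s) \<in> pairs" and k: "k \<in> bounded_measurable M"
  shows "(\<integral>x. k x * fun_density x \<partial>M) + (\<integral>x. l x \<partial>M) \<le> K * (Npf M q k powr q + Npf M q s powr q) powr (1 / q)"
proof -
  have l: "integrable M l" and s: "s \<in> Lpf M q" using ls by (auto simp: pairs_def)
  define R where "R = (Npf M q k powr q + Npf M q s powr q) powr (1 / q)"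
  have "(\<integral>x. k x * fun_density x \<partial>M) + (\<integral>x. l x \<partial>M) - K * R \<le> 0 + e" if e: "0 < e" for e
  proof -
    \<comment> \<open>The length contributes an error \<open>K * e1\<close>, the integral of the
      density an error \<open>e1\<close>.\<close>
    define e1 where "e1 = e / (K + 1)"
    have e1: "0 < e1" using e K by (simp add: e1_def)
    have Ke1: "K * e1 + e1 = e" proof -
      have "K * e1 + e1 = (K + 1) * e1" by (simp add: distrib_right)
      then show ?thesis using K by (simp add: e1_def)
    qed
    obtain b r where b: "b \<in> DD" "r \<in> Lpf M q" "AE x in M. der_len b x \<le> r x" "(\<integral>x. \<bar>op_density b x - l x\<bar> \<partial>M) < e1"
      "Npf M q (\<lambda>x. r x - s x) < e1" using ls e1 unfolding pairs_def by blast
    have 2: "(\<lambda>x. r x - s x) \<in> Lpf M q" using b s q by (intro Lpf_diff) auto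
    have "AE x in M. \<bar>der_len b x\<bar> \<le> \<bar>r x\<bar>" using b(3) der_len_props(2)[OF DD_D[OF b(1)]] by eventually_elim simp
    then have "Npf M q (der_len b) \<le> Npf M q r"
      using b q by (intro Lpf_mono(2)[where p = q] der_len_measurable DD_D) auto
    also have "Npf M q r = Npf M q (\<lambda>x. s x + (r x - s x))" by simp
    also have "\<dots> \<le> Npf M q s + Npf M q (\<lambda>x. r x - s x)" using s 2 q by (intro Lpf_add(2)) auto
    finally have Ab: "Npf M q (der_len b) \<le> Npf M q s + e1" using b by linarith
    have kL: "k \<in> Lpf M q" by (rule bounded_measurable_Lpf[OF k])
    have kc: "ae_class M k \<in> Lp M q" "Npf M q (rep (ae_class M k)) = Npf M q k"
      using ae_class_in_Lp[OF kL] q by (auto simp: Lp_norm_eq)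
    have "(\<integral>x. k x * fun_density x \<partial>M) + (\<integral>x. op_density b x \<partial>M) = \<psi> (ae_class M k, b)"
      using psi_split[OF kc(1) DD_TX[OF b(1)]] fun_density(2)[OF k] op_density_integral[OF b(1)]
      by (simp add: gpart_def vpart_def)
    also have "\<dots> \<le> K * (Npf M q k powr q + Npf M q (der_len b) powr q) powr (1 / q)"
      using psi_bound[OF kc(1) DD_TX[OF b(1)]] by (simp add: kc)
    also have "\<dots> \<le> K * ((Npf M q k + 0) powr q + (Npf M q s + e1) powr q) powr (1 / q)"
      using Ab q K by (intro mult_left_mono powr_mono2 add_mono) (auto simp: Npf_nonneg)
    \<comment> \<open>Minkowski for pairs separates the error \<open>(0, e1)\<close> from the norm
      \<open>R\<close>.\<close>
    also have "\<dots> \<le> K * (R + (0 powr q + e1 powr q) powr (1 / q))"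
      unfolding R_def using q e1 K by (intro mult_left_mono Minkowski_pair) (auto simp: Npf_nonneg)
    also have "(0 powr q + e1 powr q) powr (1 / q) = e1" using q e1 by (simp add: powr_powr)
    finally have "(\<integral>x. k x * fun_density x \<partial>M) + (\<integral>x. op_density b x \<partial>M) \<le> K * R + K * e1" by (simp add: distrib_left)
    moreover have "(\<integral>x. l x \<partial>M) - (\<integral>x. op_density b x \<partial>M) \<le> (\<integral>x. \<bar>op_density b x - l x\<bar> \<partial>M)"
    proof -
      have "(\<integral>x. l x \<partial>M) - (\<integral>x. op_density b x \<partial>M) = (\<integral>x. l x - op_density b x \<partial>M)" using l op_density(1)[OF b(1)] by simp
      also have "\<dots> \<le> (\<integral>x. \<bar>op_density b x - l x\<bar> \<partial>M)" using l op_density(1)[OF b(1)] by (intro integral_mono) auto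
      finally show ?thesis .
    qed
    ultimately show ?thesis using b(4) Ke1 by linarith
  qed
  then have "(\<integral>x. k x * fun_density x \<partial>M) + (\<integral>x. l x \<partial>M) - K * R \<le> 0" by (rule field_le_epsilon)
  then show ?thesis by (simp add: R_def)
qed

text \<open>Quotients \<open>l / s\<close> of pairs, written multiplicatively so that nothing is
  divided where \<open>s\<close> vanishes. Positivity of \<open>s\<close> where \<open>G\<close> is
  positive later allows coefficients of the form \<open>G powr (p - 1) / s\<close>.\<close>

definition ratios :: "('a \<Rightarrow> real) set" where
  "ratios = {G \<in> borel_measurable M. (\<forall>x. 0 \<le> G x) \<and> (\<exists>l s. (l, s) \<in> pairs \<and>
    (AE x in M. l x = G x * s x \<and> (0 < G x \<longrightarrow> 0 < s x)))}"

text \<open>Multiplication by the sign of the density turns the pair of \<open>b\<close> into the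
  moduli of density and length wherever the density is nonzero. The modulus in the denominator gives
  nonnegativity at every point, the length being nonnegative almost everywhere.\<close>

lemma ratios_op_density:
  assumes b: "b \<in> DD"
  shows "(\<lambda>x. \<bar>op_density b x\<bar> / \<bar>der_len b x\<bar>) \<in> ratios"
proof -
  note [measurable] = op_density_measurable[OF b] der_len_measurable[OF DD_D[OF b]]
  have sg: "(\<lambda>x. sgn (op_density b x)) \<in> bounded_measurable M"
    by (intro bounded_measurableI[where K = 1]) (auto simp: sgn_if)
  have "AE x in M. sgn (op_density b x) * op_density b x = \<bar>op_density b x\<bar> / \<bar>der_len b x\<bar> * (\<bar>sgn (op_density b x)\<bar> * der_len b x) \<and>
      (0 < \<bar>op_density b x\<bar> / \<bar>der_len b x\<bar> \<longrightarrow> 0 < \<bar>sgn (op_density b x)\<bar> * der_len b x)"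
    using op_density_zero[OF b] der_len_props(2)[OF DD_D[OF b]]
    by eventually_elim (auto simp: sgn_if)
  then show ?thesis using pairs_mult[OF pairs_op_density[OF b] sg] by (auto simp: ratios_def)
qed

text \<open>Glue the two pairs along the set where the first ratio is the larger one; indicators are
  admissible multipliers of pairs.\<close>

lemma ratios_max:
  assumes "G \<in> ratios" "H \<in> ratios"
  shows "(\<lambda>x. max (G x) (H x)) \<in> ratios"
proof -
  have [measurable]: "G \<in> borel_measurable M" "H \<in> borel_measurable M" and nn: "\<And>x. 0 \<le> G x" "\<And>x. 0 \<le> H x"
    using assms by (auto simp: ratios_def)
  obtain l s where ls: "(l, s) \<in> pairs" "AE x in M. l x = G x * s x \<and> (0 < G x \<longrightarrow> 0 < s x)"
    using assms by (auto simp: ratios_def)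
  obtain k t where kt: "(k, t) \<in> pairs" "AE x in M. k x = H x * t x \<and> (0 < H x \<longrightarrow> 0 < t x)"
    using assms by (auto simp: ratios_def)
  define E where "E = {x \<in> space M. H x \<le> G x}"
  have E[measurable]: "E \<in> sets M" unfolding E_def by measurable
  define u where "u x = indicator E x * l x + indicator (space M - E) x * k x" for x
  define v where "v x = \<bar>indicator E x\<bar> * s x + \<bar>indicator (space M - E) x\<bar> * t x" for x
  have "(u, v) \<in> pairs"
    unfolding u_def[abs_def] v_def[abs_def]
    by (intro pairs_add pairs_mult ls kt bounded_measurable_indicator) auto
  moreover have "AE x in M. u x = max (G x) (H x) * v x \<and> (0 < max (G x) (H x) \<longrightarrow> 0 < v x)"
    using ls(2) kt(2) AE_space
  proof eventually_elim
    case (elim x)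
    show ?case
    proof (cases "H x \<le> G x")
      case True
      then have "u x = l x" "v x = s x" using elim by (auto simp: u_def v_def E_def)
      then show ?thesis using elim True by (auto simp: max_def)
    next
      case False
      then have "u x = k x" "v x = t x" using elim by (auto simp: u_def v_def E_def)
      then show ?thesis using elim False by (auto simp: max_def)
    qed
  qed
  moreover have "(\<lambda>x. max (G x) (H x)) \<in> borel_measurable M" by measurable
  ultimately show ?thesis using nn by (auto simp: ratios_def le_max_iff_disj)
qed

lemma exponent_simps: "(p - 1) * q = p"
proof -
  have "p * q * (1 / p + 1 / q) = p * q" by (simp add: conj)
  then have "q + p = p * q" using p q by (simp add: distrib_left)
  then show ?thesis by (simp add: algebra_simps)
qed

text \<open>Test with \<open>k = sgn f \<bar>f\<bar>\<^sup>p\<^sup>-\<^sup>1\<close> and with a combination of derivations of length \<open>G\<^sup>p\<^sup>-\<^sup>1\<close>, both cut off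
  to be bounded.\<close>

lemma ratios_bound:
  assumes G: "G \<in> ratios"
  shows "integrable M (\<lambda>x. \<bar>fun_density x\<bar> powr p + G x powr p)" "(\<integral>x. \<bar>fun_density x\<bar> powr p + G x powr p \<partial>M) \<le> K powr p"
proof -
  have Gm[measurable]: "G \<in> borel_measurable M" and G0: "\<And>x. 0 \<le> G x" using G by (auto simp: ratios_def)
  obtain l s where ls: "(l, s) \<in> pairs" and Gs: "AE x in M. l x = G x * s x \<and> (0 < G x \<longrightarrow> 0 < s x)"
    using G by (auto simp: ratios_def)
  have [measurable]: "s \<in> borel_measurable M" "fun_density \<in> borel_measurable M"
    using ls fun_density(1) by (auto simp: pairs_def Lpf_def)
  define a where "a n x = (if \<bar>fun_density x\<bar> \<le> real n then \<bar>fun_density x\<bar> powr p else 0)" for n x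
  \<comment> \<open>The lower cut-off on \<open>s\<close> keeps the coefficient
    \<open>G powr (p - 1) / s\<close> bounded. It exhausts the set where \<open>G\<close> is
    positive, because \<open>s\<close> is positive there almost everywhere.\<close>
  define c where "c n x = (if G x \<le> real n \<and> 1 / real (Suc n) \<le> s x then G x powr p else 0)" for n x
  have ac0: "0 \<le> a n x" "0 \<le> c n x" for n x by (auto simp: a_def c_def)
  have p0: "0 < p - 1" using p by simp
  have am: "a n \<in> bounded_measurable M" for n
  proof (rule bounded_measurableI)
    show "a n \<in> borel_measurable M" unfolding a_def[abs_def] by measurable
    show "\<bar>a n x\<bar> \<le> real n powr p" for x using p by (auto simp: a_def intro: powr_mono2)
  qed
  have cm: "c n \<in> bounded_measurable M" for n
  proof (rule bounded_measurableI)
    show "c n \<in> borel_measurable M" unfolding c_def[abs_def] by measurable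
    show "\<bar>c n x\<bar> \<le> real n powr p" for x using p G0 by (auto simp: c_def intro: powr_mono2)
  qed
  have ai: "integrable M (a n)" and ci: "integrable M (c n)" for n
    using bounded_mult_integrable[OF am, of "\<lambda>x. 1" n] bounded_mult_integrable[OF cm, of "\<lambda>x. 1" n] by auto
  have le: "(\<integral>x. a n x + c n x \<partial>M) \<le> K powr p" for n
  proof -
    \<comment> \<open>Test data in conjugate powers: \<open>k\<close> times
      \<open>fun_density\<close> and \<open>\<bar>k\<bar> powr q\<close> both equal
      \<open>a n\<close>. Likewise the pair multiplied by \<open>h\<close> becomes
      \<open>(c n, r)\<close> with \<open>r powr q = c n\<close>, because
      \<open>(p - 1) * q = p\<close>.\<close>
    define k where "k x = (if \<bar>fun_density x\<bar> \<le> real n then sgn (fun_density x) * \<bar>fun_density x\<bar> powr (p - 1) else 0)" for x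
    define h where "h x = (if G x \<le> real n \<and> 1 / real (Suc n) \<le> s x then G x powr (p - 1) / s x else 0)" for x
    define r where "r x = (if G x \<le> real n \<and> 1 / real (Suc n) \<le> s x then G x powr (p - 1) else 0)" for x
    have km: "k \<in> bounded_measurable M"
    proof (rule bounded_measurableI)
      show "k \<in> borel_measurable M" unfolding k_def[abs_def] by measurable
      show "\<bar>k x\<bar> \<le> real n powr (p - 1)" for x
        using p0 by (auto simp: k_def abs_mult sgn_if intro: powr_mono2)
    qed
    have rm: "r \<in> borel_measurable M" unfolding r_def[abs_def] by measurable
    have hm: "h \<in> bounded_measurable M"
    proof (rule bounded_measurableI)
      show "h \<in> borel_measurable M" unfolding h_def[abs_def] by measurable
      show "\<bar>h x\<bar> \<le> real n powr (p - 1) * real (Suc n)" for x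
      proof (cases "G x \<le> real n \<and> 1 / real (Suc n) \<le> s x")
        case True
        then have s0: "0 < s x" by (auto intro: less_le_trans[of 0 "1 / real (Suc n)"])
        have "1 \<le> s x * real (Suc n)" using True by (simp only: pos_divide_le_eq of_nat_0_less_iff zero_less_Suc)
        then have s: "0 < s x" "1 / s x \<le> real (Suc n)"
          using s0 by (simp_all only: pos_divide_le_eq mult.commute)
        have "G x powr (p - 1) * (1 / s x) \<le> real n powr (p - 1) * real (Suc n)"
          using True s p0 G0 by (intro mult_mono powr_mono2) auto
        then show ?thesis using True s by (simp add: h_def)
      qed (auto simp: h_def)
    qed
    have "(\<lambda>x. h x * l x, \<lambda>x. \<bar>h x\<bar> * s x) \<in> pairs" by (rule pairs_mult[OF ls hm])
    moreover have "AE x in M. h x * l x = c n x"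
      using Gs
    proof eventually_elim
      case (elim x)
      show ?case
      proof (cases "G x \<le> real n \<and> 1 / real (Suc n) \<le> s x")
        case True
        then have "0 < s x" by (auto intro: less_le_trans[of 0 "1 / real (Suc n)"])
        then show ?thesis using True elim G0[of x] powr_mult_base[OF G0, of x "p - 1"]
          by (simp add: h_def c_def mult.commute)
      qed (auto simp: h_def c_def)
    qed
    moreover have "AE x in M. \<bar>h x\<bar> * s x = r x"
    proof (rule AE_I2)
      fix x
      show "\<bar>h x\<bar> * s x = r x"
      proof (cases "G x \<le> real n \<and> 1 / real (Suc n) \<le> s x")
        case True
        then have "0 < s x" by (auto intro: less_le_trans[of 0 "1 / real (Suc n)"])
        then show ?thesis using True by (simp add: h_def r_def)
      qed (auto simp: h_def r_def)
    qed
    moreover have "c n \<in> borel_measurable M" using cm[of n] by (simp add: bounded_measurable_def)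
    ultimately have "(c n, r) \<in> pairs" using rm by (rule pairs_cong)
    from pairs_bound[OF this km]
    have *: "(\<integral>x. k x * fun_density x \<partial>M) + (\<integral>x. c n x \<partial>M) \<le> K * (Npf M q k powr q + Npf M q r powr q) powr (1 / q)" .
    have kf: "k x * fun_density x = a n x" for x
      using powr_mult_base[of "\<bar>fun_density x\<bar>" "p - 1"] by (auto simp: k_def a_def sgn_if mult.commute)
    have "\<bar>k x\<bar> powr q = a n x" for x
      using p q by (auto simp: k_def a_def abs_mult sgn_if powr_powr exponent_simps)
    then have 1: "Npf M q k powr q = (\<integral>x. a n x \<partial>M)" using q by (simp add: Npf_powr)
    have "\<bar>r x\<bar> powr q = c n x" for x
      by (auto simp: r_def c_def powr_powr exponent_simps)
    then have 2: "Npf M q r powr q = (\<integral>x. c n x \<partial>M)" using q by (simp add: Npf_powr)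
    \<comment> \<open>The same number stands on both sides of the estimate, on the right under the
      power \<open>1 / q\<close>; it is finite by the cut-offs, so it can be absorbed.\<close>
    have "(\<integral>x. a n x \<partial>M) + (\<integral>x. c n x \<partial>M) \<le> K powr p"
      using * K ac0 by (intro le_powr_of_le_mult[OF p q conj]) (auto simp: kf 1 2)
    then show ?thesis using ai ci by simp
  qed
  have mono: "mono (\<lambda>n. a n x + c n x)" for x
  proof (rule monoI)
    fix m n :: nat assume mn: "m \<le> n"
    have "1 / real (Suc n) \<le> 1 / real (Suc m)" using mn by (intro divide_left_mono) auto
    then have "c m x \<le> c n x" using mn by (auto simp: c_def)
    moreover have "a m x \<le> a n x" using mn by (auto simp: a_def)
    ultimately show "a m x + c m x \<le> a n x + c n x" by simp
  qed
  have lim: "AE x in M. (\<lambda>n. a n x + c n x) \<longlonglongrightarrow> \<bar>fun_density x\<bar> powr p + G x powr p"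
    using Gs
  proof eventually_elim
    case (elim x)
    have "\<forall>\<^sub>F n in sequentially. \<bar>fun_density x\<bar> \<le> real n" "\<forall>\<^sub>F n in sequentially. G x \<le> real n"
      using filterlim_real_sequentially by (auto simp: filterlim_at_top)
    \<comment> \<open>Where \<open>G\<close> vanishes, the cut-off on \<open>s\<close> leaves the
      value 0 unchanged.\<close>
    moreover have "\<forall>\<^sub>F n in sequentially. G x = 0 \<or> 1 / real (Suc n) \<le> s x"
    proof (cases "G x = 0")
      case False
      then have "0 < s x" using elim G0[of x] by simp
      moreover have "(\<lambda>n. 1 / real (Suc n)) \<longlonglongrightarrow> 0" using LIMSEQ_inverse_real_of_nat by (simp add: inverse_eq_divide)
      ultimately have "\<forall>\<^sub>F n in sequentially. 1 / real (Suc n) < s x" by (auto dest: order_tendstoD(2))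
      then show ?thesis by eventually_elim simp
    qed simp
    ultimately have "\<forall>\<^sub>F n in sequentially. a n x + c n x = \<bar>fun_density x\<bar> powr p + G x powr p"
      by eventually_elim (auto simp: a_def c_def)
    then show ?case by (rule tendsto_eventually)
  qed
  have m: "(\<lambda>x. \<bar>fun_density x\<bar> powr p + G x powr p) \<in> borel_measurable M" by measurable
  have i: "integrable M (\<lambda>x. a n x + c n x)" for n using ai ci by auto
  note mon = integrable_of_bounded_mono[where u = "\<lambda>n x. a n x + c n x", OF i _ _ lim m le]
  show "integrable M (\<lambda>x. \<bar>fun_density x\<bar> powr p + G x powr p)"
    using mono ac0 by (intro mon) auto
  show "(\<integral>x. \<bar>fun_density x\<bar> powr p + G x powr p \<partial>M) \<le> K powr p"
    using mono ac0 by (intro mon) auto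
qed

lemma ratios_powr_integrable:
  assumes G: "G \<in> ratios"
  shows "integrable M (\<lambda>x. \<bar>fun_density x\<bar> powr p)" "integrable M (\<lambda>x. G x powr p)"
    "(\<integral>x. \<bar>fun_density x\<bar> powr p \<partial>M) + (\<integral>x. G x powr p \<partial>M) \<le> K powr p"
proof -
  have [measurable]: "G \<in> borel_measurable M" "fun_density \<in> borel_measurable M"
    using G fun_density(1) by (auto simp: ratios_def)
  note b = ratios_bound[OF G]
  show 1: "integrable M (\<lambda>x. \<bar>fun_density x\<bar> powr p)" by (rule Bochner_Integration.integrable_bound[OF b(1)]) auto
  show 2: "integrable M (\<lambda>x. G x powr p)" by (rule Bochner_Integration.integrable_bound[OF b(1)]) auto
  show "(\<integral>x. \<bar>fun_density x\<bar> powr p \<partial>M) + (\<integral>x. G x powr p \<partial>M) \<le> K powr p" using b(2) 1 2 by simp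
qed

text \<open>One ratio is enough to read off integrability of the function part; the zero derivation
  provides it.\<close>

lemma fun_density_Lpf: "fun_density \<in> Lpf M p"
  using ratios_powr_integrable(1)[OF ratios_op_density[OF zero_der_DD]] fun_density(1) by (auto simp: Lpf_def)

text \<open>The p-th powers of the ratios form a family closed under maxima with commonly bounded
  integrals; the p-th root of its essential supremum bounds all ratios simultaneously.\<close>

lemma ex_gradient_bound:
  "\<exists>g\<in>Lpf M p. (\<forall>x. 0 \<le> g x) \<and> (\<forall>b\<in>DD. AE x in M. \<bar>op_density b x\<bar> \<le> g x * der_len b x) \<and>
    (\<integral>x. \<bar>fun_density x\<bar> powr p \<partial>M) + (\<integral>x. g x powr p \<partial>M) \<le> K powr p"
proof -
  \<comment> \<open>What the function part leaves of the total \<open>K powr p\<close>; this keeps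
    the joint estimate sharp.\<close>
  define S where "S = K powr p - (\<integral>x. \<bar>fun_density x\<bar> powr p \<partial>M)"
  define \<G> where "\<G> = (\<lambda>G x. G x powr p) ` ratios"
  have "\<exists>g. integrable M g \<and> (\<forall>x. 0 \<le> g x) \<and> (\<integral>x. g x \<partial>M) \<le> S \<and> (\<forall>G\<in>\<G>. AE x in M. G x \<le> g x)"
  proof (rule ex_ess_sup)
    show "\<G> \<noteq> {}" using ratios_op_density[OF zero_der_DD] by (auto simp: \<G>_def)
    show "integrable M G" if "G \<in> \<G>" for G using that ratios_powr_integrable(2) by (auto simp: \<G>_def)
    show "0 \<le> G x" if "G \<in> \<G>" for G x using that by (auto simp: \<G>_def)
    show "(\<integral>x. G x \<partial>M) \<le> S" if "G \<in> \<G>" for G using that ratios_powr_integrable(3) by (fastforce simp: \<G>_def S_def)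
    show "(\<lambda>x. max (G x) (H x)) \<in> \<G>" if in_G: "G \<in> \<G>" "H \<in> \<G>" for G H
    proof -
      obtain G' H' where GH: "G' \<in> ratios" "H' \<in> ratios" "G = (\<lambda>x. G' x powr p)" "H = (\<lambda>x. H' x powr p)"
        using in_G unfolding \<G>_def by blast
      have nn: "0 \<le> G' x" "0 \<le> H' x" for x using GH by (auto simp: ratios_def)
      have "max (G' x) (H' x) powr p = max (G x) (H x)" for x
      proof (cases "G' x \<le> H' x")
        case True
        then have "G x \<le> H x" using nn p by (auto simp: GH intro: powr_mono2)
        then show ?thesis using True by (simp add: GH max_def)
      next
        case False
        then have "H x \<le> G x" using nn p by (auto simp: GH intro: powr_mono2)
        then show ?thesis using False by (auto simp: GH max_def)
      qed
      then show ?thesis unfolding \<G>_def by (intro image_eqI[OF _ ratios_max[OF GH(1,2)]]) auto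
    qed
  qed
  then obtain g where g: "integrable M g" "\<And>x. 0 \<le> g x" "(\<integral>x. g x \<partial>M) \<le> S" "\<And>G. G \<in> \<G> \<Longrightarrow> AE x in M. G x \<le> g x"
    by blast
  define k where "k x = g x powr (1 / p)" for x
  have kp: "k x powr p = g x" for x using g(2) p by (simp add: k_def powr_powr)
  have [measurable]: "g \<in> borel_measurable M" using g(1) by auto
  have "k \<in> borel_measurable M" unfolding k_def[abs_def] by measurable
  then have kL: "k \<in> Lpf M p" using g(1) by (simp add: Lpf_def k_def powr_powr) (use g(2) p in simp)
  have "AE x in M. \<bar>op_density b x\<bar> \<le> k x * der_len b x" if b: "b \<in> DD" for b
  proof -
    have "AE x in M. (\<bar>op_density b x\<bar> / \<bar>der_len b x\<bar>) powr p \<le> g x"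
      using ratios_op_density[OF b] by (intro g(4)) (auto simp: \<G>_def)
    then show ?thesis using op_density_zero[OF b] der_len_props(2)[OF DD_D[OF b]]
    proof eventually_elim
      case (elim x)
      show ?case
      \<comment> \<open>At points of length 0 the density vanishes too; elsewhere take p-th roots
        and multiply by the length.\<close>
      proof (cases "der_len b x = 0")
        case False
        then have der_len: "0 < der_len b x" using elim by simp
        have "((\<bar>op_density b x\<bar> / \<bar>der_len b x\<bar>) powr p) powr (1 / p) \<le> k x"
          unfolding k_def using elim p by (intro powr_mono2) auto
        then have "\<bar>op_density b x\<bar> / der_len b x \<le> k x" using der_len p by (simp add: powr_powr)
        then show ?thesis using der_len by (simp add: pos_divide_le_eq)
      qed (use elim in simp)
    qed
  qed
  moreover have "(\<integral>x. \<bar>fun_density x\<bar> powr p \<partial>M) + (\<integral>x. k x powr p \<partial>M) \<le> K powr p"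
    using g(3) by (simp add: kp S_def)
  ultimately show ?thesis using kL by (intro bexI[of _ k]) (auto simp: k_def)
qed

text \<open>Truncation: the Riesz lemma covers bounded functions, and now that the density is in L^p
  the integrals converge for every \<open>g\<close> in L^q by domination.\<close>

lemma gpart_eq:
  assumes g: "g \<in> Lpf M q"
  shows "gpart g = (\<integral>x. fun_density x * g x \<partial>M)"
proof -
  have [measurable]: "g \<in> borel_measurable M" "fun_density \<in> borel_measurable M" using g fun_density(1) by (auto simp: Lpf_def)
  define t where "t n x = (if \<bar>g x\<bar> \<le> real n then g x else 0)" for n x
  have tm: "t n \<in> bounded_measurable M" for n
  proof (rule bounded_measurableI[where K = "real n"])
    show "t n \<in> borel_measurable M" unfolding t_def[abs_def] by measurable
  qed (auto simp: t_def)
  note tL = bounded_measurable_Lpf[OF tm]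
  have [measurable]: "t n \<in> borel_measurable M" for n using tm[of n] by (auto simp: bounded_measurable_def)
  have ev: "\<forall>\<^sub>F n in sequentially. t n x = g x" for x
  proof -
    have "\<forall>\<^sub>F n in sequentially. \<bar>g x\<bar> \<le> real n"
      using filterlim_real_sequentially by (auto simp: filterlim_at_top)
    then show ?thesis by eventually_elim (simp add: t_def)
  qed
  have "(\<lambda>n. Npf M q (\<lambda>x. t n x + - 1 * g x)) \<longlonglongrightarrow> 0"
  proof (rule Npf_tendsto_0[OF g])
    have "(\<lambda>n. t n x + - 1 * g x) \<longlonglongrightarrow> 0" for x
    proof (rule tendsto_eventually)
      show "\<forall>\<^sub>F n in sequentially. t n x + - 1 * g x = 0" using ev[of x] by eventually_elim simp
    qed
    then show "AE x in M. (\<lambda>n. t n x + - 1 * g x) \<longlonglongrightarrow> 0" by simp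
    show "AE x in M. \<bar>t n x + - 1 * g x\<bar> \<le> \<bar>g x\<bar>" for n by (auto simp: t_def)
  qed (use q in auto)
  then have "(\<lambda>n. K * Npf M q (\<lambda>x. t n x + - 1 * g x)) \<longlonglongrightarrow> K * 0" by (intro tendsto_intros)
  then have lim: "(\<lambda>n. K * Npf M q (\<lambda>x. t n x + - 1 * g x)) \<longlonglongrightarrow> 0" by simp
  have g1: "(\<lambda>x. - 1 * g x) \<in> Lpf M q" using g q by (intro Lpf_scale) auto
  have eq: "gpart (\<lambda>x. t n x + - 1 * g x) = gpart (t n) - gpart g" for n
    using gpart(1)[OF tL g1] gpart(2)[OF g, of "- 1"] by simp
  have "(\<lambda>n. gpart (t n) - gpart g) \<longlonglongrightarrow> 0"
  proof (rule Lim_null_comparison[OF _ lim])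
    show "\<forall>\<^sub>F n in sequentially. norm (gpart (t n) - gpart g) \<le> K * Npf M q (\<lambda>x. t n x + - 1 * g x)"
      unfolding eq[symmetric] real_norm_def
      using q by (intro always_eventually allI gpart(3) Lpf_add(1) tL g1) auto
  qed
  then have lim1: "(\<lambda>n. gpart (t n)) \<longlonglongrightarrow> gpart g" by (simp add: LIM_zero_iff)
  have lim2: "(\<lambda>n. \<integral>x. t n x * fun_density x \<partial>M) \<longlonglongrightarrow> (\<integral>x. fun_density x * g x \<partial>M)"
  proof (rule integral_dominated_convergence)
    show "integrable M (\<lambda>x. \<bar>fun_density x * g x\<bar>)" using Holder(1)[OF p q conj fun_density_Lpf g] by auto
    have "(\<lambda>n. t n x * fun_density x) \<longlonglongrightarrow> fun_density x * g x" for x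
    proof (rule tendsto_eventually)
      show "\<forall>\<^sub>F n in sequentially. t n x * fun_density x = fun_density x * g x" using ev[of x] by eventually_elim simp
    qed
    then show "AE x in M. (\<lambda>n. t n x * fun_density x) \<longlonglongrightarrow> fun_density x * g x" by simp
    show "AE x in M. norm (t n x * fun_density x) \<le> \<bar>fun_density x * g x\<bar>" for n by (auto simp: t_def abs_mult)
  qed auto
  have "gpart (t n) = (\<integral>x. t n x * fun_density x \<partial>M)" for n by (rule fun_density(2)[OF tm])
  then show ?thesis using lim1 lim2 LIMSEQ_unique by simp
qed

section \<open>The Sobolev function of a functional\<close>

definition sobolev_class :: "'a aeclass" where "sobolev_class = ae_class M fun_density"

definition sobolev_op :: "'a lderivation \<Rightarrow> 'a aeclass" where "sobolev_op = (\<lambda>b\<in>DD. ae_class M (op_density b))"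

lemma rep_sobolev_op: "b \<in> DD \<Longrightarrow> AE x in M. rep (sobolev_op b) x = op_density b x"
  unfolding sobolev_op_def using rep_ae_class[OF op_density_measurable] by simp

lemma sobolev_op_L0: "b \<in> DD \<Longrightarrow> sobolev_op b \<in> L0 M"
  unfolding sobolev_op_def using ae_class_in_L0[OF op_density_measurable] by simp

lemma rep_sobolev_class: "AE x in M. rep sobolev_class x = fun_density x" "sobolev_class \<in> Lp M p" "Npf M p (rep sobolev_class) = Npf M p fun_density"
  using rep_ae_class[OF Lpf_measurable[OF fun_density_Lpf]] ae_class_in_Lp[OF fun_density_Lpf] p
  by (auto simp: sobolev_class_def Lp_norm_eq)

lemma sobolev_class_integral:
  assumes "g \<in> Lpf M q"
  shows "(\<integral>x. rep sobolev_class x * g x \<partial>M) = gpart g"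
  unfolding gpart_eq[OF assms]
  using rep_sobolev_class(1) Lpf_measurable[OF assms] Lpf_measurable[OF fun_density_Lpf] rep_measurable[OF Lp_L0[OF rep_sobolev_class(2)]]
  by (intro integral_cong_AE) (auto elim!: eventually_mono)

lemma is_sobolev_operator_sobolev_op:
  assumes g: "g \<in> Lpf M p" "\<And>x. 0 \<le> g x" "\<And>b. b \<in> DD \<Longrightarrow> AE x in M. \<bar>op_density b x\<bar> \<le> g x * der_len b x"
  shows "is_sobolev_operator T d M p q sobolev_class sobolev_op"
  unfolding is_sobolev_operator_def
proof (intro conjI ballI allI)
  have "sobolev_op b \<in> Lp M 1" if "b \<in> DD" for b
    using ae_class_in_Lp(1)[of "op_density b" M 1] op_density(1)[OF that] that by (simp add: sobolev_op_def Lpf_1)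
  then show "sobolev_op \<in> DD \<rightarrow>\<^sub>E Lp M 1" by (auto simp: sobolev_op_def)
  show "sobolev_op (der_add T d M b c) = L0_add M (sobolev_op b) (sobolev_op c)" if bc: "b \<in> DD" "c \<in> DD" for b c
    using rep_sobolev_op[OF DD_add(1)[OF bc]] rep_add[OF sobolev_op_L0[OF bc(1)] sobolev_op_L0[OF bc(2)]]
      rep_sobolev_op[OF bc(1)] rep_sobolev_op[OF bc(2)] op_density_add[OF bc]
    by (intro L0_eqI[where M = M] L0_add_in sobolev_op_L0 DD_add(1) bc) auto
  show "sobolev_op (der_scale T d M a b) = L0_scale M a (sobolev_op b)" if b: "b \<in> DD" for a b
    using rep_sobolev_op[OF DD_scale(1)[OF b, of a]] rep_scale[OF sobolev_op_L0[OF b], of a] rep_sobolev_op[OF b] op_density_scale[OF b, of a]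
    by (intro L0_eqI[where M = M] L0_scale_in sobolev_op_L0 DD_scale(1) b) auto
  show "sobolev_op (der_fmult T d M h b) = L0_fmult M h (sobolev_op b)" if h: "h \<in> Lipb T d" and b: "b \<in> DD" for h b
    using rep_sobolev_op[OF DD_fmult[OF b h]] rep_fmult[OF sobolev_op_L0[OF b] Lipb_measurable[OF h]] rep_sobolev_op[OF b] op_density_fmult[OF b h]
    by (intro L0_eqI[where M = M] L0_fmult_in sobolev_op_L0 DD_fmult b h Lipb_measurable) auto
  have "ae_class M g \<in> sobolev_bounds T d M p q sobolev_op"
    unfolding sobolev_bounds_def Lp_nonneg_def
  proof (intro CollectI conjI ballI)
    note r = rep_ae_class[OF Lpf_measurable[OF g(1)]]
    show "ae_class M g \<in> Lp M p" using g(1) p by (intro ae_class_in_Lp) auto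
    show "AE x in M. 0 \<le> rep (ae_class M g) x" using r by eventually_elim (simp add: g(2))
    show "AE x in M. \<bar>rep (sobolev_op b) x\<bar> \<le> rep (ae_class M g) x * rep (der_abs T d M q b) x" if b: "b \<in> DD" for b
      using r rep_sobolev_op[OF b] g(3)[OF b] by eventually_elim (simp add: der_len_def)
  qed
  then show "sobolev_bounds T d M p q sobolev_op \<noteq> {}" by blast
  show "(\<integral>x. rep (sobolev_op b) x \<partial>M) = - (\<integral>x. rep sobolev_class x * rep (divergence T d M b) x \<partial>M)" if b: "b \<in> DD" for b
  proof -
    have "(\<integral>x. rep (sobolev_op b) x \<partial>M) = (\<integral>x. op_density b x \<partial>M)"
      using rep_sobolev_op[OF b] op_density(1)[OF b] rep_measurable[OF sobolev_op_L0[OF b]] by (intro integral_cong_AE) auto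
    also have "\<dots> = vpart b" by (rule op_density_integral[OF b, symmetric])
    \<comment> \<open>This is the vanishing of \<open>\<psi>\<close> at the graph point
      \<open>(div(b), b)\<close>, split into its two parts.\<close>
    also have "\<dots> = - gpart (div_fun b)"
      using psi_split[OF DD_props(1)[OF b] DD_TX[OF b]] graph0[OF graphI[OF b]]
      by (simp add: vpart_def gpart_def div_fun_def ae_class_rep[OF Lp_L0[OF DD_props(1)[OF b]]])
    finally show ?thesis using sobolev_class_integral[OF DD_props(2)[OF b]] by (simp add: div_fun_def)
  qed
qed

text \<open>The gradient is minimal, hence below the bound just constructed, and the joint estimate
  controls both terms of the Sobolev norm at once.\<close>

lemma sobolev_class_norm: "sobolev_class \<in> nvec W" "nnorm W sobolev_class \<le> K"
proof -
  obtain g where g: "g \<in> Lpf M p" "\<And>x. 0 \<le> g x" "\<And>b. b \<in> DD \<Longrightarrow> AE x in M. \<bar>op_density b x\<bar> \<le> g x * der_len b x"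
    "(\<integral>x. \<bar>fun_density x\<bar> powr p \<partial>M) + (\<integral>x. g x powr p \<partial>M) \<le> K powr p"
    using ex_gradient_bound by blast
  have L: "is_sobolev_operator T d M p q sobolev_class sobolev_op" using g(1-3) by (rule is_sobolev_operator_sobolev_op)
  then show "sobolev_class \<in> nvec W" using rep_sobolev_class(2) by (auto simp: W_iff)
  define G where "G = rep (sobolev_gradient T d M p q sobolev_class)"
  note Gp = sobolev_gradient_props[OF L, folded G_def]
  have "AE x in M. G x \<le> g x"
  proof (rule Gp(4)[OF g(1)])
    show "AE x in M. \<bar>rep (sobolev_op b) x\<bar> \<le> g x * der_len b x" if b: "b \<in> DD" for b
      using rep_sobolev_op[OF b] g(3)[OF b] by eventually_elim simp
  qed (simp add: g(2))
  then have "AE x in M. \<bar>G x\<bar> \<le> \<bar>g x\<bar>" using Gp(2) by eventually_elim simp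
  then have "Npf M p G \<le> Npf M p g"
    using p by (intro Lpf_mono(2)[OF g(1) Lpf_measurable[OF Gp(1)]]) auto
  then have "Npf M p G powr p \<le> Npf M p g powr p" using p by (intro powr_mono2) (auto simp: Npf_nonneg)
  also have "\<dots> = (\<integral>x. g x powr p \<partial>M)" using p g(2) by (simp add: Npf_powr)
  finally have "Npf M p (rep sobolev_class) powr p + Npf M p G powr p \<le> K powr p"
    using g(4) p by (simp add: rep_sobolev_class Npf_powr)
  then show "nnorm W sobolev_class \<le> K"
    unfolding norm_W G_def[symmetric] using p K by (subst powr_inverse_le_iff) auto
qed

end

section \<open>The isometry\<close>

context emtm_conjugate
begin

lemma sobolev_of_functional:
  assumes phi: "\<phi> \<in> nvec Q'"
  shows "\<exists>f. represents f \<phi> \<and> nnorm W f \<le> nnorm Q' \<phi>"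
proof -
  interpret Q: seminormed_nspace "quotient_nspace P B" by (rule P.seminormed_quotient[OF B_nsubspace])
  have K: "0 \<le> nnorm Q' \<phi>" using phi Q.dual_norm_nonneg by (auto simp: Q.dual_nvec_iff)
  interpret F: emtm_functional T d M q p "\<lambda>v. \<phi> (P.coset B v)" "nnorm Q' \<phi>"
    by unfold_locales
       (use P.dual_quotientD[OF B_nsubspace phi] K graph_B in auto)
  have "\<phi> (P.coset B (g, zero_der)) = (\<integral>x. rep F.sobolev_class x * rep g x \<partial>M)" if g: "g \<in> Lp M q" for g
    using F.sobolev_class_integral[of "rep g"] g by (simp add: Lp_iff F.gpart_def ae_class_rep)
  then show ?thesis using F.sobolev_class_norm phi by (auto simp: represents_def)
qed

lemma normed_Q': "normed_nspace Q'"
proof -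
  interpret Q: seminormed_nspace "quotient_nspace P B" by (rule P.seminormed_quotient[OF B_nsubspace])
  show ?thesis by (rule Q.normed_dual)
qed

text \<open>Each construction gives one inequality; uniqueness on the respective side identifies its
  outcome with the given partner.\<close>

lemma represents_norm:
  assumes "represents f \<phi>"
  shows "nnorm Q' \<phi> = nnorm W f"
proof (rule antisym)
  have in_WQ: "f \<in> nvec W" "\<phi> \<in> nvec Q'" using assms by (simp_all add: represents_def)
  obtain \<phi>' where "represents f \<phi>'" "nnorm Q' \<phi>' \<le> nnorm W f"
    using functional_of_sobolev[OF in_WQ(1)] by blast
  then show "nnorm Q' \<phi> \<le> nnorm W f" using represents_right_unique assms by metis
  obtain f' where f': "represents f' \<phi>" "nnorm W f' \<le> nnorm Q' \<phi>"
    using sobolev_of_functional[OF in_WQ(2)] by blast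
  have "f' = f"
    using f'(1) assms by (intro represents_left_unique[OF f'(1)]) (auto simp: represents_def W_iff)
  then show "nnorm W f \<le> nnorm Q' \<phi>" using f' by simp
qed

text \<open>The sum of the functionals is represented by some Sobolev function, and its integrals
  identify that function with the sum. Closure of the Sobolev space under addition is a
  by-product.\<close>

lemma represents_add:
  assumes f: "represents f \<phi>" and f': "represents f' \<phi>'"
  shows "represents (nadd W f f') (nadd Q' \<phi> \<phi>')"
proof -
  interpret Q': normed_nspace Q' by (rule normed_Q')
  have phi: "\<phi> \<in> nvec Q'" "\<phi>' \<in> nvec Q'" and fL: "f \<in> Lp M p" "f' \<in> Lp M p"
    using assms by (auto simp: represents_def W_iff)
  obtain k where k: "represents k (nadd Q' \<phi> \<phi>')" using sobolev_of_functional[OF Q'.add_closed[OF phi]] by blast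
  have "k = L0_add M f f'"
  proof (rule represents_left_unique[OF k])
    show "L0_add M f f' \<in> Lp M p" using fL p by (intro Lp_add) auto
    fix g assume g: "g \<in> Lp M q"
    have i: "integrable M (\<lambda>x. rep u x * rep g x)" if "u \<in> Lp M p" for u
      using that g by (intro Holder[OF p q conj]) (auto simp: Lp_iff)
    have "P.coset B (g, zero_der) \<in> nvec (quotient_nspace P B)"
      using g zero_der_TX by (auto simp: P.quotient_nvec[OF B_nsubspace] P_simps)
    then have "nadd Q' \<phi> \<phi>' (P.coset B (g, zero_der)) = \<phi> (P.coset B (g, zero_der)) + \<phi>' (P.coset B (g, zero_der))"
      by (simp add: dual_nspace_def)
    also have "\<dots> = (\<integral>x. rep f x * rep g x + rep f' x * rep g x \<partial>M)"
      using f f' g i fL by (simp add: represents_def)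
    also have "\<dots> = (\<integral>x. rep (L0_add M f f') x * rep g x \<partial>M)"
      using rep_add[OF Lp_L0[OF fL(1)] Lp_L0[OF fL(2)]] i[OF fL(1)] i[OF fL(2)] i[of "L0_add M f f'"] fL p Lp_add[of f M p f']
      by (intro integral_cong_AE) (auto simp: distrib_right elim!: eventually_mono)
    finally show "nadd Q' \<phi> \<phi>' (P.coset B (g, zero_der)) = (\<integral>x. rep (L0_add M f f') x * rep g x \<partial>M)" .
  qed
  then show ?thesis using k by (simp add: W1p_nspace_def)
qed

lemma represents_scale:
  assumes f: "represents f \<phi>"
  shows "represents (nscale W c f) (nscale Q' c \<phi>)"
proof -
  interpret Q': normed_nspace Q' by (rule normed_Q')
  have phi: "\<phi> \<in> nvec Q'" and fL: "f \<in> Lp M p"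
    using assms by (auto simp: represents_def W_iff)
  obtain k where k: "represents k (nscale Q' c \<phi>)" using sobolev_of_functional[OF Q'.scale_closed[OF phi]] by blast
  have "k = L0_scale M c f"
  proof (rule represents_left_unique[OF k])
    show cL: "L0_scale M c f \<in> Lp M p" using fL p by (intro Lp_scale) auto
    fix g assume g: "g \<in> Lp M q"
    have i: "integrable M (\<lambda>x. rep u x * rep g x)" if "u \<in> Lp M p" for u
      using that g by (intro Holder[OF p q conj]) (auto simp: Lp_iff)
    have "P.coset B (g, zero_der) \<in> nvec (quotient_nspace P B)"
      using g zero_der_TX by (auto simp: P.quotient_nvec[OF B_nsubspace] P_simps)
    then have "nscale Q' c \<phi> (P.coset B (g, zero_der)) = c * \<phi> (P.coset B (g, zero_der))"
      by (simp add: dual_nspace_def)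
    also have "\<dots> = (\<integral>x. c * (rep f x * rep g x) \<partial>M)"
      using f g by (simp add: represents_def)
    also have "\<dots> = (\<integral>x. rep (L0_scale M c f) x * rep g x \<partial>M)"
      using rep_scale[OF Lp_L0[OF fL], of c] i[OF fL] i[OF cL]
      by (intro integral_cong_AE) (auto elim!: eventually_mono)
    finally show "nscale Q' c \<phi> (P.coset B (g, zero_der)) = (\<integral>x. rep (L0_scale M c f) x * rep g x \<partial>M)" .
  qed
  then show ?thesis using k by (simp add: W1p_nspace_def)
qed

text \<open>Right uniqueness makes the relation a map, the two existence results make it total and
  onto, and left uniqueness makes it injective.\<close>

lemma W_isometric_dual: "isometrically_isomorphic W Q'"
proof -
  define \<Phi> where "\<Phi> f = (THE \<phi>. represents f \<phi>)" for f
  have Phi_eq: "\<Phi> f = \<phi>" if "represents f \<phi>" for f \<phi>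
    unfolding \<Phi>_def using that represents_right_unique by (intro the_equality)
  have ex: "represents f (\<Phi> f)" if "f \<in> nvec W" for f
    using functional_of_sobolev[OF that] Phi_eq by auto
  have inD: "f \<in> nvec W" "\<phi> \<in> nvec Q'" if "represents f \<phi>" for f \<phi>
    using that by (auto simp: represents_def)
  show ?thesis
  proof (rule isometrically_isomorphicI[OF normed_Q'])
    show "linear_between W Q' \<Phi>"
      unfolding linear_between_def
      using Phi_eq[OF represents_add[OF ex ex]] Phi_eq[OF represents_scale[OF ex]] inD(2)[OF ex] by blast
    show "nadd W x y \<in> nvec W" if "x \<in> nvec W" "y \<in> nvec W" for x y
      using represents_add[OF ex[OF that(1)] ex[OF that(2)]] inD by blast
    show "nscale W c x \<in> nvec W" if "x \<in> nvec W" for c x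
      using represents_scale[OF ex[OF that]] inD by blast
    show "nnorm Q' (\<Phi> x) = nnorm W x" if "x \<in> nvec W" for x
      by (rule represents_norm[OF ex[OF that]])
    show "bij_betw \<Phi> (nvec W) (nvec Q')"
      unfolding bij_betw_def
    proof
      show "inj_on \<Phi> (nvec W)"
      proof (rule inj_onI)
        fix x y assume xy: "x \<in> nvec W" "y \<in> nvec W" "\<Phi> x = \<Phi> y"
        then have "represents y (\<Phi> x)" using ex[OF xy(2)] by simp
        then show "x = y" by (intro represents_left_unique[OF ex[OF xy(1)]]) (auto simp: represents_def W_iff)
      qed
      show "\<Phi> ` nvec W = nvec Q'"
      proof
        show "\<Phi> ` nvec W \<subseteq> nvec Q'" using inD(2)[OF ex] by blast
        show "nvec Q' \<subseteq> \<Phi> ` nvec W"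
          using sobolev_of_functional Phi_eq inD(1) by (metis image_eqI subsetI)
      qed
    qed
  qed
qed

end

theorem theorem5p10:
  fixes T :: "'a topology" and d :: "'a \<Rightarrow> 'a \<Rightarrow> ennreal" and M :: "'a measure"
    and p q :: real
  assumes "emtm_space T d M"
    and "1 < p" and "1 < q" and "1 / p + 1 / q = 1"
  shows "isometrically_isomorphic
    (W1p_nspace T d M p q)
    (dual_nspace (quotient_nspace (LqLLip_nspace T d M q) (BXq T d M q)))"
proof -
  interpret emtm_conjugate T d M q p
    using assms by unfold_locales
  show ?thesis by (rule W_isometric_dual)
qed

end
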